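(* Let $\mathcal O$ be a modular operad and let $V$ be a contractible dg vector space with an inner product and a structure of an $\mathcal O$-algebra. Then the class $[V]$ (in the cohomology of $\mathsf F^\vee\mathcal O((0))$, equivalently in the homology of $\mathsf F\mathcal O((0))$) produced from $V$ by Kontsevich's dual construction does not depend on the choice of the contracting homotopy $s$.
   Context: **Conventions.** $\mathbf k$ is a field of characteristic zero; vector spaces are $\mathbb Z/2$-graded, "dg" means differential $\mathbb Z/2$-graded, $\Pi$ is parity reversion. Modular operads, stable graphs and the Feynman transform $\mathsf F$ are in the sense of Getzler–Kapranov, "Modular operads". A stable graph without legs, of genus $g$, is a connected graph with a genus $g(v)\ge0$ on each vertex, with $2g(v)-2+n(v)>0$ ($n(v)$ the valence) and $g=\sum_vg(v)+\dim H_1(G)$. $\mathrm{Edge}(G)$ is the set of edges; $\mathcal O((G))=\bigotimes_v\mathcal O((g(v),\mathrm{Flag}(v)))$, where $\mathrm{Flag}(v)$ is the set of half-edges at $v$; $\mathfrak K(G)=\Pi^{m}\Lambda^{m}\mathbf k^{\mathrm{Edge}(G)}$, $m=|\mathrm{Edge}(G)|$. **Algebras.** $V$ is a finite-dimensional dg vector space with an even nondegenerate symmetric inner product $\langle,\rangle$ compatible with the differential. $\mathcal E(V)$ is the modular endomorphism operad, $\mathcal E(V)((g,n))=V^{\otimes n}$, with composition given by contraction with $\langle,\rangle$. An $\mathcal O$-algebra structure on $V$ is a map of modular operads $\mathcal O\to\mathcal E(V)$. $V$ is contractible if $H(V)=0$. A contracting homotopy here is an odd operator $s:V\to V$ with $s^2=0$,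 $ds+sd=\mathrm{id}_V$ and $\langle s(a),b\rangle=(-1)^{|a|}\langle a,s(b)\rangle$. **Dual Feynman transform (part without legs).** $\mathsf F^\vee\mathcal O((g,0))=\bigoplus_G(\mathfrak K(G)\otimes\mathcal O((G)))_{\mathrm{Aut}(G)}$, the sum over isomorphism classes of stable graphs of genus $g$ without legs, with differential the sum of the internal differential of $\mathcal O$ and of the contractions of all edges using the composition in $\mathcal O$; $\mathsf F^\vee\mathcal O((0))$ denotes the collection (direct sum) over all $g$. The complex $\mathsf F\mathcal O((g,0))$ is the linear dual of $\mathsf F^\vee\mathcal O((g,0))$. **Dual construction and $[V]$.** Given a contractible $\mathcal O$-algebra $V$ and a contracting homotopy $s$, the Feynman amplitude $Z_V:\mathsf F^\vee\mathcal O((0))\to\mathbf k$ of an $\mathcal O$-decorated graph $G$ is computed by replacing the decoration at each vertex by a tensor in $V^{\otimes n(v)}$ via the action $\mathcal O\to\mathcal E(V)$, and contracting these tensors along all edges of $G$ with the form $\langle ?,s(?)\rangle$ (the factor $\mathfrak K(G)$ accounting for $s$ being odd). $Z_V$ is a cocycle on $\mathsf F^\vee\mathcal O((0))$, i.e. a cycle in $\mathsf F\mathcal O((0))$; $[V]$ denotes its (co)homology class. *)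

theory Defs
  imports Complex_Main "HOL-Library.Poly_Mapping" "HOL-Library.Z2"
begin

section \<open>Signs and free vector spaces\<close>

text \<open>Parities are elements of the field \<^typ>\<open>bit\<close>, so that the Koszul sign for interchanging
  homogeneous elements of parities \<open>p\<close> and \<open>q\<close> is \<open>psign (p * q)\<close>.\<close>

definition psign :: "bit \<Rightarrow> 'k::field_char_0" where
  "psign p = (if p = 0 then 1 else - 1)"

text \<open>The exponent of the Koszul sign for bringing the elements of a list that satisfy \<open>P\<close> to the
  front, both parts keeping their order: one contribution \<open>par x * par y\<close> for each \<open>x\<close>
  outside \<open>P\<close> that precedes a \<open>y\<close> in \<open>P\<close>.\<close>

fun unshuffle_par :: "('a \<Rightarrow> bit) \<Rightarrow> ('a \<Rightarrow> bool) \<Rightarrow> 'a list \<Rightarrow> bit" where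
  "unshuffle_par par P [] = 0"
| "unshuffle_par par P (x # xs) =
     (if P x then 0 else par x * sum_list (map par (filter P xs))) + unshuffle_par par P xs"

text \<open>\<^typ>\<open>'a \<Rightarrow>\<^sub>0 'k\<close> is the vector space with basis \<^typ>\<open>'a\<close>.\<close>

abbreviation "keys \<equiv> Poly_Mapping.keys"
abbreviation "lookup \<equiv> Poly_Mapping.lookup"
abbreviation "single \<equiv> Poly_Mapping.single"

definition pscale :: "'k::field_char_0 \<Rightarrow> ('a \<Rightarrow>\<^sub>0 'k) \<Rightarrow> ('a \<Rightarrow>\<^sub>0 'k)" where
  "pscale c f = Poly_Mapping.map ((*) c) f"

lemma lookup_pscale [simp]: "lookup (pscale c f) x = c * lookup f x"
  by (simp add: pscale_def Poly_Mapping.map.rep_eq when_def)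

lemma vector_space_pscale: "vector_space pscale"
  by unfold_locales (auto intro!: poly_mapping_eqI simp: lookup_add algebra_simps)

definition lin_ext :: "('a \<Rightarrow> ('b \<Rightarrow>\<^sub>0 'k)) \<Rightarrow> ('a \<Rightarrow>\<^sub>0 'k::field_char_0) \<Rightarrow> ('b \<Rightarrow>\<^sub>0 'k)" where
  "lin_ext f c = (\<Sum>x\<in>keys c. pscale (lookup c x) (f x))"

definition lin_ext_scalar :: "('a \<Rightarrow> 'k) \<Rightarrow> ('a \<Rightarrow>\<^sub>0 'k::field_char_0) \<Rightarrow> 'k" where
  "lin_ext_scalar f c = (\<Sum>x\<in>keys c. lookup c x * f x)"


section \<open>Graded and dg vector spaces\<close>

text \<open>A graded vector space is given by its two homogeneous parts, independent subspaces of an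
  ambient vector space.\<close>

definition graded_space :: "('k::field_char_0 \<Rightarrow> 'v::ab_group_add \<Rightarrow> 'v) \<Rightarrow> (bit \<Rightarrow> 'v set) \<Rightarrow> bool" where
  "graded_space scale A \<longleftrightarrow>
     vector_space scale \<and> (\<forall>p. module.subspace scale (A p)) \<and> A 0 \<inter> A 1 = {0}"

text \<open>\<open>f\<close> is a linear map from the graded space \<open>A\<close> to \<open>B\<close> of parity \<open>q\<close>.\<close>

definition graded_map ::
  "('k \<Rightarrow> 'v::ab_group_add \<Rightarrow> 'v) \<Rightarrow> (bit \<Rightarrow> 'v set) \<Rightarrow> ('k \<Rightarrow> 'w::ab_group_add \<Rightarrow> 'w) \<Rightarrow> (bit \<Rightarrow> 'w set) \<Rightarrow>
   bit \<Rightarrow> ('v \<Rightarrow> 'w) \<Rightarrow> bool" where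
  "graded_map sA A sB B q f \<longleftrightarrow>
     (\<forall>p. \<forall>x\<in>A p. f x \<in> B (p + q)) \<and>
     (\<forall>p. \<forall>x\<in>A p. \<forall>y\<in>A p. f (x + y) = f x + f y) \<and>
     (\<forall>p. \<forall>x\<in>A p. \<forall>c. f (sA c x) = sB c (f x))"

definition dg_space ::
  "('k::field_char_0 \<Rightarrow> 'v::ab_group_add \<Rightarrow> 'v) \<Rightarrow> (bit \<Rightarrow> 'v set) \<Rightarrow> ('v \<Rightarrow> 'v) \<Rightarrow> bool" where
  "dg_space scale A d \<longleftrightarrow>
     graded_space scale A \<and> graded_map scale A scale A 1 d \<and> (\<forall>p. \<forall>x\<in>A p. d (d x) = 0)"


section \<open>Stable graphs\<close>

text \<open>A graph is a list of vertices, each given by its genus and its set of flags (half-edges),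
  together with a list of edges, each a set of two flags; the flags in no edge are the legs.
  The two lists carry an enumeration of the vertices and of the edges, which is used to
  express tensor products over vertices and top exterior powers of the edge space.  All
  constructions below are made invariant under change of enumeration, with the appropriate
  signs.  Since the flags at a vertex are recorded as a set of labels, an isomorphism of graphs
  is an injective renaming of the flags combined with reorderings of the two lists.\<close>

type_synonym graph = "(nat \<times> nat set) list \<times> nat set list"

definition stable :: "nat \<Rightarrow> nat set \<Rightarrow> bool" where
  "stable g I \<longleftrightarrow> finite I \<and> 2 * g + card I > 2"

definition graph_flags :: "graph \<Rightarrow> nat set" where
  "graph_flags G = (\<Union>v\<in>set (fst G). snd v)"

definition graph_legs :: "graph \<Rightarrow> nat set" where
  "graph_legs G = graph_flags G - \<Union>(set (snd G))"

definition adjacent :: "graph \<Rightarrow> (nat \<times> nat) set" where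
  "adjacent G = {(i, j). i < length (fst G) \<and> j < length (fst G) \<and>
     (\<exists>e\<in>set (snd G). e \<inter> snd (fst G ! i) \<noteq> {} \<and> e \<inter> snd (fst G ! j) \<noteq> {})}"

definition graph_connected :: "graph \<Rightarrow> bool" where
  "graph_connected G \<longleftrightarrow> fst G \<noteq> [] \<and>
     (\<forall>i<length (fst G). \<forall>j<length (fst G). (i, j) \<in> (adjacent G)\<^sup>*)"

text \<open>For a connected graph, \<open>dim H\<^sub>1 = |E| - |V| + 1\<close>, which is never negative.\<close>

definition graph_genus :: "graph \<Rightarrow> nat" where
  "graph_genus G = sum_list (map fst (fst G)) + (length (snd G) + 1 - length (fst G))"

definition stable_graph :: "graph \<Rightarrow> bool" where
  "stable_graph G \<longleftrightarrow>
     (\<forall>v\<in>set (fst G). stable (fst v) (snd v)) \<and>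
     (\<forall>i<length (fst G). \<forall>j<length (fst G). i \<noteq> j \<longrightarrow> snd (fst G ! i) \<inter> snd (fst G ! j) = {}) \<and>
     distinct (snd G) \<and>
     (\<forall>e\<in>set (snd G). card e = 2 \<and> e \<subseteq> graph_flags G) \<and>
     (\<forall>e\<in>set (snd G). \<forall>f\<in>set (snd G). e \<noteq> f \<longrightarrow> e \<inter> f = {}) \<and>
     graph_connected G"


section \<open>Modular operads\<close>

text \<open>A vertex together with a homogeneous decoration.\<close>

datatype 'o vertex = Vertex (vgenus: nat) (vflags: "nat set") (vpar: bit) (vdec: 'o)

type_synonym 'o dgraph = "'o vertex list \<times> nat set list"

definition underlying :: "'o vertex \<Rightarrow> nat \<times> nat set" where
  "underlying v = (vgenus v, vflags v)"

definition underlying_graph :: "'o dgraph \<Rightarrow> graph" where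
  "underlying_graph \<Gamma> = (map underlying (fst \<Gamma>), snd \<Gamma>)"

text \<open>The data of a modular operad, as a functor of finite sets \<open>I\<close> of labels:
  \<open>ospace \<O> g I p\<close> is the part of parity \<open>p\<close> of \<open>\<O>((g,I))\<close>, with differential \<open>odiff \<O> g I\<close>;
  \<open>oact \<O> g I \<sigma> : \<O>((g,I)) \<rightarrow> \<O>((g,\<sigma>(I)))\<close> is the action of an injection \<open>\<sigma>\<close> of \<open>I\<close> into the
  labels; and \<open>ocomp \<O> G : \<O>((G)) \<rightarrow> \<O>((g,I))\<close>, for every stable graph \<open>G\<close> of genus \<open>g\<close> with set
  of legs \<open>I\<close>, is the structure map, evaluated at \<open>x\<^sub>1 \<otimes> ... \<otimes> x\<^sub>k\<close> with \<open>x\<^sub>i\<close> the decoration of the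
  \<open>i\<close>-th vertex.  The \<open>S\<^sub>n\<close>-module \<open>\<O>((g,n))\<close> is the value at \<open>I = {1..n}\<close>.\<close>

record ('k, 'o) modop =
  oscale :: "'k \<Rightarrow> 'o \<Rightarrow> 'o"
  ospace :: "nat \<Rightarrow> nat set \<Rightarrow> bit \<Rightarrow> 'o set"
  odiff :: "nat \<Rightarrow> nat set \<Rightarrow> 'o \<Rightarrow> 'o"
  oact :: "nat \<Rightarrow> nat set \<Rightarrow> (nat \<Rightarrow> nat) \<Rightarrow> 'o \<Rightarrow> 'o"
  ocomp :: "graph \<Rightarrow> 'o list \<Rightarrow> 'o"

definition decorated :: "('k, 'o) modop \<Rightarrow> 'o dgraph \<Rightarrow> bool" where
  "decorated \<O> \<Gamma> \<longleftrightarrow> stable_graph (underlying_graph \<Gamma>) \<and>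
     (\<forall>v\<in>set (fst \<Gamma>). vdec v \<in> ospace \<O> (vgenus v) (vflags v) (vpar v))"

definition relabel :: "('k, 'o) modop \<Rightarrow> (nat \<Rightarrow> nat) \<Rightarrow> 'o vertex \<Rightarrow> 'o vertex" where
  "relabel \<O> \<phi> v =
     Vertex (vgenus v) (\<phi> ` vflags v) (vpar v) (oact \<O> (vgenus v) (vflags v) \<phi> (vdec v))"

definition relabel_graph :: "('k, 'o) modop \<Rightarrow> (nat \<Rightarrow> nat) \<Rightarrow> 'o dgraph \<Rightarrow> 'o dgraph" where
  "relabel_graph \<O> \<phi> \<Gamma> = (map (relabel \<O> \<phi>) (fst \<Gamma>), map ((`) \<phi>) (snd \<Gamma>))"

definition compose :: "('k, 'o) modop \<Rightarrow> 'o dgraph \<Rightarrow> 'o" where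
  "compose \<O> \<Gamma> = ocomp \<O> (underlying_graph \<Gamma>) (map vdec (fst \<Gamma>))"

text \<open>The decorated corolla obtained by contracting all edges of a decorated graph.\<close>

definition collapse :: "('k, 'o) modop \<Rightarrow> 'o dgraph \<Rightarrow> 'o vertex" where
  "collapse \<O> \<Gamma> = Vertex (graph_genus (underlying_graph \<Gamma>)) (graph_legs (underlying_graph \<Gamma>))
     (sum_list (map vpar (fst \<Gamma>))) (compose \<O> \<Gamma>)"

definition vertex_diff :: "('k, 'o) modop \<Rightarrow> 'o vertex \<Rightarrow> 'o vertex" where
  "vertex_diff \<O> v =
     Vertex (vgenus v) (vflags v) (vpar v + 1) (odiff \<O> (vgenus v) (vflags v) (vdec v))"

text \<open>A modular operad is an algebra over the triple \<open>M\<close> of Getzler and Kapranov, where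
  \<open>(M \<O>)((g,I))\<close> is the colimit of the spaces \<open>\<O>((G))\<close> over the groupoid of stable graphs \<open>G\<close> of
  genus \<open>g\<close> with legs \<open>I\<close>.  The assumptions \<open>act_*\<close> describe the underlying stable
  \<open>S\<close>-module; \<open>comp_add\<close> to \<open>comp_relabel\<close> say that the structure maps are well defined
  morphisms \<open>(M \<O>)((g,I)) \<rightarrow> \<O>((g,I))\<close> of stable \<open>S\<close>-modules (for a reordering of the vertices this
  involves the Koszul sign of the tensor product \<open>\<O>((G))\<close>); \<open>comp_unit\<close> and \<open>comp_assoc\<close> are the axioms
  of an algebra.  In the latter, the graph whose vertices are the decorated graphs \<open>\<Gamma>s\<close>, and whose
  edges are \<open>es\<close>, is flattened.\<close>

locale modular_operad =
  fixes \<O> :: "('k::field_char_0, 'o::ab_group_add) modop"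
  assumes dg: "stable g I \<Longrightarrow> dg_space (oscale \<O>) (ospace \<O> g I) (odiff \<O> g I)"
    and act_map: "\<lbrakk>stable g I; inj_on \<sigma> I\<rbrakk> \<Longrightarrow>
      graded_map (oscale \<O>) (ospace \<O> g I) (oscale \<O>) (ospace \<O> g (\<sigma> ` I)) 0 (oact \<O> g I \<sigma>)"
    and act_diff: "\<lbrakk>stable g I; inj_on \<sigma> I; x \<in> ospace \<O> g I p\<rbrakk> \<Longrightarrow>
      odiff \<O> g (\<sigma> ` I) (oact \<O> g I \<sigma> x) = oact \<O> g I \<sigma> (odiff \<O> g I x)"
    and act_cong: "\<lbrakk>stable g I; inj_on \<sigma> I; \<forall>i\<in>I. \<sigma> i = \<tau> i; x \<in> ospace \<O> g I p\<rbrakk> \<Longrightarrow>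
      oact \<O> g I \<sigma> x = oact \<O> g I \<tau> x"
    and act_id: "\<lbrakk>stable g I; x \<in> ospace \<O> g I p\<rbrakk> \<Longrightarrow> oact \<O> g I id x = x"
    and act_comp: "\<lbrakk>stable g I; inj_on \<sigma> I; inj_on \<tau> (\<sigma> ` I); x \<in> ospace \<O> g I p\<rbrakk> \<Longrightarrow>
      oact \<O> g I (\<tau> \<circ> \<sigma>) x = oact \<O> g (\<sigma> ` I) \<tau> (oact \<O> g I \<sigma> x)"
    and comp_mem: "decorated \<O> \<Gamma> \<Longrightarrow> compose \<O> \<Gamma> \<in>
      ospace \<O> (graph_genus (underlying_graph \<Gamma>)) (graph_legs (underlying_graph \<Gamma>))
        (sum_list (map vpar (fst \<Gamma>)))"
    and comp_add: "\<lbrakk>decorated \<O> (us @ Vertex g I p x # ws, es);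
        decorated \<O> (us @ Vertex g I p y # ws, es)\<rbrakk> \<Longrightarrow>
      compose \<O> (us @ Vertex g I p (x + y) # ws, es) =
      compose \<O> (us @ Vertex g I p x # ws, es) + compose \<O> (us @ Vertex g I p y # ws, es)"
    and comp_scale: "decorated \<O> (us @ Vertex g I p x # ws, es) \<Longrightarrow>
      compose \<O> (us @ Vertex g I p (oscale \<O> c x) # ws, es) =
      oscale \<O> c (compose \<O> (us @ Vertex g I p x # ws, es))"
    and comp_diff: "decorated \<O> (vs, es) \<Longrightarrow>
      odiff \<O> (graph_genus (underlying_graph (vs, es))) (graph_legs (underlying_graph (vs, es)))
        (compose \<O> (vs, es)) =
      (\<Sum>i<length vs. oscale \<O> (psign (sum_list (map vpar (take i vs))))
        (compose \<O> (vs[i := vertex_diff \<O> (vs ! i)], es)))"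
    and comp_swap: "decorated \<O> (us @ v # w # ws, es) \<Longrightarrow>
      compose \<O> (us @ w # v # ws, es) =
      oscale \<O> (psign (vpar v * vpar w)) (compose \<O> (us @ v # w # ws, es))"
    and comp_edges: "\<lbrakk>decorated \<O> (vs, es); distinct es'; set es' = set es\<rbrakk> \<Longrightarrow>
      compose \<O> (vs, es') = compose \<O> (vs, es)"
    and comp_relabel: "\<lbrakk>decorated \<O> \<Gamma>; inj_on \<phi> (graph_flags (underlying_graph \<Gamma>))\<rbrakk> \<Longrightarrow>
      collapse \<O> (relabel_graph \<O> \<phi> \<Gamma>) = relabel \<O> \<phi> (collapse \<O> \<Gamma>)"
    and comp_unit: "decorated \<O> ([v], []) \<Longrightarrow> compose \<O> ([v], []) = vdec v"
    and comp_assoc: "\<lbrakk>\<forall>\<Gamma>\<in>set \<Gamma>s. decorated \<O> \<Gamma>; decorated \<O> (map (collapse \<O>) \<Gamma>s, es);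
        decorated \<O> (concat (map fst \<Gamma>s), es @ concat (map snd \<Gamma>s))\<rbrakk> \<Longrightarrow>
      compose \<O> (concat (map fst \<Gamma>s), es @ concat (map snd \<Gamma>s)) =
      compose \<O> (map (collapse \<O>) \<Gamma>s, es)"


section \<open>Dg spaces with an inner product and contracting homotopies\<close>

record ('k, 'v) ipdg =
  vscale :: "'k \<Rightarrow> 'v \<Rightarrow> 'v"
  vspace :: "bit \<Rightarrow> 'v set"
  vdiff :: "'v \<Rightarrow> 'v"
  vform :: "'v \<Rightarrow> 'v \<Rightarrow> 'k"

text \<open>The underlying vector space is the whole type \<^typ>\<open>'v\<close>.  Compatibility of the form with
  the differential means that it is a chain map \<open>V \<otimes> V \<rightarrow> k\<close>.\<close>

locale inner_dg_space =
  fixes V :: "('k::field_char_0, 'v::ab_group_add) ipdg"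
  assumes finite_dim: "\<exists>B. finite_dimensional_vector_space (vscale V) B"
    and dg: "dg_space (vscale V) (vspace V) (vdiff V)"
    and total: "\<exists>a\<in>vspace V 0. \<exists>b\<in>vspace V 1. v = a + b"
    and diff_linear: "Vector_Spaces.linear (vscale V) (vscale V) (vdiff V)"
    and form_linear_left: "Vector_Spaces.linear (vscale V) (*) (\<lambda>u. vform V u w)"
    and form_linear_right: "Vector_Spaces.linear (vscale V) (*) (vform V w)"
    and form_even: "\<lbrakk>u \<in> vspace V p; w \<in> vspace V q; p \<noteq> q\<rbrakk> \<Longrightarrow> vform V u w = 0"
    and form_sym: "\<lbrakk>u \<in> vspace V p; w \<in> vspace V q\<rbrakk> \<Longrightarrow> vform V u w = psign (p * q) * vform V w u"
    and form_nondegenerate: "(\<And>w. vform V u w = 0) \<Longrightarrow> u = 0"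
    and form_diff: "u \<in> vspace V p \<Longrightarrow>
      vform V (vdiff V u) w + psign p * vform V u (vdiff V w) = 0"

definition contractible :: "('k, 'v::ab_group_add) ipdg \<Rightarrow> bool" where
  "contractible V \<longleftrightarrow> (\<forall>v. vdiff V v = 0 \<longrightarrow> (\<exists>u. v = vdiff V u))"

definition contracting_homotopy ::
  "('k::field_char_0, 'v::ab_group_add) ipdg \<Rightarrow> ('v \<Rightarrow> 'v) \<Rightarrow> bool" where
  "contracting_homotopy V s \<longleftrightarrow>
     Vector_Spaces.linear (vscale V) (vscale V) s \<and>
     (\<forall>p. \<forall>v\<in>vspace V p. s v \<in> vspace V (p + 1)) \<and>
     (\<forall>v. s (s v) = 0) \<and>
     (\<forall>v. vdiff V (s v) + s (vdiff V v) = v) \<and>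
     (\<forall>p. \<forall>a\<in>vspace V p. \<forall>b. vform V (s a) b = psign p * vform V a (s b))"


section \<open>The modular endomorphism operad\<close>

text \<open>The tensor power of \<open>V\<close> over an unordered finite set \<open>I\<close> is the quotient of the space of linear
  combinations of words in homogeneous vectors, each labelled by a different element of \<open>I\<close>, by
  multilinearity and by the symmetry constraint of graded vector spaces.  Elements of the quotient are
  given by representatives in \<open>E_space\<close>; two representatives are equal in the quotient iff their
  difference lies in \<open>E_rel\<close>.\<close>

datatype 'v letter = Letter (llabel: nat) (lpar: bit) (lvec: 'v)

definition tensor_words :: "('k, 'v) ipdg \<Rightarrow> nat set \<Rightarrow> 'v letter list set" where
  "tensor_words V I = {w. distinct (map llabel w) \<and> set (map llabel w) = I \<and>
     (\<forall>l\<in>set w. lvec l \<in> vspace V (lpar l))}"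

definition E_space :: "('k::zero, 'v) ipdg \<Rightarrow> nat set \<Rightarrow> bit \<Rightarrow> ('v letter list \<Rightarrow>\<^sub>0 'k) set" where
  "E_space V I p = {t. \<forall>w\<in>keys t. w \<in> tensor_words V I \<and> sum_list (map lpar w) = p}"

definition E_rel ::
  "('k::field_char_0, 'v::ab_group_add) ipdg \<Rightarrow> nat set \<Rightarrow> ('v letter list \<Rightarrow>\<^sub>0 'k) set" where
  "E_rel V I = module.span pscale (
     {single (u @ Letter i p (x + y) # w) 1
        - single (u @ Letter i p x # w) 1 - single (u @ Letter i p y # w) 1 | u i p x y w.
        u @ Letter i p x # w \<in> tensor_words V I \<and> u @ Letter i p y # w \<in> tensor_words V I} \<union>
     {single (u @ Letter i p (vscale V c x) # w) 1 - single (u @ Letter i p x # w) c | u i p x c w.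
        u @ Letter i p x # w \<in> tensor_words V I} \<union>
     {single (u @ l # l' # w) 1 - single (u @ l' # l # w) (psign (lpar l * lpar l')) | u l l' w.
        u @ l # l' # w \<in> tensor_words V I})"

definition E_act ::
  "(nat \<Rightarrow> nat) \<Rightarrow> ('v letter list \<Rightarrow>\<^sub>0 'k::field_char_0) \<Rightarrow> ('v letter list \<Rightarrow>\<^sub>0 'k)" where
  "E_act \<sigma> = lin_ext (\<lambda>w. single (map (\<lambda>l. Letter (\<sigma> (llabel l)) (lpar l) (lvec l)) w) 1)"

definition E_diff ::
  "('k::field_char_0, 'v) ipdg \<Rightarrow> ('v letter list \<Rightarrow>\<^sub>0 'k) \<Rightarrow> ('v letter list \<Rightarrow>\<^sub>0 'k)" where
  "E_diff V = lin_ext (\<lambda>w. \<Sum>i<length w.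
     single (w[i := Letter (llabel (w ! i)) (lpar (w ! i) + 1) (vdiff V (lvec (w ! i)))])
       (psign (sum_list (map lpar (take i w)))))"

definition tensor2 ::
  "('a list \<Rightarrow>\<^sub>0 'k::field_char_0) \<Rightarrow> ('a list \<Rightarrow>\<^sub>0 'k) \<Rightarrow> ('a list \<Rightarrow>\<^sub>0 'k)" where
  "tensor2 s t = (\<Sum>u\<in>keys s. \<Sum>w\<in>keys t. single (u @ w) (lookup s u * lookup t w))"

definition tensor_list :: "('a list \<Rightarrow>\<^sub>0 'k::field_char_0) list \<Rightarrow> ('a list \<Rightarrow>\<^sub>0 'k)" where
  "tensor_list ts = foldr tensor2 ts (single [] 1)"

text \<open>Contraction of a word along an edge \<open>e\<close>: the two letters labelled by the ends of \<open>e\<close> are moved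
  to the front and replaced by the value of the bilinear form \<open>B\<close> on them.\<close>

definition contract_word :: "('v letter \<Rightarrow> 'v letter \<Rightarrow> 'k::field_char_0) \<Rightarrow> nat set \<Rightarrow>
    'v letter list \<Rightarrow> ('v letter list \<Rightarrow>\<^sub>0 'k)" where
  "contract_word B e w =
     (case filter (\<lambda>l. llabel l \<in> e) w of
        [a, b] \<Rightarrow> single (filter (\<lambda>l. llabel l \<notin> e) w)
                   (psign (unshuffle_par lpar (\<lambda>l. llabel l \<in> e) w) * B a b)
      | _ \<Rightarrow> 0)"

text \<open>For \<open>es = [e\<^sub>1, ..., e\<^sub>m]\<close> this is the composite \<open>e\<^sub>1 \<circ> ... \<circ> e\<^sub>m\<close> of contractions, so that for an
  odd form \<open>B\<close> it changes sign when two edges are interchanged.\<close>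

definition contract_edges :: "('v letter \<Rightarrow> 'v letter \<Rightarrow> 'k::field_char_0) \<Rightarrow> nat set list \<Rightarrow>
    ('v letter list \<Rightarrow>\<^sub>0 'k) \<Rightarrow> ('v letter list \<Rightarrow>\<^sub>0 'k)" where
  "contract_edges B es t = foldr (\<lambda>e. lin_ext (contract_word B e)) es t"

definition form_letters :: "('k, 'v) ipdg \<Rightarrow> 'v letter \<Rightarrow> 'v letter \<Rightarrow> 'k" where
  "form_letters V a b = vform V (lvec a) (lvec b)"

definition E_comp :: "('k::field_char_0, 'v) ipdg \<Rightarrow> graph \<Rightarrow>
    ('v letter list \<Rightarrow>\<^sub>0 'k) list \<Rightarrow> ('v letter list \<Rightarrow>\<^sub>0 'k)" where
  "E_comp V G ts = contract_edges (form_letters V) (snd G) (tensor_list ts)"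

text \<open>An \<open>\<O>\<close>-algebra structure on \<open>V\<close>, that is, a map of modular operads \<open>\<O> \<rightarrow> \<E>(V)\<close>; the map
  \<open>\<alpha> g I : \<O>((g,I)) \<rightarrow> \<E>(V)((g,I))\<close> takes values in representatives.\<close>

locale operad_algebra =
  fixes \<O> :: "('k::field_char_0, 'o::ab_group_add) modop"
    and V :: "('k, 'v::ab_group_add) ipdg"
    and \<alpha> :: "nat \<Rightarrow> nat set \<Rightarrow> 'o \<Rightarrow> ('v letter list \<Rightarrow>\<^sub>0 'k)"
  assumes mem: "\<lbrakk>stable g I; x \<in> ospace \<O> g I p\<rbrakk> \<Longrightarrow> \<alpha> g I x \<in> E_space V I p"
    and add: "\<lbrakk>stable g I; x \<in> ospace \<O> g I p; y \<in> ospace \<O> g I p\<rbrakk> \<Longrightarrow>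
      \<alpha> g I (x + y) - (\<alpha> g I x + \<alpha> g I y) \<in> E_rel V I"
    and scale: "\<lbrakk>stable g I; x \<in> ospace \<O> g I p\<rbrakk> \<Longrightarrow>
      \<alpha> g I (oscale \<O> c x) - pscale c (\<alpha> g I x) \<in> E_rel V I"
    and diff: "\<lbrakk>stable g I; x \<in> ospace \<O> g I p\<rbrakk> \<Longrightarrow>
      \<alpha> g I (odiff \<O> g I x) - E_diff V (\<alpha> g I x) \<in> E_rel V I"
    and act: "\<lbrakk>stable g I; x \<in> ospace \<O> g I p; inj_on \<sigma> I\<rbrakk> \<Longrightarrow>
      \<alpha> g (\<sigma> ` I) (oact \<O> g I \<sigma> x) - E_act \<sigma> (\<alpha> g I x) \<in> E_rel V (\<sigma> ` I)"
    and comp: "\<lbrakk>decorated \<O> \<Gamma>; G = underlying_graph \<Gamma>\<rbrakk> \<Longrightarrow>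
      \<alpha> (graph_genus G) (graph_legs G) (compose \<O> \<Gamma>)
        - E_comp V G (map (\<lambda>v. \<alpha> (vgenus v) (vflags v) (vdec v)) (fst \<Gamma>)) \<in> E_rel V (graph_legs G)"


section \<open>The Feynman transform without legs\<close>

definition legless :: "('k, 'o) modop \<Rightarrow> 'o dgraph \<Rightarrow> bool" where
  "legless \<O> \<Gamma> \<longleftrightarrow> decorated \<O> \<Gamma> \<and> graph_legs (underlying_graph \<Gamma>) = {}"

text \<open>The direct sum over \<open>g\<close> of the spaces \<open>F\<^sup>\<or>\<O>((g,0))\<close> is the quotient of \<^typ>\<open>'o dgraph \<Rightarrow>\<^sub>0 'k\<close> by
  \<open>Fdual_rel\<close>, where the decorated graph with vertices \<open>v\<^sub>1, ..., v\<^sub>k\<close> decorated by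
  \<open>x\<^sub>1, ..., x\<^sub>k\<close> and edges \<open>e\<^sub>1, ..., e\<^sub>m\<close> stands for the class of
  \<open>(e\<^sub>1 \<and> ... \<and> e\<^sub>m) \<otimes> (x\<^sub>1 \<otimes> ... \<otimes> x\<^sub>k)\<close>.  The relations discard the elements of \<^typ>\<open>'o dgraph\<close> that are not
  decorated stable graphs without legs; make the symbols multilinear in the decorations,
  graded symmetric in the vertices and alternating in the edges, which gives the tensor
  products \<open>K(G) \<otimes> \<O>((G))\<close>; and identify the symbols along isomorphisms of graphs, which gives the
  coinvariants under \<open>Aut(G)\<close>, one summand for each isomorphism class.\<close>

definition Fdual_rel ::
  "('k::field_char_0, 'o::ab_group_add) modop \<Rightarrow> ('o dgraph \<Rightarrow>\<^sub>0 'k) set" where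
  "Fdual_rel \<O> = module.span pscale (
     {single \<Gamma> 1 | \<Gamma>. \<not> legless \<O> \<Gamma>} \<union>
     {single (us @ Vertex g I p (x + y) # ws, es) 1
        - single (us @ Vertex g I p x # ws, es) 1 - single (us @ Vertex g I p y # ws, es) 1
        | us g I p x y ws es.
        legless \<O> (us @ Vertex g I p x # ws, es) \<and> legless \<O> (us @ Vertex g I p y # ws, es)} \<union>
     {single (us @ Vertex g I p (oscale \<O> c x) # ws, es) 1 - single (us @ Vertex g I p x # ws, es) c
        | us g I p x c ws es. legless \<O> (us @ Vertex g I p x # ws, es)} \<union>
     {single (us @ v # w # ws, es) 1 - single (us @ w # v # ws, es) (psign (vpar v * vpar w))
        | us v w ws es. legless \<O> (us @ v # w # ws, es)} \<union>
     {single (vs, es @ e # f # fs) 1 + single (vs, es @ f # e # fs) 1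
        | vs es e f fs. legless \<O> (vs, es @ e # f # fs)} \<union>
     {single \<Gamma> 1 - single (relabel_graph \<O> \<phi> \<Gamma>) 1
        | \<Gamma> \<phi>. legless \<O> \<Gamma> \<and> inj_on \<phi> (graph_flags (underlying_graph \<Gamma>))})"

text \<open>Contraction of one edge: the one or two vertices at \<open>e\<close> are moved to the front and
  composed.\<close>

definition contract_edge_vertices ::
  "('k, 'o) modop \<Rightarrow> nat set \<Rightarrow> 'o vertex list \<Rightarrow> 'o vertex list" where
  "contract_edge_vertices \<O> e vs =
     collapse \<O> (filter (\<lambda>v. vflags v \<inter> e \<noteq> {}) vs, [e]) # filter (\<lambda>v. vflags v \<inter> e = {}) vs"

text \<open>The differential is the sum of the internal differential of \<open>\<O>\<close>, which passes the \<open>m\<close> odd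
  edges first, and of the contractions of the edges \<open>e\<^sub>j\<close>, each moved to the front of
  \<open>e\<^sub>1 \<and> ... \<and> e\<^sub>m\<close> and removed.\<close>

definition Fdual_diff_graph ::
  "('k::field_char_0, 'o) modop \<Rightarrow> 'o dgraph \<Rightarrow> ('o dgraph \<Rightarrow>\<^sub>0 'k)" where
  "Fdual_diff_graph \<O> \<Gamma> = (let vs = fst \<Gamma>; es = snd \<Gamma> in
     (\<Sum>i<length vs. single (vs[i := vertex_diff \<O> (vs ! i)], es)
        (psign (of_nat (length es) + sum_list (map vpar (take i vs))))) +
     (\<Sum>j<length es. single (contract_edge_vertices \<O> (es ! j) vs, take j es @ drop (Suc j) es)
        (psign (of_nat j + unshuffle_par vpar (\<lambda>v. vflags v \<inter> es ! j \<noteq> {}) vs))))"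

definition Fdual_diff ::
  "('k::field_char_0, 'o) modop \<Rightarrow> ('o dgraph \<Rightarrow>\<^sub>0 'k) \<Rightarrow> ('o dgraph \<Rightarrow>\<^sub>0 'k)" where
  "Fdual_diff \<O> = lin_ext (\<lambda>\<Gamma>. if legless \<O> \<Gamma> then Fdual_diff_graph \<O> \<Gamma> else 0)"

text \<open>The complex \<open>F\<O>((0))\<close>, the linear dual of \<open>F\<^sup>\<or>\<O>((0))\<close>: linear functionals on the quotient by
  \<open>Fdual_rel\<close>, with differential the transpose of \<open>Fdual_diff\<close>.  The sign by which
  the transpose is usually modified changes neither cycles nor boundaries.\<close>

definition F_space ::
  "('k::field_char_0, 'o::ab_group_add) modop \<Rightarrow> (('o dgraph \<Rightarrow>\<^sub>0 'k) \<Rightarrow> 'k) set" where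
  "F_space \<O> = {f. Vector_Spaces.linear pscale (*) f \<and> (\<forall>c\<in>Fdual_rel \<O>. f c = 0)}"

definition F_diff :: "('k::field_char_0, 'o) modop \<Rightarrow>
    (('o dgraph \<Rightarrow>\<^sub>0 'k) \<Rightarrow> 'k) \<Rightarrow> (('o dgraph \<Rightarrow>\<^sub>0 'k) \<Rightarrow> 'k)" where
  "F_diff \<O> f = f \<circ> Fdual_diff \<O>"

definition F_cycles ::
  "('k::field_char_0, 'o::ab_group_add) modop \<Rightarrow> (('o dgraph \<Rightarrow>\<^sub>0 'k) \<Rightarrow> 'k) set" where
  "F_cycles \<O> = {f \<in> F_space \<O>. F_diff \<O> f = (\<lambda>_. 0)}"

definition F_homologous :: "('k::field_char_0, 'o::ab_group_add) modop \<Rightarrow>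
    ((('o dgraph \<Rightarrow>\<^sub>0 'k) \<Rightarrow> 'k) \<times> (('o dgraph \<Rightarrow>\<^sub>0 'k) \<Rightarrow> 'k)) set" where
  "F_homologous \<O> = {(f, f'). f \<in> F_cycles \<O> \<and> f' \<in> F_cycles \<O> \<and>
     (\<exists>h\<in>F_space \<O>. (\<lambda>c. f c - f' c) = F_diff \<O> h)}"

definition F_homology ::
  "('k::field_char_0, 'o::ab_group_add) modop \<Rightarrow> (('o dgraph \<Rightarrow>\<^sub>0 'k) \<Rightarrow> 'k) set set" where
  "F_homology \<O> = F_cycles \<O> // F_homologous \<O>"


section \<open>The dual construction\<close>

text \<open>The form \<open>\<langle>?, s(?)\<rangle>\<close>; the sign is the Koszul sign of the odd operator \<open>s\<close> passing the first
  argument, so that its value at \<open>a \<otimes> b\<close> is also \<open>\<langle>s(a), b\<rangle>\<close>.  It is odd and graded symmetric, hence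
  can be contracted along unoriented edges.\<close>

definition propagator ::
  "('k::field_char_0, 'v) ipdg \<Rightarrow> ('v \<Rightarrow> 'v) \<Rightarrow> 'v letter \<Rightarrow> 'v letter \<Rightarrow> 'k" where
  "propagator V s a b = psign (lpar a) * vform V (lvec a) (s (lvec b))"

text \<open>The contraction of all edges lies in the tensor power over the empty set, which is
  \<open>k\<close> with basis the empty word.\<close>

definition amplitude_graph :: "('k::field_char_0, 'v) ipdg \<Rightarrow>
    (nat \<Rightarrow> nat set \<Rightarrow> 'o \<Rightarrow> ('v letter list \<Rightarrow>\<^sub>0 'k)) \<Rightarrow> ('v \<Rightarrow> 'v) \<Rightarrow> 'o dgraph \<Rightarrow> 'k" where
  "amplitude_graph V \<alpha> s \<Gamma> =
     lookup (contract_edges (propagator V s) (snd \<Gamma>)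
       (tensor_list (map (\<lambda>v. \<alpha> (vgenus v) (vflags v) (vdec v)) (fst \<Gamma>)))) []"

definition feynman_amplitude :: "('k::field_char_0, 'o) modop \<Rightarrow> ('k, 'v) ipdg \<Rightarrow>
    (nat \<Rightarrow> nat set \<Rightarrow> 'o \<Rightarrow> ('v letter list \<Rightarrow>\<^sub>0 'k)) \<Rightarrow> ('v \<Rightarrow> 'v) \<Rightarrow> ('o dgraph \<Rightarrow>\<^sub>0 'k) \<Rightarrow> 'k" where
  "feynman_amplitude \<O> V \<alpha> s =
     lin_ext_scalar (\<lambda>\<Gamma>. if legless \<O> \<Gamma> then amplitude_graph V \<alpha> s \<Gamma> else 0)"

text \<open>The class \<open>[V]\<close>, as computed with \<open>s\<close>.\<close>

definition dual_class :: "('k::field_char_0, 'o::ab_group_add) modop \<Rightarrow> ('k, 'v) ipdg \<Rightarrow>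
    (nat \<Rightarrow> nat set \<Rightarrow> 'o \<Rightarrow> ('v letter list \<Rightarrow>\<^sub>0 'k)) \<Rightarrow> ('v \<Rightarrow> 'v) \<Rightarrow> (('o dgraph \<Rightarrow>\<^sub>0 'k) \<Rightarrow> 'k) set" where
  "dual_class \<O> V \<alpha> s = F_homologous \<O> `` {feynman_amplitude \<O> V \<alpha> s}"

end

theory Submission
  imports Defs "HOL-Library.Multiset"
begin

text \<open>For an operator \<open>r\<close> on \<open>V\<close>, let the form of \<open>r\<close> be \<open>\<langle>r(?), ?\<rangle>\<close>; the
propagator is the form of \<open>s\<close>.  The differential of \<open>V\<close> is a derivation of contraction: it commutes, up
to sign, with the contraction along an edge by the form of \<open>r\<close>, except for a correction term, the
contraction by the form of the graded commutator \<open>[d, r]\<close> (\<open>E_diff_contraction\<close>).  For \<open>r = s\<close> this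
commutator is the identity.  Thus moving \<open>d\<close> through the contractions along all edges of a graph
replaces the propagator, on one edge after the other, by the inner product itself, and contraction
by the inner product is composition in \<open>\<E>(V)\<close>, which the algebra structure matches with composition in
\<open>\<O>\<close>.  These terms are therefore the values of the amplitude on the graphs with one edge contracted.
On the ground field \<open>d\<close> is zero, and so the amplitude is a cocycle.

The equation \<open>ds + sd = 1\<close> is affine in \<open>s\<close>, so it holds along the whole line \<open>s + t\<delta>\<close> from \<open>s\<close> to
\<open>s'\<close>, where \<open>\<delta> = s' - s\<close>.  Moreover \<open>\<delta> = [d, r]\<close> for the even operator \<open>r = (ss' - s's) / 2\<close>, which is
self-adjoint because of the antisymmetrisation (\<open>contracting_homotopies_path\<close>).  Consequently
\<open>s + t\<delta> + r dt\<close> is a propagator with coefficients in the differential forms \<open>k[t, dt]\<close> on the line, and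
its amplitude is a cocycle with such coefficients.  Its part without \<open>dt\<close> interpolates between the two
amplitudes, and the integral over \<open>0 \<le> t \<le> 1\<close> of the coefficient of \<open>dt\<close> is a functional whose boundary
is their difference.

The ring \<open>k[t, dt]\<close> itself does not appear below.  A linear functional on \<open>k[t]\<close> is given by its moments,
the sequence \<open>a\<close> of its values on the powers of \<open>t\<close>.  The operators \<open>path_contraction\<close> and
\<open>path_contraction_dt\<close> are the results of applying this functional to the part without \<open>dt\<close> and to the
coefficient of \<open>dt\<close>.  Evaluation at \<open>0\<close> has the moments \<open>1, 0, 0, ...\<close>, evaluation at \<open>1\<close> has
\<open>1, 1, 1, ...\<close>, and integration over the unit interval has \<open>1 / (k + 1)\<close>.  The functional
\<open>p \<mapsto> a(p')\<close> has the moments \<open>k a\<^sub>k\<^sub>-\<^sub>1\<close>, so that the fundamental theorem of calculus becomes the equation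
\<open>k (1 / k) = 1\<close> for \<open>k > 0\<close>.  The cocycle condition over \<open>k[t, dt]\<close> is the pair of identities
\<open>total_boundary_G\<close> and \<open>total_boundary_H\<close>.

All these identities hold for linear combinations of words, before passing to the tensor
powers of \<open>V\<close>.  The quotient enters only through the comparison of words with decorated graphs: the algebra
structure is a map of operads modulo \<open>E_rel\<close>, and the contractions and tensor products respect \<open>E_rel\<close>
(\<open>contraction_E_rel\<close>, \<open>E_rel_tensor2_left\<close>, \<open>E_rel_tensor2_right\<close>).  This gives functionals
on the graph complex (\<open>amplitude_in_F_space\<close>) and the formula for their boundaries
(\<open>amplitude_Fdual_diff_graph\<close>).\<close>

section \<open>Signs and linear extension\<close>

text \<open>Parities are computed in the field with two elements, by the ring laws; rewriting addition and
multiplication to bit operations would hide that structure.\<close>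

declare add_bit_eq_xor [simp del] mult_bit_eq_and [simp del]

lemma bit_add_same [simp]: "(p::bit) + p = 0" "p + (p + q) = q"
  by (cases p; cases q; simp)+

lemma bit_mult_same [simp]: "(p::bit) * p = p" "p * (p * q) = p * q"
  by (cases p; cases q; simp)+

lemma psign_simps [simp]: "psign 0 = 1" "psign 1 = - 1" "psign p * psign p = (1 :: 'k::field_char_0)"
  "psign p * (psign p * x) = (x :: 'k)"
  by (cases p; simp add: psign_def)+

lemma psign_add: "psign (p + q) = (psign p * psign q :: 'k::field_char_0)"
  by (cases p; cases q; simp add: psign_def)

abbreviation plinear :: "(('a \<Rightarrow>\<^sub>0 'k::field_char_0) \<Rightarrow> ('b \<Rightarrow>\<^sub>0 'k)) \<Rightarrow> bool" where
  "plinear \<equiv> Vector_Spaces.linear pscale pscale"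

interpretation pm: vector_space pscale
  by (rule vector_space_pscale)

lemma plinear_iff:
  "plinear f \<longleftrightarrow> (\<forall>x y. f (x + y) = f x + f y) \<and> (\<forall>c x. f (pscale c x) = pscale c (f x))"
  by (simp add: Vector_Spaces.linear_iff vector_space_pscale)

lemma plinearI:
  "\<lbrakk>\<And>x y. f (x + y) = f x + f y; \<And>c x. f (pscale c x) = pscale c (f x)\<rbrakk> \<Longrightarrow> plinear f"
  by (simp add: plinear_iff)

lemma plinearD:
  assumes "plinear f"
  shows plinear_add: "f (x + y) = f x + f y" and plinear_scale: "f (pscale c x) = pscale c (f x)"
    and plinear_zero: "f 0 = 0" and plinear_minus: "f (- x) = - f x"
    and plinear_diff: "f (x - y) = f x - f y" and plinear_sum: "f (sum g S) = (\<Sum>i\<in>S. f (g i))"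
proof -
  have mh: "module_hom pscale pscale f"
    using assms by (simp add: Vector_Spaces.linear_def)
  show "f (x + y) = f x + f y" "f (pscale c x) = pscale c (f x)" 
    using assms by (auto simp: plinear_iff)
  show "f 0 = 0" "f (- x) = - f x" "f (x - y) = f x - f y" "f (sum g S) = (\<Sum>i\<in>S. f (g i))"
    using mh by (simp_all add: module_hom.zero module_hom.neg module_hom.diff module_hom.sum)
qed

lemma pscale_simps [simp]: "pscale c 0 = 0" "pscale 0 x = 0" "pscale 1 x = x"
  "pscale a (pscale b x) = pscale (a * b) x"
  "pscale c (single w d) = single w (c * d)"
  "pscale (- 1) x = - x"
  by (auto intro!: poly_mapping_eqI simp: lookup_single when_def)

lemma pscale_add: "pscale c (x + y) = pscale c x + pscale c y"
  and pscale_diff: "pscale c (x - y) = pscale c x - pscale c y"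
  and pscale_minus: "pscale c (- x) = - pscale c x" "pscale (- c) x = - pscale c x"
  and pscale_sum: "pscale c (sum g S) = (\<Sum>i\<in>S. pscale c (g i))"
  and pscale_add_left: "pscale (c + d) x = pscale c x + pscale d x"
  by (simp_all add: pm.scale_right_distrib pm.scale_right_diff_distrib pm.scale_sum_right
      pm.scale_left_distrib)

lemma plinear_intros:
  "plinear (\<lambda>x. x)" "plinear (\<lambda>x. 0)"
  "plinear f \<Longrightarrow> plinear g \<Longrightarrow> plinear (\<lambda>x. f x + g x)"
  "plinear f \<Longrightarrow> plinear g \<Longrightarrow> plinear (\<lambda>x. f x - g x)"
  "plinear f \<Longrightarrow> plinear (\<lambda>x. - f x)"
  "plinear f \<Longrightarrow> plinear (\<lambda>x. pscale c (f x))"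
  by (auto simp: plinear_iff pscale_add pscale_diff mult.commute)

lemma plinear_compose: "plinear h \<Longrightarrow> plinear f \<Longrightarrow> plinear (\<lambda>x. h (f x))"
  by (auto simp: plinear_iff)

lemma lin_ext_superset:
  assumes "finite S" "keys c \<subseteq> S"
  shows "lin_ext f c = (\<Sum>x\<in>S. pscale (lookup c x) (f x))"
  unfolding lin_ext_def using assms
  by (intro sum.mono_neutral_left) (auto simp: in_keys_iff)

lemma lin_ext_single [simp]: "lin_ext f (single x c) = pscale c (f x)"
  by (subst lin_ext_superset[where S = "{x}"]) auto

lemma plinear_lin_ext:
  fixes f :: "'a \<Rightarrow> ('b \<Rightarrow>\<^sub>0 'k::field_char_0)"
  shows "plinear (lin_ext f)"
proof (rule plinearI)
  fix x y :: "'a \<Rightarrow>\<^sub>0 'k"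
  let ?S = "keys x \<union> keys y"
  have "keys (x + y) \<subseteq> ?S" by (rule keys_add)
  then show "lin_ext f (x + y) = lin_ext f x + lin_ext f y"
    by (subst (1 2 3) lin_ext_superset[where S = ?S])
      (auto simp: lookup_add pscale_add_left sum.distrib)
next
  fix c and x :: "'a \<Rightarrow>\<^sub>0 'k"
  have "keys (pscale c x) \<subseteq> keys x" by (auto simp: in_keys_iff)
  then show "lin_ext f (pscale c x) = pscale c (lin_ext f x)"
    by (subst (1 2) lin_ext_superset[where S = "keys x"]) (auto simp: pscale_sum)
qed

lemma poly_mapping_eq_sum: "t = (\<Sum>w\<in>keys t. pscale (lookup t w) (single w 1))"
  by (rule poly_mapping_eqI)
    (auto simp: lookup_sum lookup_single when_def in_keys_iff sum.delta' if_distrib cong: if_cong)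

text \<open>Almost all identities between linear maps below are checked on words.  Only the words that occur in the
argument have to be considered, so an identity may depend on conditions on words.\<close>

lemma plinear_eqI:
  assumes "plinear f" "plinear g" "\<And>w. w \<in> keys t \<Longrightarrow> f (single w 1) = g (single w 1)"
  shows "f t = g t"
proof -
  have "f t = (\<Sum>w\<in>keys t. pscale (lookup t w) (f (single w 1)))"
    by (subst poly_mapping_eq_sum[of t])
      (simp only: plinear_sum[OF assms(1)] plinear_scale[OF assms(1)])
  also have "\<dots> = (\<Sum>w\<in>keys t. pscale (lookup t w) (g (single w 1)))"
    using assms(3) by simp
  also have "\<dots> = g t"
    by (subst (3) poly_mapping_eq_sum[of t])
      (simp only: plinear_sum[OF assms(2)] plinear_scale[OF assms(2)])
  finally show ?thesis .
qed

lemma lin_ext_eq_plinear: "plinear f \<Longrightarrow> lin_ext (\<lambda>w. f (single w 1)) t = f t"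
  by (rule plinear_eqI) (auto simp: plinear_lin_ext)

lemma lin_ext_mem_subspace:
  assumes "pm.subspace S" "\<And>w. w \<in> keys t \<Longrightarrow> f w \<in> S"
  shows "lin_ext f t \<in> S"
  unfolding lin_ext_def using assms by (auto intro!: pm.subspace_sum pm.subspace_scale)

lemma plinear_mem_span:
  assumes "plinear f" "t \<in> pm.span A" "\<And>x. x \<in> A \<Longrightarrow> f x \<in> S" "pm.subspace S"
  shows "f t \<in> S"
  using assms(2)
proof (induction rule: pm.span_induct_alt)
  case base
  then show ?case using assms by (simp add: plinear_zero pm.subspace_0)
next
  case (step c x y)
  then show ?case using assms
    by (simp add: plinear_add plinear_scale pm.subspace_add pm.subspace_scale)
qed

section \<open>Contractions of words\<close>

abbreviation wpar :: "'v letter list \<Rightarrow> bit" where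
  "wpar w \<equiv> sum_list (map lpar w)"

text \<open>Representatives of elements of the tensor power of \<open>V\<close> over \<open>I\<close>, not necessarily homogeneous.\<close>

definition tensor_space :: "('k::field_char_0, 'v) ipdg \<Rightarrow> nat set \<Rightarrow> ('v letter list \<Rightarrow>\<^sub>0 'k) set" where
  "tensor_space V I = {t. keys t \<subseteq> tensor_words V I}"

definition letter_ok :: "('k, 'v) ipdg \<Rightarrow> 'v letter \<Rightarrow> bool" where
  "letter_ok V l \<longleftrightarrow> lvec l \<in> vspace V (lpar l)"

definition diff_letter :: "('k, 'v) ipdg \<Rightarrow> 'v letter \<Rightarrow> 'v letter" where
  "diff_letter V l = Letter (llabel l) (lpar l + 1) (vdiff V (lvec l))"

lemma diff_letter_simps [simp]:
  "llabel (diff_letter V l) = llabel l" "lpar (diff_letter V l) = lpar l + 1"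
  "lvec (diff_letter V l) = vdiff V (lvec l)"
  by (simp_all add: diff_letter_def)

text \<open>Contraction against a multilinear form \<open>M\<close> in any number of letters, rather than just two.  In this
generality the letters at \<open>e\<close> can be fed to \<open>M\<close> one by one, by partial application, and
the properties of contraction can be proved by induction on the word.\<close>

definition contract_with ::
  "('v letter list \<Rightarrow> 'k::field_char_0) \<Rightarrow> nat set \<Rightarrow> 'v letter list \<Rightarrow> ('v letter list \<Rightarrow>\<^sub>0 'k)" where
  "contract_with M e w = single (filter (\<lambda>l. llabel l \<notin> e) w)
     (psign (unshuffle_par lpar (\<lambda>l. llabel l \<in> e) w) * M (filter (\<lambda>l. llabel l \<in> e) w))"

definition pair_form :: "('a \<Rightarrow> 'a \<Rightarrow> 'k::field_char_0) \<Rightarrow> 'a list \<Rightarrow> 'k" where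
  "pair_form B ls = (case ls of [a, b] \<Rightarrow> B a b | _ \<Rightarrow> 0)"

lemma pair_form_simps [simp]:
  "pair_form B [] = 0" "pair_form B [a] = 0" "pair_form B [a, b] = B a b"
  "pair_form B (a # b # c # ls) = 0"
  by (simp_all add: pair_form_def)

lemma contract_word_eq: "contract_word B e = contract_with (pair_form B) e"
  by (rule ext) (auto simp: contract_word_def contract_with_def pair_form_def split: list.splits)

definition op_form :: "('k, 'v) ipdg \<Rightarrow> ('v \<Rightarrow> 'v) \<Rightarrow> 'v letter \<Rightarrow> 'v letter \<Rightarrow> 'k" where
  "op_form V r a b = vform V (r (lvec a)) (lvec b)"

definition contraction :: "('k::field_char_0, 'v) ipdg \<Rightarrow> ('v \<Rightarrow> 'v) \<Rightarrow> nat set \<Rightarrow>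
    ('v letter list \<Rightarrow>\<^sub>0 'k) \<Rightarrow> ('v letter list \<Rightarrow>\<^sub>0 'k)" where
  "contraction V r e = lin_ext (contract_word (op_form V r) e)"

definition homogeneous :: "('k, 'v) ipdg \<Rightarrow> bit \<Rightarrow> ('v letter list \<Rightarrow> 'k::field_char_0) \<Rightarrow> bool" where
  "homogeneous V q M \<longleftrightarrow> (\<forall>ls. list_all (letter_ok V) ls \<longrightarrow> M ls \<noteq> 0 \<longrightarrow> wpar ls = q)"

definition pcons :: "'a \<Rightarrow> ('a list \<Rightarrow>\<^sub>0 'k::field_char_0) \<Rightarrow> ('a list \<Rightarrow>\<^sub>0 'k)" where
  "pcons l = lin_ext (\<lambda>w. single (l # w) 1)"

lemma pcons_single [simp]: "pcons l (single w c) = single (l # w) c"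
  by (simp add: pcons_def)

lemma plinear_pcons: "plinear (pcons l)"
  by (simp add: pcons_def plinear_lin_ext)

lemma plinear_E_diff: "plinear (E_diff V)"
  by (simp add: E_diff_def plinear_lin_ext)

lemma plinear_contraction: "plinear (contraction V r e)"
  by (simp add: contraction_def plinear_lin_ext)

lemmas plinear_compose_intros = plinear_intros plinear_compose[OF plinear_lin_ext]
  plinear_compose[OF plinear_pcons] plinear_compose[OF plinear_E_diff]
  plinear_compose[OF plinear_contraction]

lemma E_diff_Nil [simp]: "E_diff V (single [] c) = 0"
  by (simp add: E_diff_def)

lemma E_diff_single:
  "E_diff V (single w 1) = (\<Sum>i<length w. single (w[i := diff_letter V (w ! i)]) (psign (wpar (take i w))))"
  by (simp add: E_diff_def diff_letter_def)

text \<open>The Leibniz rule for words, which replaces the sum over positions in \<open>E_diff\<close> by a recursion.\<close>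

lemma E_diff_Cons:
  "E_diff V (single (l # w) 1) =
   single (diff_letter V l # w) 1 + pscale (psign (lpar l)) (pcons l (E_diff V (single w 1)))"
  unfolding E_diff_single
  by (simp add: sum.lessThan_Suc_shift pscale_sum plinear_sum[OF plinear_pcons] psign_add
      del: sum.lessThan_Suc)

lemma keys_E_diff:
  fixes t :: "'v letter list \<Rightarrow>\<^sub>0 'k::field_char_0"
  assumes "w \<in> keys (E_diff V t)"
  obtains u i where "u \<in> keys t" "i < length u" "w = u[i := diff_letter V (u ! i)]"
proof -
  have "E_diff V t = (\<Sum>u\<in>keys t. pscale (lookup t u) (E_diff V (single u 1)))"
    by (subst (1) poly_mapping_eq_sum[of t])
      (simp only: plinear_sum[OF plinear_E_diff] plinear_scale[OF plinear_E_diff])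
  then have "w \<in> keys (\<Sum>u\<in>keys t. pscale (lookup t u) (E_diff V (single u 1)))"
    using assms by simp
  then have "(\<Sum>u\<in>keys t. lookup (pscale (lookup t u) (E_diff V (single u 1))) w) \<noteq> 0"
    by (simp add: in_keys_iff lookup_sum)
  then obtain u where u: "u \<in> keys t" "lookup (pscale (lookup t u) (E_diff V (single u 1))) w \<noteq> 0"
    by (rule sum.not_neutral_contains_not_neutral)
  then have "(\<Sum>i<length u. lookup (single (u[i := diff_letter V (u ! i)]) (psign (wpar (take i u)) :: 'k)) w) \<noteq> 0"
    by (simp add: E_diff_single lookup_sum)
  then obtain i where i: "i \<in> {..<length u}"
    "lookup (single (u[i := diff_letter V (u ! i)]) (psign (wpar (take i u)) :: 'k)) w \<noteq> 0"
    by (rule sum.not_neutral_contains_not_neutral)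
  then have "i < length u" "w = u[i := diff_letter V (u ! i)]"
    by (auto simp: lookup_single when_def split: if_splits)
  with u that show ?thesis by blast
qed

lemma tensor_words_iff:
  "w \<in> tensor_words V I \<longleftrightarrow>
   distinct (map llabel w) \<and> llabel ` set w = I \<and> list_all (letter_ok V) w"
  by (auto simp: tensor_words_def letter_ok_def list_all_iff)

lemma subspace_keys: "pm.subspace {t :: 'a \<Rightarrow>\<^sub>0 'k::field_char_0. keys t \<subseteq> A}"
proof (rule pm.subspaceI)
  fix x y :: "'a \<Rightarrow>\<^sub>0 'k" 
  assume "x \<in> {t. keys t \<subseteq> A}" "y \<in> {t. keys t \<subseteq> A}"
  then show "x + y \<in> {t. keys t \<subseteq> A}" using keys_add[of x y] by auto
next
  fix c and x :: "'a \<Rightarrow>\<^sub>0 'k" 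
  assume "x \<in> {t. keys t \<subseteq> A}"
  moreover have "keys (pscale c x) \<subseteq> keys x" by (auto simp: in_keys_iff)
  ultimately show "pscale c x \<in> {t. keys t \<subseteq> A}" by auto
qed simp

lemma subspace_tensor_space: "pm.subspace (tensor_space V I)"
  unfolding tensor_space_def by (rule subspace_keys)

lemma tensor_space_single: "w \<in> tensor_words V I \<Longrightarrow> single w c \<in> tensor_space V I"
  by (auto simp: tensor_space_def)

lemma subspace_E_rel: "pm.subspace (E_rel V I)"
  unfolding E_rel_def by (rule pm.subspace_span)

lemma unshuffle_par_append:
  "unshuffle_par par P (u @ w) =
   unshuffle_par par P u + unshuffle_par par P w +
   sum_list (map par (filter (\<lambda>x. \<not> P x) u)) * sum_list (map par (filter P w))"
  by (induction u) (auto simp: algebra_simps)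

lemma unshuffle_par_none: "(\<And>x. x \<in> set u \<Longrightarrow> \<not> P x) \<Longrightarrow> unshuffle_par par P u = 0"
  by (induction u) (auto simp: filter_False)

text \<open>The two terms on the left are the signs for extracting first the \<open>Q\<close>-letters and then the \<open>P\<close>-letters,
and in the other order.  Each pair of a \<open>P\<close>-letter and a \<open>Q\<close>-letter contributes to exactly one of
them, according to which letter comes first.\<close>

lemma unshuffle_par_commute:
  assumes "\<And>x. \<not> (P x \<and> Q x)"
  shows "unshuffle_par par Q w + unshuffle_par par P (filter (\<lambda>x. \<not> Q x) w) +
    (unshuffle_par par P w + unshuffle_par par Q (filter (\<lambda>x. \<not> P x) w)) =
    sum_list (map par (filter P w)) * sum_list (map par (filter Q w))"
proof (induction w)
  case (Cons x w)
  have f: "filter Q (filter (\<lambda>x. \<not> P x) w) = filter Q w"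
    "filter P (filter (\<lambda>x. \<not> Q x) w) = filter P w"
    using assms by (auto simp: filter_filter intro!: filter_cong)
  consider "P x" "\<not> Q x" | "Q x" "\<not> P x" | "\<not> P x" "\<not> Q x" using assms by blast
  then show ?case
    by cases (use Cons.IH in \<open>simp_all add: f[simplified] algebra_simps\<close>)
qed simp

lemma contract_with_mem:
  assumes "t \<in> tensor_space V I"
  shows "lin_ext (contract_with M e) t \<in> tensor_space V (I - e)"
proof (rule lin_ext_mem_subspace[OF subspace_tensor_space])
  fix w assume "w \<in> keys t"
  then have "w \<in> tensor_words V I" using assms by (auto simp: tensor_space_def)
  then show "contract_with M e w \<in> tensor_space V (I - e)"
    unfolding contract_with_def
    by (intro tensor_space_single) (auto simp: tensor_words_iff distinct_map_filter list_all_iff)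
qed

lemma contraction_mem: "t \<in> tensor_space V I \<Longrightarrow> contraction V r e t \<in> tensor_space V (I - e)"
  by (simp add: contraction_def contract_word_eq contract_with_mem)

text \<open>Contractions along disjoint edges commute in the graded sense: the two orders of extraction
differ by the sign for interchanging the two groups of letters, whose total parities
are those of the forms whenever the values are nonzero.\<close>

lemma contract_with_commute:
  assumes "homogeneous V p M" "homogeneous V q N" "e \<inter> f = {}" "t \<in> tensor_space V I"
  shows "lin_ext (contract_with M e) (lin_ext (contract_with N f) t) =
    pscale (psign (p * q)) (lin_ext (contract_with N f) (lin_ext (contract_with M e) t))"
proof (rule plinear_eqI[where t = t])
  fix w assume "w \<in> keys t"
  then have w: "list_all (letter_ok V) w" using assms(4) by (auto simp: tensor_space_def tensor_words_iff)
  let ?P = "\<lambda>l. llabel l \<in> e" and ?Q = "\<lambda>l. llabel l \<in> f"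
  let ?P' = "\<lambda>l. llabel l \<notin> e" and ?Q' = "\<lambda>l. llabel l \<notin> f"
  have d: "\<And>x. \<not> (?P x \<and> ?Q x)" using assms(3) by auto
  have f: "filter ?Q (filter ?P' w) = filter ?Q w"
    "filter ?P (filter ?Q' w) = filter ?P w"
    "filter ?P' (filter ?Q' w) = filter ?Q' (filter ?P' w)"
    using d by (auto simp: filter_filter intro!: filter_cong)
  have key: "psign (unshuffle_par lpar ?Q w + unshuffle_par lpar ?P (filter ?Q' w)) * (N (filter ?Q w) * M (filter ?P w)) =
    psign (p * q) * psign (unshuffle_par lpar ?P w + unshuffle_par lpar ?Q (filter ?P' w)) * (N (filter ?Q w) * M (filter ?P w))"
  proof (cases "N (filter ?Q w) * M (filter ?P w) = 0")
    case False
    have "list_all (letter_ok V) (filter ?P w)" "list_all (letter_ok V) (filter ?Q w)"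
      using w by (auto simp: list_all_iff)
    then have "wpar (filter ?P w) = p" "wpar (filter ?Q w) = q"
      using assms(1,2) False by (auto simp: homogeneous_def)
    then have "unshuffle_par lpar ?Q w + unshuffle_par lpar ?P (filter ?Q' w) +
      (unshuffle_par lpar ?P w + unshuffle_par lpar ?Q (filter ?P' w)) = p * q"
      using unshuffle_par_commute[where P = ?P and Q = ?Q and par = lpar and w = w, OF d] by simp
    then have "unshuffle_par lpar ?Q w + unshuffle_par lpar ?P (filter ?Q' w) =
      p * q + (unshuffle_par lpar ?P w + unshuffle_par lpar ?Q (filter ?P' w))"
      by (metis add.commute bit_add_same(2))
    then show ?thesis by (simp only: psign_add)
  qed simp
  have A: "lin_ext (contract_with M e) (lin_ext (contract_with N f) (single w 1)) =
    single (filter ?Q' (filter ?P' w))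
      (psign (unshuffle_par lpar ?Q w + unshuffle_par lpar ?P (filter ?Q' w)) * (N (filter ?Q w) * M (filter ?P w)))"
    by (simp add: contract_with_def f psign_add mult_ac
        del: filter_filter mult_cancel_left mult_cancel_right)
  have B: "pscale (psign (p * q)) (lin_ext (contract_with N f) (lin_ext (contract_with M e) (single w 1))) =
    single (filter ?Q' (filter ?P' w))
      (psign (p * q) * psign (unshuffle_par lpar ?P w + unshuffle_par lpar ?Q (filter ?P' w)) * (N (filter ?Q w) * M (filter ?P w)))"
    by (simp add: contract_with_def f psign_add mult_ac
        del: filter_filter mult_cancel_left mult_cancel_right)
  show "lin_ext (contract_with M e) (lin_ext (contract_with N f) (single w 1)) =
    pscale (psign (p * q)) (lin_ext (contract_with N f) (lin_ext (contract_with M e) (single w 1)))"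
    by (rule trans[OF A trans[OF arg_cong[OF key, of "single (filter ?Q' (filter ?P' w))"] B[symmetric]]])
qed (intro plinear_compose_intros)+

text \<open>The boundary of a multilinear form, as the composite of the form with the differential of the tensor
power.\<close>

fun diff_form :: "('k, 'v) ipdg \<Rightarrow> ('v letter list \<Rightarrow> 'k::field_char_0) \<Rightarrow> 'v letter list \<Rightarrow> 'k" where
  "diff_form V M [] = 0"
| "diff_form V M (l # ls) =
     M (diff_letter V l # ls) + psign (lpar l) * diff_form V (\<lambda>ls. M (l # ls)) ls"

lemma diff_form_zero [simp]: "diff_form V (\<lambda>_. 0) ls = 0"
  by (induction ls) auto

lemma diff_form_pair_form:
  fixes V :: "('k::field_char_0, 'v) ipdg"
  shows "diff_form V (pair_form B) =
   pair_form (\<lambda>a b. B (diff_letter V a) b + psign (lpar a) * B a (diff_letter V b))"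
proof
  fix ls :: "'v letter list"
  consider "ls = []" | a where "ls = [a]" | a b where "ls = [a, b]" | a b c ls' where "ls = a # b # c # ls'"
    by (metis list.exhaust)
  then show "diff_form V (pair_form B) ls =
      pair_form (\<lambda>a b. B (diff_letter V a) b + psign (lpar a) * B a (diff_letter V b)) ls"
    by cases auto
qed

lemma contract_with_Cons_in:
  "llabel l \<in> e \<Longrightarrow> contract_with M e (l # w) = contract_with (\<lambda>ls. M (l # ls)) e w"
  by (simp add: contract_with_def)

lemma contract_with_Cons_out:
  assumes "homogeneous V q M" "llabel l \<notin> e" "list_all (letter_ok V) w"
  shows "contract_with M e (l # w) = pscale (psign (lpar l * q)) (pcons l (contract_with M e w))"
proof (cases "M (filter (\<lambda>l. llabel l \<in> e) w) = 0")
  case False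
  moreover have "list_all (letter_ok V) (filter (\<lambda>l. llabel l \<in> e) w)"
    using assms(3) by (auto simp: list_all_iff)
  ultimately have "wpar (filter (\<lambda>l. llabel l \<in> e) w) = q"
    using assms(1) by (auto simp: homogeneous_def)
  then show ?thesis using assms(2)
    by (simp add: contract_with_def psign_add mult_ac)
qed (use assms in \<open>simp add: contract_with_def plinear_zero[OF plinear_pcons]\<close>)

section \<open>Contraction and the differential\<close>

context inner_dg_space
begin

lemma vector_space_V: "vector_space (vscale V)"
  using dg by (simp add: dg_space_def graded_space_def)

lemma vspace_subspace: "module.subspace (vscale V) (vspace V p)"
  using dg by (simp add: dg_space_def graded_space_def)

lemma vspace_add: "x \<in> vspace V p \<Longrightarrow> y \<in> vspace V p \<Longrightarrow> x + y \<in> vspace V p"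
  and vspace_scale: "x \<in> vspace V p \<Longrightarrow> vscale V c x \<in> vspace V p"
  using module.subspace_add[OF _ vspace_subspace] module.subspace_scale[OF _ vspace_subspace]
    vector_space_V
  by (auto simp: module_iff_vector_space)

lemma vspace_diff: "x \<in> vspace V p \<Longrightarrow> vdiff V x \<in> vspace V (p + 1)"
  using dg by (auto simp: dg_space_def graded_map_def)

lemma form_add: "vform V (x + y) z = vform V x z + vform V y z"
  "vform V z (x + y) = vform V z x + vform V z y"
  "vform V (vscale V c x) z = c * vform V x z" "vform V z (vscale V c x) = c * vform V z x"
  using form_linear_left[of z] form_linear_right[of z]
  by (simp_all add: Vector_Spaces.linear_iff)

lemma form_minus: "vform V (x - y) z = vform V x z - vform V y z"
  using form_add(1)[of "x - y" y z] by simp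

lemma letter_ok_diff: "letter_ok V l \<Longrightarrow> letter_ok V (diff_letter V l)"
  by (simp add: letter_ok_def vspace_diff)

lemma E_diff_ok:
  assumes "list_all (letter_ok V) w" "u \<in> keys (E_diff V (single w (1 :: 'k)))"
  shows "list_all (letter_ok V) u"
proof -
  obtain i where u: "i < length w" "u = w[i := diff_letter V (w ! i)]"
    using assms(2) by (rule keys_E_diff) simp
  then show ?thesis
    using assms(1) letter_ok_diff[of "w ! i"]
    by (auto simp: list_all_length nth_list_update)
qed

text \<open>The induction on the word passes from \<open>M\<close> to its partial application to the first letter,
of parity shifted by that letter, if this letter is contracted; otherwise the letter moves out of the
contraction with a sign.\<close>

lemma E_diff_contract_with:
  assumes "homogeneous V q M" "list_all (letter_ok V) w"
  shows "E_diff V (contract_with M e w) =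
    pscale (psign q) (lin_ext (contract_with M e) (E_diff V (single w 1))
      - contract_with (diff_form V M) e w)"
  using assms
proof (induction w arbitrary: M q)
  case Nil
  have "E_diff V (contract_with M e []) = 0"
    unfolding contract_with_def by (simp del: pscale_simps(5))
  moreover have "contract_with (diff_form V M) e [] = 0"
    unfolding contract_with_def by simp
  ultimately show ?case by (simp add: plinear_zero[OF plinear_lin_ext])
next
  case (Cons l w)
  let ?D = "E_diff V" and ?p = "lpar l" and ?d = "diff_letter V l"
  have w: "list_all (letter_ok V) w" "letter_ok V l" using Cons.prems by auto
  show ?case
  proof (cases "llabel l \<in> e")
    case True
    let ?Ml = "\<lambda>ls. M (l # ls)"
    have hom: "homogeneous V (q + ?p) ?Ml"
      unfolding homogeneous_def
    proof (intro allI impI)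
      fix ls assume "list_all (letter_ok V) ls" "M (l # ls) \<noteq> 0"
      then have "wpar (l # ls) = q"
        using Cons.prems(1) w unfolding homogeneous_def by (metis list.pred_inject(2))
      then show "wpar ls = q + ?p" by (auto simp: add_ac)
    qed
    have 1: "contract_with M e (l # w) = contract_with ?Ml e w"
      using True by (rule contract_with_Cons_in)
    have 2: "lin_ext (contract_with M e) (pcons l t) = lin_ext (contract_with ?Ml e) t" for t
      by (rule plinear_eqI[where t = t])
        (auto intro!: plinear_compose_intros simp: contract_with_Cons_in True)
    have 3: "contract_with (diff_form V M) e (l # w) =
       contract_with M e (?d # w) + pscale (psign ?p) (contract_with (diff_form V ?Ml) e w)"
      using True by (simp add: contract_with_def distrib_left single_add mult_ac)
    show ?thesis
      unfolding 1 3 E_diff_Cons Cons.IH[OF hom w(1)]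
      by (simp add: plinearD[OF plinear_lin_ext] 2 psign_add pscale_add pscale_diff mult_ac)
  next
    case False
    have 1: "contract_with M e (l # w) = pscale (psign (?p * q)) (pcons l (contract_with M e w))"
      using Cons.prems(1) False w(1) by (rule contract_with_Cons_out)
    have c1: "contract_with M e (?d # w) = pscale (psign ((?p + 1) * q)) (pcons ?d (contract_with M e w))"
      using contract_with_Cons_out[of V q M ?d e w] Cons.prems(1) False w(1) by simp
    have 2: "lin_ext (contract_with M e) (pcons l (?D (single w 1))) =
      pscale (psign (?p * q)) (pcons l (lin_ext (contract_with M e) (?D (single w 1))))"
      by (rule plinear_eqI[where t = "?D (single w 1)"])
        (auto intro!: plinear_compose_intros contract_with_Cons_out
           E_diff_ok[OF w(1)] Cons.prems(1) False)
    have hom: "homogeneous V (q + 1) (diff_form V M)"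
      unfolding homogeneous_def
    proof (intro allI impI)
      fix ls assume "list_all (letter_ok V) ls" "diff_form V M ls \<noteq> 0"
      then show "wpar ls = q + 1"
        using Cons.prems(1)
      proof (induction ls arbitrary: M q)
        case (Cons a ls)
        show ?case
        proof (cases "M (diff_letter V a # ls) = 0")
          case True
          then have "diff_form V (\<lambda>ls. M (a # ls)) ls \<noteq> 0" using Cons.prems by auto
          moreover have "homogeneous V (q + lpar a) (\<lambda>ls. M (a # ls))"
            unfolding homogeneous_def
          proof (intro allI impI)
            fix ls assume "list_all (letter_ok V) ls" "M (a # ls) \<noteq> 0"
            then have "wpar (a # ls) = q"
              using Cons.prems unfolding homogeneous_def by (metis list.pred_inject(2))
            then show "wpar ls = q + lpar a" by (auto simp: add_ac)
          qed
          ultimately have "wpar ls = q + lpar a + 1"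
            using Cons.IH[of "\<lambda>ls. M (a # ls)" "q + lpar a"] Cons.prems by simp
          then show ?thesis by (simp add: add_ac)
        next
          case False
          then have "wpar (diff_letter V a # ls) = q"
            using Cons.prems letter_ok_diff unfolding homogeneous_def by (metis list.pred_inject(2))
          then show ?thesis by (auto simp: add_ac)
        qed
      qed simp
    qed
    have 3: "contract_with (diff_form V M) e (l # w) =
        pscale (psign (?p * (q + 1))) (pcons l (contract_with (diff_form V M) e w))"
      using hom False w(1) by (rule contract_with_Cons_out)
    have 4: "?D (pcons l t) = pcons ?d t + pscale (psign ?p) (pcons l (?D t))" for t
      by (rule plinear_eqI[where t = t])
        (auto intro!: plinear_compose_intros simp: E_diff_Cons)
    show ?thesis
      unfolding 1 3 E_diff_Cons plinear_scale[OF plinear_E_diff] 4 Cons.IH[OF Cons.prems(1) w(1)]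
      by (simp add: plinearD[OF plinear_lin_ext] plinearD[OF plinear_pcons] c1 2 psign_add
          pscale_add pscale_diff mult_ac distrib_left distrib_right)
  qed
qed

text \<open>Self-adjointness in the graded sense.  It makes the form of \<open>r\<close> graded symmetric, so that
contraction along an edge is well defined although edges are not oriented.\<close>

definition self_adjoint :: "bit \<Rightarrow> ('v \<Rightarrow> 'v) \<Rightarrow> bool" where
  "self_adjoint q r \<longleftrightarrow> Vector_Spaces.linear (vscale V) (vscale V) r \<and>
     (\<forall>p. \<forall>v\<in>vspace V p. r v \<in> vspace V (p + q)) \<and>
     (\<forall>p. \<forall>a\<in>vspace V p. \<forall>b. vform V (r a) b = psign (p * q) * vform V a (r b))"

lemma self_adjointD:
  assumes "self_adjoint q r"
  shows "r (x + y) = r x + r y" "r (vscale V c x) = vscale V c (r x)"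
    "v \<in> vspace V p \<Longrightarrow> r v \<in> vspace V (p + q)"
    "v \<in> vspace V p \<Longrightarrow> vform V (r v) b = psign (p * q) * vform V v (r b)"
  using assms by (auto simp: self_adjoint_def Vector_Spaces.linear_iff)

lemma homogeneous_op_form:
  assumes "self_adjoint q r"
  shows "homogeneous V q (pair_form (op_form V r))"
  unfolding homogeneous_def
proof (intro allI impI)
  fix ls assume ls: "list_all (letter_ok V) ls" "pair_form (op_form V r) ls \<noteq> 0"
  then obtain a b where ab: "ls = [a, b]" "op_form V r a b \<noteq> 0"
    by (auto simp: pair_form_def split: list.splits)
  with ls have "r (lvec a) \<in> vspace V (lpar a + q)" "lvec b \<in> vspace V (lpar b)"
    using self_adjointD(3)[OF assms] by (auto simp: letter_ok_def)
  then have "lpar a + q = lpar b" using ab form_even unfolding op_form_def by metis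
  then have "lpar a + lpar b = q" by (metis bit_add_same(2))
  then show "wpar ls = q" using ab by simp
qed

lemma op_form_sym:
  assumes "self_adjoint q r" "letter_ok V a" "letter_ok V b"
  shows "op_form V r a b = psign (lpar a * lpar b) * op_form V r b a"
proof -
  have a: "lvec a \<in> vspace V (lpar a)" and b: "lvec b \<in> vspace V (lpar b)"
    using assms by (auto simp: letter_ok_def)
  have "vform V (r (lvec a)) (lvec b) = psign ((lpar a + q) * lpar b) * vform V (lvec b) (r (lvec a))"
    by (rule form_sym[OF self_adjointD(3)[OF assms(1) a] b])
  also have "\<dots> = psign (lpar a * lpar b) * vform V (r (lvec b)) (lvec a)"
    unfolding self_adjointD(4)[OF assms(1) b] by (simp add: psign_add distrib_left distrib_right mult_ac)
  finally show ?thesis by (simp add: op_form_def)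
qed

lemma op_form_add:
  assumes "self_adjoint q r"
  shows "op_form V r (Letter i p (x + y)) b = op_form V r (Letter i p x) b + op_form V r (Letter i p y) b"
    "op_form V r b (Letter i p (x + y)) = op_form V r b (Letter i p x) + op_form V r b (Letter i p y)"
    "op_form V r (Letter i p (vscale V c x)) b = c * op_form V r (Letter i p x) b"
    "op_form V r b (Letter i p (vscale V c x)) = c * op_form V r b (Letter i p x)"
  by (simp_all add: op_form_def self_adjointD[OF assms] form_add)

lemma contraction_commute:
  assumes "self_adjoint p r" "self_adjoint q r'" "e \<inter> f = {}" "t \<in> tensor_space V I"
  shows "contraction V r e (contraction V r' f t) =
    pscale (psign (p * q)) (contraction V r' f (contraction V r e t))"
  unfolding contraction_def contract_word_eq
  by (rule contract_with_commute[OF homogeneous_op_form homogeneous_op_form]) (fact assms)+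

text \<open>The form of \<open>r\<close> has as boundary, up to sign, the form of the graded commutator of \<open>r\<close> with the
differential, because the inner product is a chain map.\<close>

lemma E_diff_contraction:
  assumes "self_adjoint q r" "t \<in> tensor_space V I"
    and "\<And>x. r' x = vdiff V (r x) - vscale V (psign q) (r (vdiff V x))"
  shows "E_diff V (contraction V r e t) =
    pscale (psign q) (contraction V r e (E_diff V t)) + contraction V r' e t"
proof (rule plinear_eqI[where t = t])
  fix w assume "w \<in> keys t"
  then have ok: "list_all (letter_ok V) w" using assms(2) by (auto simp: tensor_space_def tensor_words_iff)
  have B: "pair_form (op_form V r') (filter (\<lambda>l. llabel l \<in> e) w) =
    - psign q * diff_form V (pair_form (op_form V r)) (filter (\<lambda>l. llabel l \<in> e) w)"
  proof -
    have "op_form V r' a b = - psign q * (op_form V r (diff_letter V a) b + psign (lpar a) * op_form V r a (diff_letter V b))"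
      if "letter_ok V a" for a b
    proof -
      have "r (lvec a) \<in> vspace V (lpar a + q)"
        using that self_adjointD(3)[OF assms(1)] by (auto simp: letter_ok_def)
      then have "vform V (vdiff V (r (lvec a))) (lvec b) + psign (lpar a + q) * vform V (r (lvec a)) (vdiff V (lvec b)) = 0"
        by (rule form_diff)
      then have "vform V (vdiff V (r (lvec a))) (lvec b) = - (psign (lpar a + q) * vform V (r (lvec a)) (vdiff V (lvec b)))"
        by (simp add: eq_neg_iff_add_eq_0)
      then show ?thesis
        by (simp add: op_form_def assms(3) form_minus form_add psign_add algebra_simps)
    qed
    moreover have "list_all (letter_ok V) (filter (\<lambda>l. llabel l \<in> e) w)"
      using ok by (auto simp: list_all_iff)
    ultimately show ?thesis
      unfolding diff_form_pair_form by (auto simp: pair_form_def split: list.splits)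
  qed
  show "E_diff V (contraction V r e (single w 1)) =
    pscale (psign q) (contraction V r e (E_diff V (single w 1))) + contraction V r' e (single w 1)"
    using E_diff_contract_with[OF homogeneous_op_form[OF assms(1)] ok, of e]
    unfolding contraction_def contract_word_eq
    by (simp add: pscale_diff) (simp add: contract_with_def B mult_ac flip: single_uminus)
qed (intro plinear_compose_intros)+

end

section \<open>Tensor products of representatives\<close>

lemma tensor2_alt: "tensor2 s t = lin_ext (\<lambda>u. lin_ext (\<lambda>w. single (u @ w) 1) t) s"
  by (simp add: tensor2_def lin_ext_def pscale_sum)

lemma tensor2_alt2: "tensor2 s t = lin_ext (\<lambda>w. lin_ext (\<lambda>u. single (u @ w) 1) s) t"
  unfolding tensor2_def lin_ext_def by (subst sum.swap) (simp add: pscale_sum mult.commute)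

lemma plinear_tensor2_left: "plinear (\<lambda>s. tensor2 s t)"
  unfolding tensor2_alt by (rule plinear_lin_ext)

lemma plinear_tensor2_right: "plinear (tensor2 s)"
  unfolding tensor2_alt2[abs_def] by (rule plinear_lin_ext)

lemma tensor2_single [simp]: "tensor2 (single u a) (single w b) = single (u @ w) (a * b)"
  by (simp add: tensor2_alt)

lemmas plinear_tensor2_intros = plinear_compose_intros
  plinear_compose[OF plinear_tensor2_left] plinear_compose[OF plinear_tensor2_right]

lemma bilinear_eqI:
  assumes "\<And>t. plinear (\<lambda>s. f s t)" "\<And>t. plinear (\<lambda>s. g s t)" "\<And>s. plinear (f s)" "\<And>s. plinear (g s)"
    and "\<And>u w. u \<in> keys s \<Longrightarrow> w \<in> keys t \<Longrightarrow> f (single u 1) (single w 1) = g (single u 1) (single w 1)"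
  shows "f s t = g s t"
proof (rule plinear_eqI[where t = s])
  fix u assume u: "u \<in> keys s"
  show "f (single u 1) t = g (single u 1) t"
    by (rule plinear_eqI[where t = t]) (use assms u in auto)
qed (rule assms)+

lemma tensor2_unit [simp]: "tensor2 (single [] 1) t = t" "tensor2 t (single [] 1) = t"
proof -
  show "tensor2 (single [] 1) t = t"
    by (rule plinear_eqI[where t = t]) (intro plinear_tensor2_intros plinear_intros | simp)+
  show "tensor2 t (single [] 1) = t"
    by (rule plinear_eqI[where t = t]) (intro plinear_tensor2_intros plinear_intros | simp)+
qed

lemma tensor2_assoc: "tensor2 (tensor2 r s) t = tensor2 r (tensor2 s t)"
proof (rule plinear_eqI[where t = r])
  fix u assume "u \<in> keys r"
  show "tensor2 (tensor2 (single u 1) s) t = tensor2 (single u 1) (tensor2 s t)"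
    by (rule bilinear_eqI[where s = s and t = t]) (intro plinear_tensor2_intros | simp)+
qed (intro plinear_tensor2_intros)+

lemma tensor_list_simps [simp]:
  "tensor_list [] = single [] 1" "tensor_list (t # ts) = tensor2 t (tensor_list ts)"
  by (simp_all add: tensor_list_def)

lemma tensor_list_append: "tensor_list (ts @ ts') = tensor2 (tensor_list ts) (tensor_list ts')"
  by (induction ts) (simp_all add: tensor2_assoc)

lemma tensor2_mem_subspace:
  assumes "pm.subspace S" "\<And>u w. u \<in> keys s \<Longrightarrow> w \<in> keys t \<Longrightarrow> single (u @ w) 1 \<in> S"
  shows "tensor2 s t \<in> S"
  unfolding tensor2_alt using assms by (intro lin_ext_mem_subspace) auto

lemma tensor_words_perm:
  assumes "w \<in> tensor_words V I" "mset w' = mset w"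
  shows "w' \<in> tensor_words V I"
proof -
  have "distinct (map llabel w') = distinct (map llabel w)"
    by (rule mset_eq_imp_distinct_iff) (simp add: assms(2))
  moreover have "set w' = set w" using assms(2) by (metis set_mset_mset)
  ultimately show ?thesis using assms(1) by (auto simp: tensor_words_iff list_all_iff)
qed

lemma tensor_words_append:
  assumes "u \<in> tensor_words V I" "w \<in> tensor_words V J" "I \<inter> J = {}"
  shows "u @ w \<in> tensor_words V (I \<union> J)"
  using assms by (auto simp: tensor_words_iff)

lemma plinear_mem_keys:
  assumes "plinear F" "pm.subspace S" "\<And>w. w \<in> keys t \<Longrightarrow> F (single w 1) \<in> S"
  shows "F t \<in> S"
proof -
  have "lin_ext (\<lambda>w. F (single w 1)) t \<in> S"
    by (rule lin_ext_mem_subspace[OF assms(2)]) (rule assms(3))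
  then show ?thesis by (simp add: lin_ext_eq_plinear[OF assms(1)])
qed

lemma E_rel_add:
  assumes "u @ Letter i p x # w \<in> tensor_words V I" "u @ Letter i p y # w \<in> tensor_words V I"
  shows "single (u @ Letter i p (x + y) # w) c - single (u @ Letter i p x # w) c
     - single (u @ Letter i p y # w) c \<in> E_rel V I"
proof -
  have "single (u @ Letter i p (x + y) # w) 1 - single (u @ Letter i p x # w) 1
     - single (u @ Letter i p y # w) 1 \<in> E_rel V I"
    unfolding E_rel_def by (rule pm.span_base) (use assms in blast)
  from pm.subspace_scale[OF subspace_E_rel this, of c] show ?thesis by (simp add: pscale_diff)
qed

lemma E_rel_scale:
  assumes "u @ Letter i p x # w \<in> tensor_words V I"
  shows "single (u @ Letter i p (vscale V a x) # w) c - single (u @ Letter i p x # w) (c * a) \<in> E_rel V I"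
proof -
  have "single (u @ Letter i p (vscale V a x) # w) 1 - single (u @ Letter i p x # w) a \<in> E_rel V I"
    unfolding E_rel_def by (rule pm.span_base) (use assms in blast)
  from pm.subspace_scale[OF subspace_E_rel this, of c] show ?thesis by (simp add: pscale_diff)
qed

lemma E_rel_swap:
  assumes "u @ l # l' # w \<in> tensor_words V I"
  shows "single (u @ l # l' # w) c - single (u @ l' # l # w) (c * psign (lpar l * lpar l')) \<in> E_rel V I"
proof -
  have "single (u @ l # l' # w) 1 - single (u @ l' # l # w) (psign (lpar l * lpar l')) \<in> E_rel V I"
    unfolding E_rel_def by (rule pm.span_base) (use assms in blast)
  from pm.subspace_scale[OF subspace_E_rel this, of c] show ?thesis by (simp add: pscale_diff)
qed

lemma E_rel_induct:
  assumes "plinear f" "pm.subspace S" "t \<in> E_rel V I"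
    and "\<And>u i p x y w. u @ Letter i p x # w \<in> tensor_words V I \<Longrightarrow> u @ Letter i p y # w \<in> tensor_words V I \<Longrightarrow>
      f (single (u @ Letter i p (x + y) # w) 1) - f (single (u @ Letter i p x # w) 1)
      - f (single (u @ Letter i p y # w) 1) \<in> S"
    and "\<And>u i p x c w. u @ Letter i p x # w \<in> tensor_words V I \<Longrightarrow>
      f (single (u @ Letter i p (vscale V c x) # w) 1) - f (single (u @ Letter i p x # w) c) \<in> S"
    and "\<And>u l l' w. u @ l # l' # w \<in> tensor_words V I \<Longrightarrow>
      f (single (u @ l # l' # w) 1) - f (single (u @ l' # l # w) (psign (lpar l * lpar l'))) \<in> S"
  shows "f t \<in> S"
proof (rule plinear_mem_span[OF assms(1) assms(3)[unfolded E_rel_def] _ assms(2)])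
qed (use assms(4-6) in \<open>auto simp: plinear_diff[OF assms(1)]\<close>)

lemma E_rel_empty: "t \<in> E_rel V {} \<Longrightarrow> t = 0"
  using E_rel_induct[of "\<lambda>x. x" "{0}" t V "{}"]
  by (auto simp: tensor_words_iff plinear_intros pm.subspace_def)

text \<open>Relations stay relations in any context of tensor factors, here to the right and in the next lemma to the
left: a generator of \<open>E_rel\<close> becomes a generator when its words are extended.\<close>

lemma E_rel_tensor2_right:
  fixes V :: "('k::field_char_0, 'v::ab_group_add) ipdg"
  assumes "s \<in> E_rel V I" "t \<in> tensor_space V J" "I \<inter> J = {}"
  shows "tensor2 s t \<in> E_rel V (I \<union> J)"
proof (rule plinear_mem_keys[where t = t, OF plinear_tensor2_right subspace_E_rel])
  fix v assume "v \<in> keys t"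
  then have v: "v \<in> tensor_words V J" using assms by (auto simp: tensor_space_def)
  note app = tensor_words_append[OF _ v assms(3)]
  show "tensor2 s (single v 1) \<in> E_rel V (I \<union> J)"
  proof (rule E_rel_induct[OF plinear_tensor2_left subspace_E_rel assms(1)])
    fix u i p x y w
    assume a: "u @ Letter i p x # w \<in> tensor_words V I" "u @ Letter i p y # w \<in> tensor_words V I"
    show "tensor2 (single (u @ Letter i p (x + y) # w) 1) (single v 1)
        - tensor2 (single (u @ Letter i p x # w) 1) (single v 1)
        - tensor2 (single (u @ Letter i p y # w) 1) (single v 1) \<in> E_rel V (I \<union> J)"
      using E_rel_add[of u i p x "w @ v" V "I \<union> J" y 1] app[OF a(1)] app[OF a(2)] by simp
  next
    fix u i p x c w
    assume a: "u @ Letter i p x # w \<in> tensor_words V I"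
    show "tensor2 (single (u @ Letter i p (vscale V c x) # w) 1) (single v 1)
        - tensor2 (single (u @ Letter i p x # w) c) (single v 1) \<in> E_rel V (I \<union> J)"
      using E_rel_scale[of u i p x "w @ v" V "I \<union> J" c 1] app[OF a] by simp
  next
    fix u l l' w
    assume a: "u @ l # l' # w \<in> tensor_words V I"
    show "tensor2 (single (u @ l # l' # w) 1) (single v 1)
        - tensor2 (single (u @ l' # l # w) (psign (lpar l * lpar l'))) (single v 1) \<in> E_rel V (I \<union> J)"
      using E_rel_swap[of u l l' "w @ v" V "I \<union> J" 1] app[OF a] by simp
  qed
qed

lemma E_rel_tensor2_left:
  fixes V :: "('k::field_char_0, 'v::ab_group_add) ipdg"
  assumes "s \<in> tensor_space V J" "t \<in> E_rel V I" "J \<inter> I = {}"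
  shows "tensor2 s t \<in> E_rel V (J \<union> I)"
proof (rule plinear_mem_keys[where t = s and F = "\<lambda>s. tensor2 s t", OF plinear_tensor2_left subspace_E_rel])
  fix v assume "v \<in> keys s"
  then have v: "v \<in> tensor_words V J" using assms by (auto simp: tensor_space_def)
  note app = tensor_words_append[OF v _ assms(3)]
  show "tensor2 (single v 1) t \<in> E_rel V (J \<union> I)"
  proof (rule E_rel_induct[OF plinear_tensor2_right subspace_E_rel assms(2)])
    fix u i p x y w
    assume a: "u @ Letter i p x # w \<in> tensor_words V I" "u @ Letter i p y # w \<in> tensor_words V I"
    show "tensor2 (single v 1) (single (u @ Letter i p (x + y) # w) 1)
        - tensor2 (single v 1) (single (u @ Letter i p x # w) 1)
        - tensor2 (single v 1) (single (u @ Letter i p y # w) 1) \<in> E_rel V (J \<union> I)"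
      using E_rel_add[of "v @ u" i p x w V "J \<union> I" y 1] app[OF a(1)] app[OF a(2)] by simp
  next
    fix u i p x c w
    assume a: "u @ Letter i p x # w \<in> tensor_words V I"
    show "tensor2 (single v 1) (single (u @ Letter i p (vscale V c x) # w) 1)
        - tensor2 (single v 1) (single (u @ Letter i p x # w) c) \<in> E_rel V (J \<union> I)"
      using E_rel_scale[of "v @ u" i p x w V "J \<union> I" c 1] app[OF a] by simp
  next
    fix u l l' w
    assume a: "u @ l # l' # w \<in> tensor_words V I"
    show "tensor2 (single v 1) (single (u @ l # l' # w) 1)
        - tensor2 (single v 1) (single (u @ l' # l # w) (psign (lpar l * lpar l'))) \<in> E_rel V (J \<union> I)"
      using E_rel_swap[of "v @ u" l l' w V "J \<union> I" 1] app[OF a] by simp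
  qed
qed

text \<open>The symmetry constraint for letters implies the one for blocks: each letter of \<open>u\<close> is moved
past \<open>w\<close> by successive transpositions, beginning with the last one.\<close>

lemma E_rel_swap_blocks:
  assumes "x @ u @ w @ y \<in> tensor_words V I"
  shows "single (x @ u @ w @ y) c - single (x @ w @ u @ y) (c * psign (wpar u * wpar w)) \<in> E_rel V I"
proof -
  have move: "single (u @ l # w @ v) c - single (u @ w @ l # v) (c * psign (lpar l * wpar w)) \<in> E_rel V I"
    if "u @ l # w @ v \<in> tensor_words V I" for u l w v c
    using that
  proof (induction w arbitrary: u c)
    case Nil
    then show ?case by (simp add: pm.subspace_0[OF subspace_E_rel])
  next
    case (Cons l' w)
    have 1: "single (u @ l # l' # w @ v) c - single (u @ l' # l # w @ v) (c * psign (lpar l * lpar l')) \<in> E_rel V I"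
      using E_rel_swap[of u l l' "w @ v" V I c] Cons.prems by simp
    have 2: "single ((u @ [l']) @ l # w @ v) (c * psign (lpar l * lpar l')) -
      single ((u @ [l']) @ w @ l # v) (c * psign (lpar l * lpar l') * psign (lpar l * wpar w)) \<in> E_rel V I"
      by (rule Cons.IH, rule tensor_words_perm[OF Cons.prems]) simp
    from pm.subspace_add[OF subspace_E_rel 1 2] show ?case
      by (simp add: psign_add distrib_left mult_ac)
  qed
  show ?thesis
    using assms
  proof (induction u arbitrary: x c)
    case Nil
    then show ?case by (simp add: pm.subspace_0[OF subspace_E_rel])
  next
    case (Cons l u)
    let ?c = "c * psign (wpar u * wpar w)"
    have 1: "single ((x @ [l]) @ u @ w @ y) c - single ((x @ [l]) @ w @ u @ y) ?c \<in> E_rel V I"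
      by (rule Cons.IH) (use Cons.prems in simp)
    have 2: "single (x @ l # w @ u @ y) ?c - single (x @ w @ l # u @ y) (?c * psign (lpar l * wpar w)) \<in> E_rel V I"
      by (rule move, rule tensor_words_perm[OF Cons.prems]) simp
    from pm.subspace_add[OF subspace_E_rel 1 2] show ?case
      by (simp add: psign_add distrib_left distrib_right mult_ac)
  qed
qed

lemma E_space_tensor_space: "t \<in> E_space V I p \<Longrightarrow> t \<in> tensor_space V I"
  by (auto simp: E_space_def tensor_space_def)

lemma E_rel_tensor2_commute:
  assumes "s \<in> E_space V I p" "t \<in> E_space V J q" "I \<inter> J = {}"
  shows "tensor2 s t - pscale (psign (p * q)) (tensor2 t s) \<in> E_rel V (I \<union> J)"
proof -
  have swapped: "tensor2 t s = (\<Sum>u\<in>keys s. \<Sum>w\<in>keys t. single (w @ u) (lookup s u * lookup t w))"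
    unfolding tensor2_def by (subst sum.swap) (simp add: mult.commute)
  have "tensor2 s t - pscale (psign (p * q)) (tensor2 t s) =
    (\<Sum>u\<in>keys s. \<Sum>w\<in>keys t. pscale (lookup s u * lookup t w)
       (single (u @ w) 1 - single (w @ u) (psign (p * q))))"
    unfolding swapped by (simp add: tensor2_def pscale_sum pscale_diff sum_subtractf mult_ac)
  also have "\<dots> \<in> E_rel V (I \<union> J)"
  proof (intro pm.subspace_sum[OF subspace_E_rel] pm.subspace_scale[OF subspace_E_rel])
    fix u w assume "u \<in> keys s" "w \<in> keys t"
    then have uw: "u \<in> tensor_words V I" "wpar u = p" "w \<in> tensor_words V J" "wpar w = q"
      using assms by (auto simp: E_space_def)
    show "single (u @ w) 1 - single (w @ u) (psign (p * q)) \<in> E_rel V (I \<union> J)"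
      using E_rel_swap_blocks[of "[]" u w "[]" V "I \<union> J" 1] tensor_words_append[OF uw(1,3) assms(3)] uw
      by simp
  qed
  finally show ?thesis .
qed

section \<open>Compatibility of contraction with the tensor calculus\<close>

definition relabel_letter :: "(nat \<Rightarrow> nat) \<Rightarrow> 'v letter \<Rightarrow> 'v letter" where
  "relabel_letter \<sigma> l = Letter (\<sigma> (llabel l)) (lpar l) (lvec l)"

lemma relabel_letter_simps [simp]:
  "llabel (relabel_letter \<sigma> l) = \<sigma> (llabel l)" "lpar (relabel_letter \<sigma> l) = lpar l"
  "lvec (relabel_letter \<sigma> l) = lvec l"
  by (simp_all add: relabel_letter_def)

lemma E_act_single [simp]: "E_act \<sigma> (single w c) = single (map (relabel_letter \<sigma>) w) c"
  by (simp add: E_act_def relabel_letter_def[abs_def])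

lemma plinear_E_act: "plinear (E_act \<sigma>)"
  by (simp add: E_act_def plinear_lin_ext)

lemma E_act_tensor2: "E_act \<sigma> (tensor2 s t) = tensor2 (E_act \<sigma> s) (E_act \<sigma> t)"
  by (rule bilinear_eqI[where s = s and t = t])
    (intro plinear_tensor2_intros plinear_compose[OF plinear_E_act] plinear_E_act plinear_tensor2_right | simp)+

lemma relabel_letter_ok [simp]: "letter_ok V (relabel_letter \<sigma> l) = letter_ok V l"
  by (simp add: letter_ok_def)

lemma E_act_mem:
  assumes "t \<in> tensor_space V I" "inj_on \<sigma> I"
  shows "E_act \<sigma> t \<in> tensor_space V (\<sigma> ` I)"
  unfolding E_act_def
proof (rule lin_ext_mem_subspace[OF subspace_tensor_space])
  fix w assume "w \<in> keys t"
  then have w: "w \<in> tensor_words V I" using assms by (auto simp: tensor_space_def)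
  have "map llabel (map (relabel_letter \<sigma>) w) = map \<sigma> (map llabel w)"
    by (simp add: comp_def)
  moreover have "distinct (map \<sigma> (map llabel w))"
    using w assms(2) unfolding distinct_map[of \<sigma>] by (auto simp: tensor_words_iff)
  ultimately have "map (relabel_letter \<sigma>) w \<in> tensor_words V (\<sigma> ` I)"
    using w by (auto simp: tensor_words_iff list_all_iff image_image comp_def)
  then show "single (map (\<lambda>l. Letter (\<sigma> (llabel l)) (lpar l) (lvec l)) w) 1 \<in> tensor_space V (\<sigma> ` I)"
    by (intro tensor_space_single) (simp add: relabel_letter_def[abs_def])
qed

lemma unshuffle_par_map:
  assumes "\<And>x. x \<in> set w \<Longrightarrow> par (h x) = par' x \<and> P (h x) = P' x"
  shows "unshuffle_par par P (map h w) = unshuffle_par par' P' w"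
  using assms
proof (induction w)
  case (Cons x w)
  then have "map par (filter P (map h w)) = map par' (filter P' w)"
    by (auto simp: filter_map comp_def intro!: map_cong filter_cong)
  then show ?case using Cons by simp
qed simp

lemma pair_form_map: "(\<And>a b. B (h a) (h b) = B a b) \<Longrightarrow> pair_form B (map h ls) = pair_form B ls"
  by (auto simp: pair_form_def split: list.splits)

lemma contraction_E_act:
  assumes "t \<in> tensor_space V I" "inj_on \<sigma> J" "I \<subseteq> J" "e \<subseteq> J"
  shows "contraction V r (\<sigma> ` e) (E_act \<sigma> t) = E_act \<sigma> (contraction V r e t)"
proof (rule plinear_eqI[where t = t])
  fix w assume "w \<in> keys t"
  then have "w \<in> tensor_words V I" using assms(1) by (auto simp: tensor_space_def)
  then have w: "llabel ` set w \<subseteq> J" using assms(3) by (auto simp: tensor_words_iff)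
  have iff: "llabel (relabel_letter \<sigma> l) \<in> \<sigma> ` e \<longleftrightarrow> llabel l \<in> e" if "l \<in> set w" for l
    using that w assms(2,4) by (auto simp: inj_on_def)
  have "filter (\<lambda>l. llabel l \<in> \<sigma> ` e) (map (relabel_letter \<sigma>) w) =
      map (relabel_letter \<sigma>) (filter (\<lambda>l. llabel l \<in> e) w)"
    "filter (\<lambda>l. llabel l \<notin> \<sigma> ` e) (map (relabel_letter \<sigma>) w) =
      map (relabel_letter \<sigma>) (filter (\<lambda>l. llabel l \<notin> e) w)"
    unfolding filter_map comp_def using iff by (auto intro!: arg_cong[of _ _ "map _"] filter_cong)
  moreover have "unshuffle_par lpar (\<lambda>l. llabel l \<in> \<sigma> ` e) (map (relabel_letter \<sigma>) w) =
      unshuffle_par lpar (\<lambda>l. llabel l \<in> e) w"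
    using iff by (intro unshuffle_par_map) auto
  moreover have "pair_form (op_form V r) (map (relabel_letter \<sigma>) ls) = pair_form (op_form V r) ls" for ls
    by (rule pair_form_map) (simp add: op_form_def)
  ultimately show "contraction V r (\<sigma> ` e) (E_act \<sigma> (single w 1)) = E_act \<sigma> (contraction V r e (single w 1))"
    by (simp add: contraction_def contract_word_eq contract_with_def)
qed (intro plinear_tensor2_intros plinear_compose[OF plinear_E_act] plinear_E_act)+

text \<open>Contraction is local: it does not see the tensor factors to the right of the edge.  There is no sign,
since the contracted letters pass only letters of the first factor.\<close>

lemma contraction_tensor2:
  assumes "t \<in> tensor_space V J" "J \<inter> e = {}"
  shows "contraction V r e (tensor2 s t) = tensor2 (contraction V r e s) t"
proof (rule bilinear_eqI[where s = s and t = t])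
  fix u w assume "w \<in> keys t"
  then have "w \<in> tensor_words V J" using assms(1) by (auto simp: tensor_space_def)
  then have w: "llabel l \<notin> e" if "l \<in> set w" for l
    using assms(2) that by (auto simp: tensor_words_iff)
  then have "filter (\<lambda>l. llabel l \<in> e) w = []" "filter (\<lambda>l. llabel l \<notin> e) w = w"
    "unshuffle_par lpar (\<lambda>l. llabel l \<in> e) w = 0"
    by (auto simp: filter_empty_conv filter_id_conv intro: unshuffle_par_none)
  then show "contraction V r e (tensor2 (single u 1) (single w 1)) = tensor2 (contraction V r e (single u 1)) (single w 1)"
    by (simp add: contraction_def contract_word_eq contract_with_def unshuffle_par_append)
qed (intro plinear_tensor2_intros plinear_tensor2_right)+

lemma pcons_eq_tensor2: "pcons l t = tensor2 (single [l] 1) t"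
  by (rule plinear_eqI[where t = t]) (intro plinear_tensor2_intros plinear_pcons plinear_tensor2_right | simp)+

lemma E_diff_append:
  fixes V :: "('k::field_char_0, 'v) ipdg"
  shows "E_diff V (single (u @ w) 1) = tensor2 (E_diff V (single u 1)) (single w 1)
    + pscale (psign (wpar u)) (tensor2 (single u 1) (E_diff V (single w 1)))"
proof (induction u)
  case Nil
  then show ?case by (simp add: plinear_zero[OF plinear_tensor2_left])
next
  case (Cons l u)
  have "tensor2 (single [l] 1) (tensor2 (single u 1) t) = tensor2 (single (l # u) 1) t"
    for t :: "'v letter list \<Rightarrow>\<^sub>0 'k"
    by (simp flip: tensor2_assoc)
  then show ?case
    unfolding append_Cons E_diff_Cons Cons.IH
    by (simp add: pcons_eq_tensor2 plinear_add[OF plinear_tensor2_left] plinear_add[OF plinear_tensor2_right]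
      plinear_scale[OF plinear_tensor2_left] plinear_scale[OF plinear_tensor2_right] tensor2_assoc
      pscale_add psign_add)
qed

lemma E_diff_tensor2:
  assumes "s \<in> E_space V I p"
  shows "E_diff V (tensor2 s t) = tensor2 (E_diff V s) t + pscale (psign p) (tensor2 s (E_diff V t))"
proof (rule bilinear_eqI[where s = s and t = t])
  fix u w assume "u \<in> keys s"
  then have "wpar u = p" using assms by (auto simp: E_space_def)
  then show "E_diff V (tensor2 (single u 1) (single w 1)) =
    tensor2 (E_diff V (single u 1)) (single w 1) + pscale (psign p) (tensor2 (single u 1) (E_diff V (single w 1)))"
    by (simp add: E_diff_append)
qed (intro plinear_tensor2_intros plinear_E_diff plinear_tensor2_right)+

context inner_dg_space
begin

lemma pair_form_length: "length ls \<noteq> 2 \<Longrightarrow> pair_form B ls = 0"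
  by (auto simp: pair_form_def split: list.splits)

text \<open>A letter in the middle of a list of contracted letters can only matter if it is one of exactly two; this
reduces multilinearity and symmetry of \<open>pair_form\<close> to those of the form itself.\<close>

lemma pair_form_middle:
  "pair_form B (u @ l # w) = (if u = [] \<and> length w = 1 then B l (hd w)
     else if length u = 1 \<and> w = [] then B (hd u) l else 0)"
proof (cases "length u + length w = 1")
  case True
  then show ?thesis by (cases u; cases w) auto
next
  case False
  then show ?thesis using pair_form_length[of "u @ l # w" B] by auto
qed

lemma pair_form_middle2:
  "pair_form B (u @ l # l' # w) = (if u = [] \<and> w = [] then B l l' else 0)"
  using pair_form_length[of "u @ l # l' # w" B] by (cases u; cases w) auto

text \<open>Contraction descends to the tensor powers.  A generator of \<open>E_rel\<close> at uncontracted letters is sent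
to a generator; at contracted letters it is killed, by bilinearity and symmetry of the form.  If just one
of two interchanged letters is contracted, then the sign in the relation is the change of the
unshuffling sign.\<close>

lemma contraction_E_rel:
  assumes "self_adjoint q r" "t \<in> E_rel V I"
  shows "contraction V r e t \<in> E_rel V (I - e)"
proof (rule E_rel_induct[OF plinear_contraction subspace_E_rel assms(2)])
  let ?out = "filter (\<lambda>l. llabel l \<notin> e)" and ?in = "filter (\<lambda>l. llabel l \<in> e)"
  note C = contraction_def contract_word_eq contract_with_def
  have out: "?out w \<in> tensor_words V (I - e)" if "w \<in> tensor_words V I" for w
    using that by (auto simp: tensor_words_iff distinct_map_filter list_all_iff)
  have sp0: "0 \<in> E_rel V (I - e)" by (rule pm.subspace_0[OF subspace_E_rel])
  note add = op_form_add[OF assms(1)]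
  {
    fix u i p x y w
    assume a: "u @ Letter i p x # w \<in> tensor_words V I" "u @ Letter i p y # w \<in> tensor_words V I"
    show "contraction V r e (single (u @ Letter i p (x + y) # w) 1)
        - contraction V r e (single (u @ Letter i p x # w) 1)
        - contraction V r e (single (u @ Letter i p y # w) 1) \<in> E_rel V (I - e)"
    proof (cases "i \<in> e")
      case True
      then show ?thesis
        using sp0 by (simp add: C unshuffle_par_append pair_form_middle add distrib_left flip: single_diff)
    next
      case False
      then show ?thesis
        using E_rel_add[of "?out u" i p x "?out w" V "I - e" y] out[OF a(1)] out[OF a(2)]
        by (simp add: C unshuffle_par_append)
    qed
  next
    fix u i p x c w
    assume a: "u @ Letter i p x # w \<in> tensor_words V I"
    show "contraction V r e (single (u @ Letter i p (vscale V c x) # w) 1)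
        - contraction V r e (single (u @ Letter i p x # w) c) \<in> E_rel V (I - e)"
    proof (cases "i \<in> e")
      case True
      then show ?thesis
        using sp0 by (simp add: C unshuffle_par_append pair_form_middle add mult_ac flip: single_diff)
    next
      case False
      then show ?thesis
        using E_rel_scale[of "?out u" i p x "?out w" V "I - e" c] out[OF a(1)]
        by (simp add: C unshuffle_par_append mult.commute[of c])
    qed
  next
    fix u l l' w
    assume a: "u @ l # l' # w \<in> tensor_words V I"
    have ok: "letter_ok V l" "letter_ok V l'" using a by (auto simp: tensor_words_iff)
    note sym = op_form_sym[OF assms(1) ok]
    consider "llabel l \<in> e" "llabel l' \<in> e" | "llabel l \<in> e" "llabel l' \<notin> e"
      | "llabel l \<notin> e" "llabel l' \<in> e" | "llabel l \<notin> e" "llabel l' \<notin> e" by blast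
    then show "contraction V r e (single (u @ l # l' # w) 1)
        - contraction V r e (single (u @ l' # l # w) (psign (lpar l * lpar l'))) \<in> E_rel V (I - e)"
    proof cases
      case 1
      then show ?thesis
        using sp0 by (simp add: C unshuffle_par_append pair_form_middle2 sym add_ac mult_ac)
    next
      case 2
      then show ?thesis
        using sp0 by (simp add: C unshuffle_par_append psign_add distrib_left distrib_right mult_ac)
    next
      case 3
      then show ?thesis
        using sp0 by (simp add: C unshuffle_par_append psign_add distrib_left distrib_right mult_ac)
    next
      case 4
      then show ?thesis
        using E_rel_swap[of "?out u" l l' "?out w" V "I - e"] out[OF a]
        by (simp add: C unshuffle_par_append add_ac mult.commute[of "psign (lpar l * lpar l')"])
    qed
  }
qed

end

section \<open>Contraction along a line of propagators\<close>

text \<open>Contraction along the edges with the propagator \<open>s + t\<delta>\<close>, followed by the functional on \<open>k[t]\<close> with moments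
\<open>a\<close>: choosing \<open>t\<delta>\<close> on an edge shifts the moments.\<close>

fun path_contraction :: "('k::field_char_0, 'v) ipdg \<Rightarrow> ('v \<Rightarrow> 'v) \<Rightarrow> ('v \<Rightarrow> 'v) \<Rightarrow> (nat \<Rightarrow> 'k) \<Rightarrow>
    nat set list \<Rightarrow> ('v letter list \<Rightarrow>\<^sub>0 'k) \<Rightarrow> ('v letter list \<Rightarrow>\<^sub>0 'k)" where
  "path_contraction V s \<delta> a [] t = pscale (a 0) t"
| "path_contraction V s \<delta> a (e # es) t = contraction V s e (path_contraction V s \<delta> a es t)
     + contraction V \<delta> e (path_contraction V s \<delta> (\<lambda>k. a (Suc k)) es t)"

text \<open>The coefficient of \<open>dt\<close> in the contraction with \<open>s + t\<delta> + r dt\<close>, where exactly one edge carries \<open>r\<close>.  The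
signs come from moving the odd symbol \<open>dt\<close> to the front, past the odd contractions by \<open>s + t\<delta>\<close>.\<close>

fun path_contraction_dt :: "('k::field_char_0, 'v) ipdg \<Rightarrow> ('v \<Rightarrow> 'v) \<Rightarrow> ('v \<Rightarrow> 'v) \<Rightarrow> ('v \<Rightarrow> 'v) \<Rightarrow> (nat \<Rightarrow> 'k) \<Rightarrow>
    nat set list \<Rightarrow> ('v letter list \<Rightarrow>\<^sub>0 'k) \<Rightarrow> ('v letter list \<Rightarrow>\<^sub>0 'k)" where
  "path_contraction_dt V s \<delta> r a [] t = 0"
| "path_contraction_dt V s \<delta> r a (e # es) t = contraction V r e (path_contraction V s \<delta> a es t)
     - contraction V s e (path_contraction_dt V s \<delta> r a es t)
     - contraction V \<delta> e (path_contraction_dt V s \<delta> r (\<lambda>k. a (Suc k)) es t)"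

text \<open>What a family of operators, indexed by lists of edges, must satisfy in order to define a
functional on the graph complex: it must descend to tensor powers, alternate in the edges
and be natural in the labels.\<close>

locale edge_contraction = inner_dg_space V
  for V :: "('k::field_char_0, 'v::ab_group_add) ipdg" +
  fixes Q :: "nat set list \<Rightarrow> ('v letter list \<Rightarrow>\<^sub>0 'k) \<Rightarrow> ('v letter list \<Rightarrow>\<^sub>0 'k)"
  assumes Q_linear: "plinear (Q es)"
    and Q_mem: "t \<in> tensor_space V I \<Longrightarrow> Q es t \<in> tensor_space V (I - \<Union>(set es))"
    and Q_rel: "t \<in> E_rel V I \<Longrightarrow> Q es t \<in> E_rel V (I - \<Union>(set es))"
    and Q_swap: "t \<in> tensor_space V I \<Longrightarrow> e \<inter> f = {} \<Longrightarrow> Q (es @ e # f # fs) t = - Q (es @ f # e # fs) t"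
    and Q_act: "\<lbrakk>t \<in> tensor_space V I; inj_on \<sigma> J; I \<subseteq> J; \<Union>(set es) \<subseteq> J\<rbrakk> \<Longrightarrow>
      Q (map ((`) \<sigma>) es) (E_act \<sigma> t) = E_act \<sigma> (Q es t)"

text \<open>The pullback of \<open>Q\<close> along the differential of the graph complex, expressed by tensors: the first summand
corresponds to the internal differential, and in the second one the contraction of an edge of
the graph has become contraction by the inner product, the form of the identity.\<close>

definition total_boundary :: "('k::field_char_0, 'v::ab_group_add) ipdg \<Rightarrow>
    (nat set list \<Rightarrow> ('v letter list \<Rightarrow>\<^sub>0 'k) \<Rightarrow> ('v letter list \<Rightarrow>\<^sub>0 'k)) \<Rightarrow>
    nat set list \<Rightarrow> ('v letter list \<Rightarrow>\<^sub>0 'k) \<Rightarrow> ('v letter list \<Rightarrow>\<^sub>0 'k)" where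
  "total_boundary V Q es t = pscale (psign (of_nat (length es))) (Q es (E_diff V t)) +
     (\<Sum>j<length es. pscale (psign (of_nat j)) (Q (take j es @ drop (Suc j) es) (contraction V (\<lambda>x. x) (es ! j) t)))"

lemma psign_of_nat_Suc: "psign (of_nat (Suc j)) = (- psign (of_nat j) :: 'k::field_char_0)"
  by (simp add: psign_add)

lemma total_boundary_Nil: "total_boundary V Q [] t = Q [] (E_diff V t)"
  by (simp add: total_boundary_def)

lemma total_boundary_Cons:
  "total_boundary V Q (e # es) t = Q es (contraction V (\<lambda>x. x) e t) - total_boundary V (\<lambda>es. Q (e # es)) es t"
  by (simp add: total_boundary_def sum.lessThan_Suc_shift psign_of_nat_Suc pscale_minus sum_negf
      del: sum.lessThan_Suc of_nat_Suc)

lemma total_boundary_linear: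
  assumes "plinear f"
  shows "total_boundary V (\<lambda>es t. f (Q es t)) es t = f (total_boundary V Q es t)"
  by (simp add: total_boundary_def plinearD[OF assms])

lemma total_boundary_add:
  "total_boundary V (\<lambda>es t. Q es t + Q' es t) es t = total_boundary V Q es t + total_boundary V Q' es t"
  by (simp add: total_boundary_def pscale_add sum.distrib)

lemma total_boundary_diff:
  "total_boundary V (\<lambda>es t. Q es t - Q' es t) es t = total_boundary V Q es t - total_boundary V Q' es t"
  by (simp add: total_boundary_def pscale_diff sum_subtractf)

context inner_dg_space
begin

lemma id_adj: "self_adjoint 0 (\<lambda>x. x)"
  by (simp add: self_adjoint_def Vector_Spaces.linear_iff vector_space_V)

end

text \<open>The conditions on the graded commutators with the differential say that \<open>[d, s + t\<delta>] = 1\<close> along the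
line, and that the derivative \<open>\<delta>\<close> of the line is the boundary of \<open>r\<close>.\<close>

locale homotopy_path = inner_dg_space V
  for V :: "('k::field_char_0, 'v::ab_group_add) ipdg" +
  fixes s \<delta> r :: "'v \<Rightarrow> 'v"
  assumes s_adj: "self_adjoint 1 s" and \<delta>_adj: "self_adjoint 1 \<delta>" and r_adj: "self_adjoint 0 r"
    and s_homotopy: "vdiff V (s x) + s (vdiff V x) = x"
    and \<delta>_closed: "vdiff V (\<delta> x) + \<delta> (vdiff V x) = 0"
    and r_primitive: "vdiff V (r x) - r (vdiff V x) = \<delta> x"
begin

abbreviation "C \<equiv> contraction V"
abbreviation "G \<equiv> path_contraction V s \<delta>"
abbreviation "H \<equiv> path_contraction_dt V s \<delta> r"

lemma vscale_minus_one: "vscale V (- 1) x = - x" "vscale V 1 x = x"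
proof -
  interpret vs: vector_space "vscale V" by (rule vector_space_V)
  show "vscale V (- 1) x = - x" "vscale V 1 x = x" by simp_all
qed

lemma contraction_zero: "contraction V (\<lambda>x. 0) e t = 0"
proof -
  have "vform V 0 y = 0" for y
    using form_add(1)[of 0 0 y] by simp
  then have "pair_form (op_form V (\<lambda>x. 0)) ls = 0" for ls :: "'v letter list"
    by (auto simp: pair_form_def op_form_def split: list.splits)
  then have "contraction V (\<lambda>x. 0) e = lin_ext (\<lambda>w. 0)"
    by (simp add: contraction_def contract_word_eq contract_with_def[abs_def])
  then show ?thesis by (simp add: lin_ext_def)
qed

lemma E_diff_C:
  assumes "t \<in> tensor_space V I"
  shows "E_diff V (C s e t) = C (\<lambda>x. x) e t - C s e (E_diff V t)"
    "E_diff V (C \<delta> e t) = - C \<delta> e (E_diff V t)"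
    "E_diff V (C r e t) = C r e (E_diff V t) + C \<delta> e t"
proof -
  have "x = vdiff V (s x) - vscale V (psign 1) (s (vdiff V x))" for x
    by (simp add: vscale_minus_one s_homotopy)
  from E_diff_contraction[OF s_adj assms this] show "E_diff V (C s e t) = C (\<lambda>x. x) e t - C s e (E_diff V t)"
    by simp
  have "0 = vdiff V (\<delta> x) - vscale V (psign 1) (\<delta> (vdiff V x))" for x
    by (simp add: vscale_minus_one \<delta>_closed)
  from E_diff_contraction[OF \<delta>_adj assms this] show "E_diff V (C \<delta> e t) = - C \<delta> e (E_diff V t)"
    by (simp add: contraction_zero)
  have "\<delta> x = vdiff V (r x) - vscale V (psign 0) (r (vdiff V x))" for x
    by (simp add: vscale_minus_one r_primitive)
  from E_diff_contraction[OF r_adj assms this] show "E_diff V (C r e t) = C r e (E_diff V t) + C \<delta> e t"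
    by simp
qed

lemma plinear_G: "plinear (G a es)"
  by (induction es arbitrary: a)
    (auto simp: path_contraction.simps[abs_def]
      intro!: plinear_intros plinear_compose[OF plinear_contraction])

lemma plinear_H: "plinear (H a es)"
  by (induction es arbitrary: a)
    (auto simp: path_contraction_dt.simps[abs_def]
      intro!: plinear_intros plinear_compose[OF plinear_contraction] plinear_G)

lemma tensor_space_closed:
  "x \<in> tensor_space V I \<Longrightarrow> y \<in> tensor_space V I \<Longrightarrow> x + y \<in> tensor_space V I"
  "x \<in> tensor_space V I \<Longrightarrow> y \<in> tensor_space V I \<Longrightarrow> x - y \<in> tensor_space V I"
  "x \<in> tensor_space V I \<Longrightarrow> pscale c x \<in> tensor_space V I" "0 \<in> tensor_space V I"
  using subspace_tensor_space[of V I]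
  by (simp_all add: pm.subspace_add pm.subspace_diff pm.subspace_scale pm.subspace_0)

lemma E_rel_closed:
  "x \<in> E_rel V I \<Longrightarrow> y \<in> E_rel V I \<Longrightarrow> x + y \<in> E_rel V I"
  "x \<in> E_rel V I \<Longrightarrow> y \<in> E_rel V I \<Longrightarrow> x - y \<in> E_rel V I"
  "x \<in> E_rel V I \<Longrightarrow> pscale c x \<in> E_rel V I" "0 \<in> E_rel V I"
  using subspace_E_rel[of V I]
  by (simp_all add: pm.subspace_add pm.subspace_diff pm.subspace_scale pm.subspace_0)

lemma C_mem_minus:
  "t \<in> tensor_space V (I - J) \<Longrightarrow> C r' e t \<in> tensor_space V (I - (e \<union> J))"
  using contraction_mem[of t V "I - J" r' e] by (simp add: Diff_eq Int_ac Compl_Un)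

lemma C_rel_minus:
  "self_adjoint q r' \<Longrightarrow> t \<in> E_rel V (I - J) \<Longrightarrow> C r' e t \<in> E_rel V (I - (e \<union> J))"
  using contraction_E_rel[of q r' t "I - J" e] by (simp add: Diff_eq Int_ac Compl_Un)

lemma G_mem: "t \<in> tensor_space V I \<Longrightarrow> G a es t \<in> tensor_space V (I - \<Union>(set es))"
  by (induction es arbitrary: a) (auto intro!: tensor_space_closed C_mem_minus)

lemma H_mem: "t \<in> tensor_space V I \<Longrightarrow> H a es t \<in> tensor_space V (I - \<Union>(set es))"
  by (induction es arbitrary: a) (auto intro!: tensor_space_closed C_mem_minus G_mem)

lemma G_rel: "t \<in> E_rel V I \<Longrightarrow> G a es t \<in> E_rel V (I - \<Union>(set es))"
  by (induction es arbitrary: a)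
    (auto intro!: E_rel_closed C_rel_minus[OF s_adj] C_rel_minus[OF \<delta>_adj])

lemma H_rel: "t \<in> E_rel V I \<Longrightarrow> H a es t \<in> E_rel V (I - \<Union>(set es))"
  by (induction es arbitrary: a)
    (auto intro!: E_rel_closed C_rel_minus[OF s_adj] C_rel_minus[OF \<delta>_adj] C_rel_minus[OF r_adj] G_rel)

text \<open>Contractions by the odd operators \<open>s\<close> and \<open>\<delta>\<close> anticommute, and those by the even operator \<open>r\<close> commute
with them.  This is why the amplitudes alternate in the edges.\<close>

lemma C_swap:
  assumes "t \<in> tensor_space V I" "e \<inter> f = {}"
  shows "C s e (C s f t) = - C s f (C s e t)" "C s e (C \<delta> f t) = - C \<delta> f (C s e t)"
    "C \<delta> e (C s f t) = - C s f (C \<delta> e t)" "C \<delta> e (C \<delta> f t) = - C \<delta> f (C \<delta> e t)"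
    "C r e (C s f t) = C s f (C r e t)" "C r e (C \<delta> f t) = C \<delta> f (C r e t)"
  using contraction_commute[OF s_adj s_adj assms(2,1)] contraction_commute[OF s_adj \<delta>_adj assms(2,1)]
    contraction_commute[OF \<delta>_adj s_adj assms(2,1)] contraction_commute[OF \<delta>_adj \<delta>_adj assms(2,1)]
    contraction_commute[OF r_adj s_adj assms(2,1)] contraction_commute[OF r_adj \<delta>_adj assms(2,1)]
  by simp_all

lemma G_swap:
  assumes "t \<in> tensor_space V I" "e \<inter> f = {}"
  shows "G a (es @ e # f # fs) t = - G a (es @ f # e # fs) t"
proof (induction es arbitrary: a)
  case Nil
  note sw = C_swap[OF G_mem[OF assms(1)] assms(2)]
  show ?case by (simp add: plinearD[OF plinear_contraction] sw)
next
  case (Cons e' es)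
  then show ?case by (simp add: plinearD[OF plinear_contraction])
qed

lemma H_swap:
  assumes "t \<in> tensor_space V I" "e \<inter> f = {}"
  shows "H a (es @ e # f # fs) t = - H a (es @ f # e # fs) t"
proof (induction es arbitrary: a)
  case Nil
  have fe: "f \<inter> e = {}" using assms(2) by auto
  note sw = C_swap[OF H_mem[OF assms(1)] assms(2)] C_swap(5,6)[OF G_mem[OF assms(1)] assms(2)]
     C_swap(5,6)[OF G_mem[OF assms(1)] fe]
  show ?case by (simp add: plinearD[OF plinear_contraction] sw)
next
  case (Cons e' es)
  then show ?case by (simp add: plinearD[OF plinear_contraction] G_swap[OF assms])
qed

lemma G_act:
  assumes "t \<in> tensor_space V I" "inj_on \<sigma> J" "I \<subseteq> J" "\<Union>(set es) \<subseteq> J"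
  shows "G a (map ((`) \<sigma>) es) (E_act \<sigma> t) = E_act \<sigma> (G a es t)"
  using assms(4)
proof (induction es arbitrary: a)
  case (Cons e es)
  then have e: "e \<subseteq> J" "I - \<Union>(set es) \<subseteq> J" and IH: "\<And>a. G a (map ((`) \<sigma>) es) (E_act \<sigma> t) = E_act \<sigma> (G a es t)"
    using assms(3) by auto
  show ?case
    by (simp add: IH contraction_E_act[OF G_mem[OF assms(1)] assms(2) e(2) e(1)]
        plinearD[OF plinear_E_act])
qed (simp add: plinearD[OF plinear_E_act])

lemma H_act:
  assumes "t \<in> tensor_space V I" "inj_on \<sigma> J" "I \<subseteq> J" "\<Union>(set es) \<subseteq> J"
  shows "H a (map ((`) \<sigma>) es) (E_act \<sigma> t) = E_act \<sigma> (H a es t)"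
  using assms(4)
proof (induction es arbitrary: a)
  case (Cons e es)
  then have e: "e \<subseteq> J" "I - \<Union>(set es) \<subseteq> J" "\<Union>(set es) \<subseteq> J"
    and IH: "\<And>a. H a (map ((`) \<sigma>) es) (E_act \<sigma> t) = E_act \<sigma> (H a es t)"
    using assms(3) by auto
  show ?case
    by (simp add: IH G_act[OF assms(1,2,3) e(3)] contraction_E_act[OF G_mem[OF assms(1)] assms(2) e(2) e(1)]
        contraction_E_act[OF H_mem[OF assms(1)] assms(2) e(2) e(1)] plinearD[OF plinear_E_act])
qed (simp add: plinearD[OF plinear_E_act])

sublocale G: edge_contraction V "G a" for a
  by (intro edge_contraction.intro edge_contraction_axioms.intro inner_dg_space_axioms
      plinear_G G_mem G_rel G_swap G_act)

sublocale H: edge_contraction V "H a" for a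
  by (intro edge_contraction.intro edge_contraction_axioms.intro inner_dg_space_axioms
      plinear_H H_mem H_rel H_swap H_act)

text \<open>The inner product is even, so contraction by it commutes with everything at other edges.\<close>

lemma G_C_id:
  assumes "t \<in> tensor_space V I" "\<forall>f\<in>set es. e \<inter> f = {}"
  shows "G a es (C (\<lambda>x. x) e t) = C (\<lambda>x. x) e (G a es t)"
  using assms(2)
proof (induction es arbitrary: a)
  case (Cons f es)
  then have "f \<inter> e = {}" by auto
  then show ?case
    using Cons contraction_commute[OF s_adj id_adj _ G_mem[OF assms(1)]]
      contraction_commute[OF \<delta>_adj id_adj _ G_mem[OF assms(1)]]
    by (simp add: plinearD[OF plinear_contraction])
qed (simp add: plinearD[OF plinear_contraction])

lemma H_C_id:
  assumes "t \<in> tensor_space V I" "\<forall>f\<in>set es. e \<inter> f = {}"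
  shows "H a es (C (\<lambda>x. x) e t) = C (\<lambda>x. x) e (H a es t)"
  using assms(2)
proof (induction es arbitrary: a)
  case (Cons f es)
  then have "f \<inter> e = {}" by auto
  then show ?case
    using Cons contraction_commute[OF s_adj id_adj _ H_mem[OF assms(1)]]
      contraction_commute[OF \<delta>_adj id_adj _ H_mem[OF assms(1)]]
      contraction_commute[OF r_adj id_adj _ G_mem[OF assms(1)]]
    by (simp add: plinearD[OF plinear_contraction] G_C_id[OF assms(1)])
qed (simp add: plinearD[OF plinear_contraction])

lemma G_add: "G (\<lambda>k. a k + b k) es t = G a es t + G b es t"
  by (induction es arbitrary: a b) (simp_all add: pscale_add_left plinearD[OF plinear_contraction])

text \<open>Moving the differential through the contractions turns \<open>s\<close> on one edge into the identity and creates no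
term from \<open>\<delta>\<close>, which commutes with the differential.\<close>

lemma total_boundary_G:
  assumes "t \<in> tensor_space V I" "sorted_wrt (\<lambda>e f. e \<inter> f = {}) es"
  shows "total_boundary V (G a) es t = E_diff V (G a es t)"
  using assms(2)
proof (induction es arbitrary: a)
  case Nil
  then show ?case by (simp add: total_boundary_Nil plinearD[OF plinear_E_diff])
next
  case (Cons e es)
  then have 1: "\<forall>f\<in>set es. e \<inter> f = {}" and IH: "\<And>a. total_boundary V (G a) es t = E_diff V (G a es t)"
    by auto
  note mem = G_mem[OF assms(1)]
  have "total_boundary V (\<lambda>es. G a (e # es)) es t =
      C s e (E_diff V (G a es t)) + C \<delta> e (E_diff V (G (\<lambda>k. a (Suc k)) es t))"
    by (simp add: path_contraction.simps(2)[abs_def] total_boundary_add total_boundary_linear[OF plinear_contraction] IH)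
  then show ?case
    by (simp add: total_boundary_Cons G_C_id[OF assms(1) 1] plinearD[OF plinear_E_diff]
        E_diff_C[OF mem])
qed

text \<open>The additional terms, compared with the case of \<open>G\<close>, arise when the differential meets the edge with \<open>r\<close>,
where it leaves \<open>\<delta>\<close>.  Summed over all edges they form the derivative of the
contraction by \<open>s + t\<delta>\<close> with respect to \<open>t\<close>.\<close>

lemma total_boundary_H:
  assumes "t \<in> tensor_space V I" "sorted_wrt (\<lambda>e f. e \<inter> f = {}) es"
  shows "total_boundary V (H a) es t = G (\<lambda>k. of_nat k * a (k - 1)) es t - E_diff V (H a es t)"
  using assms(2)
proof (induction es arbitrary: a)
  case Nil
  then show ?case by (simp add: total_boundary_Nil plinearD[OF plinear_E_diff])
next
  case (Cons e es)
  then have 1: "\<forall>f\<in>set es. e \<inter> f = {}" and s: "sorted_wrt (\<lambda>e f. e \<inter> f = {}) es"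
    and IH: "\<And>a. total_boundary V (H a) es t = G (\<lambda>k. of_nat k * a (k - 1)) es t - E_diff V (H a es t)"
    by auto
  let ?Sa = "\<lambda>k. a (Suc k)" and ?da = "\<lambda>a k. of_nat k * a (k - 1) :: 'k"
  have "total_boundary V (\<lambda>es. H a (e # es)) es t = C r e (E_diff V (G a es t))
      - C s e (G (?da a) es t - E_diff V (H a es t))
      - C \<delta> e (G (?da ?Sa) es t - E_diff V (H ?Sa es t))"
    by (simp add: path_contraction_dt.simps(2)[abs_def] total_boundary_diff total_boundary_linear[OF plinear_contraction] IH
        total_boundary_G[OF assms(1) s])
  \<comment> \<open>the product rule \<open>(t p)' = t p' + p\<close>, under the functional with moments \<open>a\<close>\<close>
  moreover have "G (\<lambda>k. ?da a (Suc k)) es t = G (?da ?Sa) es t + G a es t"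
  proof -
    have "?da a (Suc k) = ?da ?Sa k + a k" for k
      by (cases k) (simp_all add: algebra_simps)
    then show ?thesis by (simp flip: G_add)
  qed
  ultimately show ?case
    by (simp add: total_boundary_Cons H_C_id[OF assms(1) 1] plinearD[OF plinear_E_diff]
        E_diff_C[OF G_mem[OF assms(1)]] E_diff_C[OF H_mem[OF assms(1)]] plinearD[OF plinear_contraction]
        algebra_simps)
qed

end

section \<open>Decorated graphs without legs\<close>

lemma underlying_simps [simp]: "fst (underlying v) = vgenus v" "snd (underlying v) = vflags v"
  by (simp_all add: underlying_def)

abbreviation flags_of :: "'o vertex list \<Rightarrow> nat set" where
  "flags_of vs \<equiv> \<Union>(vflags ` set vs)"

abbreviation disjoint_flags :: "'o vertex list \<Rightarrow> bool" where
  "disjoint_flags \<equiv> sorted_wrt (\<lambda>v w. vflags v \<inter> vflags w = {})"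

lemma graph_flags_underlying: "graph_flags (underlying_graph (vs, es)) = flags_of vs"
  by (simp add: graph_flags_def underlying_graph_def)

lemma graph_legs_underlying: "graph_legs (underlying_graph (vs, es)) = flags_of vs - \<Union>(set es)"
  by (simp add: graph_legs_def graph_flags_underlying) (simp add: underlying_graph_def)

lemma adjacent_underlying:
  "(i, j) \<in> adjacent (underlying_graph (vs, es)) \<longleftrightarrow> i < length vs \<and> j < length vs \<and>
     (\<exists>e\<in>set es. e \<inter> vflags (vs ! i) \<noteq> {} \<and> e \<inter> vflags (vs ! j) \<noteq> {})"
  unfolding adjacent_def underlying_graph_def by (simp cong: conj_cong)

lemma sorted_wrt_disjoint_nth:
  "sorted_wrt (\<lambda>x y. f x \<inter> f y = {}) xs \<longleftrightarrow>
   (\<forall>i<length xs. \<forall>j<length xs. i \<noteq> j \<longrightarrow> f (xs ! i) \<inter> f (xs ! j) = {})"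
  (is "_ \<longleftrightarrow> ?R")
proof
  assume L: "sorted_wrt (\<lambda>x y. f x \<inter> f y = {}) xs"
  show ?R
  proof (intro allI impI)
    fix i j assume ij: "i < length xs" "j < length xs" "i \<noteq> j"
    show "f (xs ! i) \<inter> f (xs ! j) = {}"
    proof (cases "i < j")
      case True
      then show ?thesis using L ij by (simp add: sorted_wrt_iff_nth_less)
    next
      case False
      then have "f (xs ! j) \<inter> f (xs ! i) = {}" using L ij by (simp add: sorted_wrt_iff_nth_less)
      then show ?thesis by (simp add: Int_commute)
    qed
  qed
qed (simp add: sorted_wrt_iff_nth_less)

lemma stable_graph_underlying:
  "stable_graph (underlying_graph (vs, es)) \<longleftrightarrow>
     (\<forall>v\<in>set vs. stable (vgenus v) (vflags v)) \<and> disjoint_flags vs \<and> distinct es \<and>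
     (\<forall>e\<in>set es. card e = 2 \<and> e \<subseteq> flags_of vs) \<and>
     (\<forall>e\<in>set es. \<forall>f\<in>set es. e \<noteq> f \<longrightarrow> e \<inter> f = {}) \<and>
     graph_connected (underlying_graph (vs, es))"
  unfolding stable_graph_def graph_flags_underlying sorted_wrt_disjoint_nth
  by (simp add: underlying_graph_def)

lemma graph_connected_underlying:
  "graph_connected (underlying_graph (vs, es)) \<longleftrightarrow> vs \<noteq> [] \<and>
    (\<forall>i<length vs. \<forall>j<length vs. (i, j) \<in> (adjacent (underlying_graph (vs, es)))\<^sup>*)"
  by (simp add: graph_connected_def) (simp add: underlying_graph_def)

text \<open>Connectedness passes along a surjection of vertices that sends adjacent vertices to
connected ones.  The surjection is given by its graph \<open>R\<close>; the cases used are isomorphisms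
and the contraction of an edge.\<close>

lemma graph_connected_transfer:
  assumes "graph_connected (underlying_graph (vs, es))"
    and total: "\<And>i. i < length vs \<Longrightarrow> \<exists>j<length vs'. R i j"
    and onto: "\<And>j. j < length vs' \<Longrightarrow> \<exists>i<length vs. R i j"
    and step: "\<And>i i' j j'. \<lbrakk>(i, i') \<in> adjacent (underlying_graph (vs, es)); R i j; R i' j'\<rbrakk> \<Longrightarrow>
      (j, j') \<in> (adjacent (underlying_graph (vs', es')))\<^sup>*"
    and single: "\<And>i j j'. \<lbrakk>R i j; R i j'\<rbrakk> \<Longrightarrow> j = j'"
  shows "graph_connected (underlying_graph (vs', es'))"
  unfolding graph_connected_underlying
proof (intro conjI allI impI)
  let ?A = "adjacent (underlying_graph (vs, es))" and ?B = "adjacent (underlying_graph (vs', es'))"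
  have "vs \<noteq> []" and conn: "\<And>i j. i < length vs \<Longrightarrow> j < length vs \<Longrightarrow> (i, j) \<in> ?A\<^sup>*"
    using assms(1) unfolding graph_connected_underlying by auto
  then show "vs' \<noteq> []" using total[of 0] by auto
  fix j j' assume "j < length vs'" "j' < length vs'"
  then obtain i i' where i: "i < length vs" "R i j" "i' < length vs" "R i' j'"
    using onto by blast
  have "\<forall>k. R m k \<longrightarrow> (j, k) \<in> ?B\<^sup>*" if "(i, m) \<in> ?A\<^sup>*" for m
    using that
  proof (induction rule: rtrancl_induct)
    case base
    then show ?case using single[OF i(2)] by auto
  next
    case (step y z)
    then obtain k where "R y k" using total[of y] by (auto simp: adjacent_underlying)
    then show ?case using step assms(4) by (meson rtrancl_trans)
  qed
  then show "(j, j') \<in> ?B\<^sup>*" using conn[OF i(1,3)] i(4) by blast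
qed

lemma legless_iff:
  "legless \<O> (vs, es) \<longleftrightarrow>
     (\<forall>v\<in>set vs. stable (vgenus v) (vflags v) \<and> vdec v \<in> ospace \<O> (vgenus v) (vflags v) (vpar v)) \<and>
     disjoint_flags vs \<and> distinct es \<and> (\<forall>e\<in>set es. card e = 2) \<and> \<Union>(set es) = flags_of vs \<and>
     (\<forall>e\<in>set es. \<forall>f\<in>set es. e \<noteq> f \<longrightarrow> e \<inter> f = {}) \<and> graph_connected (underlying_graph (vs, es))"
  unfolding legless_def decorated_def stable_graph_underlying graph_legs_underlying
  by auto

lemma legless_sorted_edges: "legless \<O> (vs, es) \<Longrightarrow> sorted_wrt (\<lambda>e f. e \<inter> f = {}) es"
  unfolding legless_iff sorted_wrt_disjoint_nth[where f = "\<lambda>x. x"]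
  by (auto simp: distinct_conv_nth)

lemma legless_replace:
  assumes "legless \<O> (us @ v # ws, es)" "vgenus v' = vgenus v" "vflags v' = vflags v"
    "vdec v' \<in> ospace \<O> (vgenus v') (vflags v') (vpar v')"
  shows "legless \<O> (us @ v' # ws, es)"
proof -
  have "underlying_graph (us @ v' # ws, es) = underlying_graph (us @ v # ws, es)"
    by (simp add: underlying_graph_def underlying_def assms)
  then show ?thesis using assms unfolding legless_def decorated_def by auto
qed

lemma legless_swap:
  assumes "legless \<O> (us @ v # w # ws, es)"
  shows "legless \<O> (us @ w # v # ws, es)"
proof -
  let ?k = "length us" and ?vs = "us @ v # w # ws" and ?vs' = "us @ w # v # ws"
  let ?\<rho> = "\<lambda>i. if i = ?k then Suc ?k else if i = Suc ?k then ?k else i"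
  have nth: "?vs' ! ?\<rho> i = ?vs ! i" for i
  proof -
    consider "i < ?k" | "i = ?k" | "i = Suc ?k" | m where "i = ?k + Suc (Suc m)"
      by (metis less_iff_Suc_add linorder_neqE_nat add_Suc_right not_less_eq)
    then show ?thesis by cases (auto simp: nth_append)
  qed
  have "graph_connected (underlying_graph (?vs, es))" using assms by (simp add: legless_iff)
  then have "graph_connected (underlying_graph (?vs', es))"
  proof (rule graph_connected_transfer[where R = "\<lambda>i j. j = ?\<rho> i"])
    fix j assume "j < length ?vs'"
    then show "\<exists>i<length ?vs. j = ?\<rho> i" by (intro exI[of _ "?\<rho> j"]) auto
  next
    fix i i' j j' assume a: "(i, i') \<in> adjacent (underlying_graph (?vs, es))" "j = ?\<rho> i" "j' = ?\<rho> i'"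
    then have "(j, j') \<in> adjacent (underlying_graph (?vs', es))"
      unfolding adjacent_underlying a(2,3) nth by auto
    then show "(j, j') \<in> (adjacent (underlying_graph (?vs', es)))\<^sup>*" by blast
  qed auto
  then show ?thesis using assms unfolding legless_iff by (auto simp: sorted_wrt_append Int_commute)
qed

lemma legless_swap_edges:
  assumes "legless \<O> (vs, es @ e # f # fs)"
  shows "legless \<O> (vs, es @ f # e # fs)"
proof -
  have S: "set (es @ e # f # fs) = set (es @ f # e # fs)" by auto
  have A: "adjacent (underlying_graph (vs, es @ e # f # fs)) = adjacent (underlying_graph (vs, es @ f # e # fs))"
    unfolding adjacent_def underlying_graph_def fst_conv snd_conv S ..
  have D: "distinct (es @ e # f # fs) = distinct (es @ f # e # fs)" by auto
  show ?thesis
    using assms unfolding legless_iff graph_connected_underlying A S D .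
qed

lemma relabel_simps [simp]:
  "vgenus (relabel \<O> \<phi> v) = vgenus v" "vflags (relabel \<O> \<phi> v) = \<phi> ` vflags v"
  "vpar (relabel \<O> \<phi> v) = vpar v" "vdec (relabel \<O> \<phi> v) = oact \<O> (vgenus v) (vflags v) \<phi> (vdec v)"
  by (simp_all add: relabel_def)

lemma stable_image: "stable g I \<Longrightarrow> inj_on \<phi> I \<Longrightarrow> stable g (\<phi> ` I)"
  by (simp add: stable_def card_image)

lemma (in modular_operad) legless_relabel:
  assumes "legless \<O> (vs, es)" "inj_on \<phi> (flags_of vs)"
  shows "legless \<O> (map (relabel \<O> \<phi>) vs, map ((`) \<phi>) es)"
proof -
  let ?vs' = "map (relabel \<O> \<phi>) vs" and ?es' = "map ((`) \<phi>) es"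
  have es: "\<Union>(set es) = flags_of vs" using assms by (simp add: legless_iff)
  have sub: "e \<subseteq> flags_of vs" if "e \<in> set es" for e using es that by auto
  have subv: "vflags v \<subseteq> flags_of vs" if "v \<in> set vs" for v using that by auto
  have int: "\<phi> ` A \<inter> \<phi> ` B = \<phi> ` (A \<inter> B)" if "A \<subseteq> flags_of vs" "B \<subseteq> flags_of vs" for A B
    using inj_on_image_Int[OF assms(2) that] by simp
  have inje: "inj_on ((`) \<phi>) (set es)"
    using inj_on_image_eq_iff[OF assms(2) sub sub] by (simp add: inj_on_def)
  have dec: "stable (vgenus v) (\<phi> ` vflags v) \<and>
      oact \<O> (vgenus v) (vflags v) \<phi> (vdec v) \<in> ospace \<O> (vgenus v) (\<phi> ` vflags v) (vpar v)"
    if "v \<in> set vs" for v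
  proof -
    have inj: "inj_on \<phi> (vflags v)" using inj_on_subset[OF assms(2) subv[OF that]] .
    have "stable (vgenus v) (vflags v)" "vdec v \<in> ospace \<O> (vgenus v) (vflags v) (vpar v)"
      using assms(1) that by (auto simp: legless_iff)
    then show ?thesis
      using act_map[OF _ inj] stable_image[OF _ inj] by (auto simp: graded_map_def)
  qed
  have "graph_connected (underlying_graph (vs, es))" using assms by (simp add: legless_iff)
  then have conn: "graph_connected (underlying_graph (?vs', ?es'))"
  proof (rule graph_connected_transfer[where R = "\<lambda>i j. j = i"])
    fix i i' j j' assume a: "(i, i') \<in> adjacent (underlying_graph (vs, es))" "j = i" "j' = i'"
    then have "(j, j') \<in> adjacent (underlying_graph (?vs', ?es'))"
      unfolding adjacent_underlying by (auto simp: image_iff)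
    then show "(j, j') \<in> (adjacent (underlying_graph (?vs', ?es')))\<^sup>*" by blast
  qed auto
  have "disjoint_flags ?vs'"
    using assms(1) subv int unfolding legless_iff sorted_wrt_disjoint_nth by auto
  moreover have "distinct ?es'" using assms(1) inje by (simp add: legless_iff distinct_map)
  moreover have "\<forall>e\<in>set ?es'. card e = 2"
    using assms(1) inj_on_subset[OF assms(2) sub] by (auto simp: legless_iff card_image)
  moreover have "\<Union>(set ?es') = flags_of ?vs'"
    using es by (simp flip: image_UN image_Union add: image_image)
  moreover have "\<forall>e\<in>set ?es'. \<forall>f\<in>set ?es'. e \<noteq> f \<longrightarrow> e \<inter> f = {}"
  proof (intro ballI impI)
    fix e' f' assume "e' \<in> set ?es'" "f' \<in> set ?es'" "e' \<noteq> f'"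
    then obtain e f where ef: "e \<in> set es" "f \<in> set es" "e' = \<phi> ` e" "f' = \<phi> ` f" "e \<noteq> f" by auto
    then have "e \<inter> f = {}" using assms(1) by (simp add: legless_iff)
    then show "e' \<inter> f' = {}" using int[OF sub[OF ef(1)] sub[OF ef(2)]] ef by simp
  qed
  moreover have "\<forall>v\<in>set ?vs'. stable (vgenus v) (vflags v) \<and> vdec v \<in> ospace \<O> (vgenus v) (vflags v) (vpar v)"
    using dec by simp
  ultimately show ?thesis
    unfolding legless_iff using conn by (intro conjI)
qed

lemma card_flags_of:
  assumes "disjoint_flags vs" "\<forall>v\<in>set vs. finite (vflags v)"
  shows "card (flags_of vs) = (\<Sum>v\<leftarrow>vs. card (vflags v))"
  using assms
proof (induction vs)
  case (Cons v vs)
  then show ?case by (subst list.set, simp, subst card_Un_disjoint) auto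
qed simp

context modular_operad
begin

context
  fixes vs es j e touch rest
  assumes G: "legless \<O> (vs, es)" and j: "j < length es" and e_def: "e = es ! j"
    and touch_def: "touch = filter (\<lambda>v. vflags v \<inter> e \<noteq> {}) vs"
    and rest_def: "rest = filter (\<lambda>v. vflags v \<inter> e = {}) vs"
begin

lemma contracted_edge: "e \<in> set es" "card e = 2" "e \<subseteq> flags_of touch" "finite e"
proof -
  show 1: "e \<in> set es" using j e_def by simp
  show 2: "card e = 2" using G 1 by (simp add: legless_iff)
  show "finite e" using 2 by (metis card.infinite zero_neq_numeral)
  show "e \<subseteq> flags_of touch" using G 1 by (fastforce simp: legless_iff touch_def)
qed

lemma decorated_touch: "decorated \<O> (touch, [e])"
proof -
  have "touch \<noteq> []" using contracted_edge by auto
  moreover have "(i, k) \<in> (adjacent (underlying_graph (touch, [e])))\<^sup>*" if "i < length touch" "k < length touch" for i k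
  proof -
    have "touch ! i \<in> set touch" "touch ! k \<in> set touch" using that by auto
    then have "(i, k) \<in> adjacent (underlying_graph (touch, [e]))"
      using that by (auto simp: adjacent_underlying touch_def Int_commute)
    then show ?thesis by blast
  qed
  moreover have "disjoint_flags touch"
    using G by (simp add: legless_iff touch_def sorted_wrt_filter)
  ultimately show ?thesis
    unfolding decorated_def stable_graph_underlying graph_connected_underlying
    using G contracted_edge by (auto simp: legless_iff touch_def)
qed

lemma collapse_touch_flags: "vflags (collapse \<O> (touch, [e])) = flags_of touch - e"
  by (simp add: collapse_def graph_legs_underlying)

text \<open>A stable vertex of genus \<open>g\<close> and valence \<open>n\<close> has \<open>2g + n \<ge> 3\<close>.  Joining two vertices adds these numbers
and removes two flags; contracting a loop raises the genus by one and removes two flags.  In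
both cases the result is again at least \<open>3\<close>.\<close>

lemma stable_collapse_touch:
  "stable (vgenus (collapse \<O> (touch, [e]))) (vflags (collapse \<O> (touch, [e])))"
proof -
  have st: "\<forall>v\<in>set touch. stable (vgenus v) (vflags v)"
    using decorated_touch by (simp add: decorated_def stable_graph_underlying)
  have ne: "touch \<noteq> []" using contracted_edge by auto
  have "3 * length us \<le> 2 * sum_list (map vgenus us) + (\<Sum>v\<leftarrow>us. card (vflags v))"
    if "\<forall>v\<in>set us. stable (vgenus v) (vflags v)" for us :: "'o vertex list"
    using that by (induction us) (auto simp: stable_def)
  from this[OF st] have "3 * length touch \<le> 2 * sum_list (map vgenus touch) + card (flags_of touch)"
    using card_flags_of[of touch] decorated_touch st
    by (auto simp: decorated_def stable_graph_underlying stable_def)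
  moreover have "card (flags_of touch - e) = card (flags_of touch) - 2"
    using contracted_edge by (simp add: card_Diff_subset)
  moreover have fin: "finite (flags_of touch)" using st by (auto simp: stable_def)
  moreover have "2 \<le> card (flags_of touch)"
    using card_mono[OF fin contracted_edge(3)] contracted_edge(2) by simp
  moreover have "length touch \<ge> 1" using ne by (cases touch) auto
  moreover have "vgenus (collapse \<O> (touch, [e])) = sum_list (map vgenus touch) + (2 - length touch)"
    by (simp add: collapse_def graph_genus_def underlying_graph_def comp_def)
  ultimately show ?thesis
    unfolding stable_def collapse_touch_flags by auto
qed

lemma flags_touch_rest: "flags_of touch \<union> flags_of rest = flags_of vs" "flags_of touch \<inter> flags_of rest = {}"
  "e \<inter> flags_of rest = {}"
proof -
  show "flags_of touch \<union> flags_of rest = flags_of vs" by (auto simp: touch_def rest_def)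
  show "e \<inter> flags_of rest = {}" by (auto simp: rest_def)
  have "vflags v \<inter> vflags w = {}" if vw: "v \<in> set touch" "w \<in> set rest" for v w
  proof -
    have "v \<noteq> w" "v \<in> set vs" "w \<in> set vs" using vw by (auto simp: touch_def rest_def)
    then obtain i k where "i < length vs" "k < length vs" "vs ! i = v" "vs ! k = w" "i \<noteq> k"
      by (metis in_set_conv_nth)
    then show ?thesis using G unfolding legless_iff sorted_wrt_disjoint_nth by auto
  qed
  then show "flags_of touch \<inter> flags_of rest = {}" by blast
qed

text \<open>For connectedness, the vertices at \<open>e\<close> are mapped to the new vertex, which has index \<open>0\<close>, and the others to their
positions in \<open>rest\<close>.  Any edge other than \<open>e\<close> is disjoint from \<open>e\<close>, so it still meets the
images of the vertices it met before.\<close>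

lemma legless_contract_edge:
  "legless \<O> (contract_edge_vertices \<O> e vs, take j es @ drop (Suc j) es)"
proof -
  let ?c = "collapse \<O> (touch, [e])" and ?es' = "take j es @ drop (Suc j) es"
  let ?vs' = "?c # rest"
  have vs': "contract_edge_vertices \<O> e vs = ?vs'"
    by (simp add: contract_edge_vertices_def touch_def rest_def)
  have es: "es = take j es @ e # drop (Suc j) es" using j e_def by (simp add: id_take_nth_drop)
  have dist: "distinct es" using G by (simp add: legless_iff)
  have set_es: "set ?es' = set es - {e}"
  proof -
    have "distinct (take j es @ e # drop (Suc j) es)" using es dist by metis
    moreover have "set es = set (take j es @ e # drop (Suc j) es)" using es by metis
    ultimately show ?thesis by auto
  qed
  have disj: "f \<inter> e = {}" if "f \<in> set ?es'" for f
    using that G contracted_edge(1) unfolding set_es by (auto simp: legless_iff)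
  have flags: "flags_of ?vs' = flags_of vs - e"
    using flags_touch_rest by (auto simp: collapse_touch_flags)
  have "\<Union>(set ?es') = flags_of vs - e"
  proof -
    have "\<Union>(set es) = \<Union>(set ?es') \<union> e" unfolding set_es using contracted_edge(1) by auto
    then have "flags_of vs = \<Union>(set ?es') \<union> e" using G by (simp add: legless_iff)
    moreover have "\<Union>(set ?es') \<inter> e = {}" using disj by blast
    ultimately show ?thesis by blast
  qed
  moreover have "disjoint_flags ?vs'"
  proof -
    have "disjoint_flags rest" using G by (simp add: legless_iff rest_def sorted_wrt_filter)
    then show ?thesis using flags_touch_rest(2) by (auto simp: collapse_touch_flags)
  qed
  moreover have "distinct ?es'" using dist by (metis distinct_append distinct_take distinct_drop set_take_disj_set_drop_if_distinct lessI less_imp_le)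
  moreover have "vdec ?c \<in> ospace \<O> (vgenus ?c) (vflags ?c) (vpar ?c)"
    using comp_mem[OF decorated_touch] by (simp add: collapse_def)
  moreover have "graph_connected (underlying_graph (?vs', ?es'))"
  proof -
    \<comment> \<open>the positions in \<open>vs\<close> of the vertices in \<open>rest\<close>; vertices need not be distinguished by their values\<close>
    define idx where "idx = filter (\<lambda>i. vflags (vs ! i) \<inter> e = {}) [0..<length vs]"
    have rest_idx: "rest = map ((!) vs) idx"
      unfolding rest_def idx_def by (subst map_nth[of vs, symmetric]) (simp add: filter_map comp_def)
    have idx: "distinct idx" "set idx = {i. i < length vs \<and> vflags (vs ! i) \<inter> e = {}}"
      by (auto simp: idx_def)
    define R where "R i k = (i < length vs \<and> (if vflags (vs ! i) \<inter> e \<noteq> {} then k = 0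
       else k \<noteq> 0 \<and> k \<le> length idx \<and> idx ! (k - 1) = i))" for i k
    have Rflags: "vflags (vs ! i) - e \<subseteq> vflags (?vs' ! k) \<and> k < length ?vs'" if "R i k" for i k
    proof (cases "vflags (vs ! i) \<inter> e \<noteq> {}")
      case True
      then have "vs ! i \<in> set touch" using that by (auto simp: R_def touch_def)
      then show ?thesis using True that by (auto simp: R_def collapse_touch_flags)
    next
      case False
      then show ?thesis using that by (cases k) (auto simp: R_def rest_idx)
    qed
    show ?thesis
    proof (rule graph_connected_transfer[where R = R])
      show "graph_connected (underlying_graph (vs, es))" using G by (simp add: legless_iff)
    next
      fix i assume i: "i < length vs"
      show "\<exists>k<length ?vs'. R i k"
      proof (cases "vflags (vs ! i) \<inter> e \<noteq> {}")
        case False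
        then have "i \<in> set idx" using i idx by auto
        then obtain k where "k < length idx" "idx ! k = i" by (auto simp: in_set_conv_nth)
        then show ?thesis using i False by (intro exI[of _ "Suc k"]) (auto simp: R_def rest_idx)
      qed (use i in \<open>auto simp: R_def\<close>)
    next
      fix k assume k: "k < length ?vs'"
      show "\<exists>i<length vs. R i k"
      proof (cases k)
        case 0
        obtain v where "v \<in> set touch" using contracted_edge by fastforce
        then have "v \<in> set vs" "vflags v \<inter> e \<noteq> {}" by (auto simp: touch_def)
        then obtain i where "i < length vs" "vflags (vs ! i) \<inter> e \<noteq> {}" by (auto simp: in_set_conv_nth)
        then show ?thesis using 0 by (auto simp: R_def)
      next
        case (Suc k')
        then have "idx ! k' \<in> set idx" using k by (auto simp: rest_idx)
        then show ?thesis using Suc k idx(2) by (intro exI[of _ "idx ! k'"]) (auto simp: R_def rest_idx)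
      qed
    next
      fix i i' k k' assume a: "(i, i') \<in> adjacent (underlying_graph (vs, es))" "R i k" "R i' k'"
      then obtain f where f: "f \<in> set es" "f \<inter> vflags (vs ! i) \<noteq> {}" "f \<inter> vflags (vs ! i') \<noteq> {}"
        by (auto simp: adjacent_underlying)
      show "(k, k') \<in> (adjacent (underlying_graph (?vs', ?es')))\<^sup>*"
      proof (cases "f = e")
        case True
        then have "k = 0" "k' = 0" using a(2,3) f(2,3) by (auto simp: R_def Int_commute split: if_splits)
        then show ?thesis by simp
      next
        case False
        then have f': "f \<in> set ?es'" using f(1) set_es by simp
        have "f \<inter> vflags (?vs' ! k) \<noteq> {}" "f \<inter> vflags (?vs' ! k') \<noteq> {}"
          using f(2,3) disj[OF f'] Rflags[OF a(2)] Rflags[OF a(3)] by blast+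
        then have "(k, k') \<in> adjacent (underlying_graph (?vs', ?es'))"
          using f' Rflags[OF a(2)] Rflags[OF a(3)] unfolding adjacent_underlying by blast
        then show ?thesis by blast
      qed
    next
      fix i k k' assume "R i k" "R i k'"
      then show "k = k'"
        using idx(1) by (cases k; cases k') (auto simp: R_def nth_eq_iff_index_eq split: if_splits)
    qed
  qed
  moreover have "\<forall>f\<in>set ?es'. card f = 2" "\<forall>f\<in>set ?es'. \<forall>f'\<in>set ?es'. f \<noteq> f' \<longrightarrow> f \<inter> f' = {}"
    using G unfolding set_es by (simp_all add: legless_iff)
  moreover have "\<forall>v\<in>set rest. stable (vgenus v) (vflags v) \<and> vdec v \<in> ospace \<O> (vgenus v) (vflags v) (vpar v)"
    using G by (simp add: legless_iff rest_def)
  ultimately show ?thesis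
    unfolding vs' legless_iff flags using stable_collapse_touch by simp
qed

end

end

section \<open>Functionals on decorated graphs\<close>

lemma lin_ext_scalar_superset:
  assumes "finite S" "keys c \<subseteq> S"
  shows "lin_ext_scalar f c = (\<Sum>x\<in>S. lookup c x * f x)"
  unfolding lin_ext_scalar_def using assms
  by (intro sum.mono_neutral_left) (auto simp: in_keys_iff)

lemma lin_ext_scalar_add: "lin_ext_scalar f (x + y) = lin_ext_scalar f x + lin_ext_scalar f y"
proof -
  let ?S = "keys x \<union> keys y"
  have "keys (x + y) \<subseteq> ?S" by (rule keys_add)
  then show ?thesis
    by (subst (1 2 3) lin_ext_scalar_superset[where S = ?S])
      (auto simp: lookup_add distrib_right sum.distrib)
qed

lemma lin_ext_scalar_scale: "lin_ext_scalar f (pscale c x) = c * lin_ext_scalar f x"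
proof -
  have "keys (pscale c x) \<subseteq> keys x" by (auto simp: in_keys_iff)
  then show ?thesis
    by (subst (1 2) lin_ext_scalar_superset[where S = "keys x"]) (auto simp: sum_distrib_left mult_ac)
qed

lemma linear_lin_ext_scalar: "Vector_Spaces.linear pscale (*) (lin_ext_scalar f)"
  by (simp add: Vector_Spaces.linear_iff vector_space_pscale lin_ext_scalar_add lin_ext_scalar_scale)
    (unfold_locales, auto simp: algebra_simps)

lemma lin_ext_scalar_single [simp]: "lin_ext_scalar f (single x c) = c * f x"
  by (subst lin_ext_scalar_superset[where S = "{x}"]) auto

lemma lin_ext_scalar_zero: "lin_ext_scalar f 0 = 0"
  by (simp add: lin_ext_scalar_def)

lemma lin_ext_scalar_diff: "lin_ext_scalar f (x - y) = lin_ext_scalar f x - lin_ext_scalar f y"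
  using lin_ext_scalar_add[of f "x - y" y] by simp

lemma lin_ext_scalar_sum: "lin_ext_scalar f (sum g S) = (\<Sum>i\<in>S. lin_ext_scalar f (g i))"
  by (induction S rule: infinite_finite_induct) (simp_all add: lin_ext_scalar_zero lin_ext_scalar_add)

lemma lin_ext_scalar_lin_ext: "lin_ext_scalar f (lin_ext g c) = lin_ext_scalar (\<lambda>x. lin_ext_scalar f (g x)) c"
  by (simp add: lin_ext_def lin_ext_scalar_sum lin_ext_scalar_scale) (simp add: lin_ext_scalar_def)

definition vertex_tensor :: "(nat \<Rightarrow> nat set \<Rightarrow> 'o \<Rightarrow> ('v letter list \<Rightarrow>\<^sub>0 'k::field_char_0)) \<Rightarrow>
    'o vertex list \<Rightarrow> ('v letter list \<Rightarrow>\<^sub>0 'k)" where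
  "vertex_tensor \<alpha> vs = tensor_list (map (\<lambda>v. \<alpha> (vgenus v) (vflags v) (vdec v)) vs)"

lemma vertex_tensor_simps [simp]:
  "vertex_tensor \<alpha> [] = single [] 1"
  "vertex_tensor \<alpha> (v # vs) = tensor2 (\<alpha> (vgenus v) (vflags v) (vdec v)) (vertex_tensor \<alpha> vs)"
  "vertex_tensor \<alpha> (us @ vs) = tensor2 (vertex_tensor \<alpha> us) (vertex_tensor \<alpha> vs)"
  by (simp_all add: vertex_tensor_def tensor_list_append)

lemma E_space_tensor2:
  assumes "s \<in> E_space V I p" "t \<in> E_space V J q" "I \<inter> J = {}"
  shows "tensor2 s t \<in> E_space V (I \<union> J) (p + q)"
proof -
  let ?S = "{t. keys t \<subseteq> {w. w \<in> tensor_words V (I \<union> J) \<and> wpar w = p + q}}"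
  have "tensor2 s t \<in> ?S"
  proof (rule tensor2_mem_subspace[OF subspace_keys])
    fix u w assume "u \<in> keys s" "w \<in> keys t"
    then show "single (u @ w) 1 \<in> ?S"
      using assms tensor_words_append[of u V I w J] by (auto simp: E_space_def)
  qed
  then show ?thesis by (auto simp: E_space_def)
qed

text \<open>The functional obtained from a family \<open>Q\<close> by tensoring the images of the decorations in
\<open>\<E>(V)\<close> and applying \<open>Q\<close> to the edges.\<close>

locale contracted_algebra =
  modular_operad \<O> + operad_algebra \<O> V \<alpha> + edge_contraction V Q
  for \<O> :: "('k::field_char_0, 'o::ab_group_add) modop"
    and V :: "('k, 'v::ab_group_add) ipdg"
    and \<alpha> :: "nat \<Rightarrow> nat set \<Rightarrow> 'o \<Rightarrow> ('v letter list \<Rightarrow>\<^sub>0 'k)"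
    and Q :: "nat set list \<Rightarrow> ('v letter list \<Rightarrow>\<^sub>0 'k) \<Rightarrow> ('v letter list \<Rightarrow>\<^sub>0 'k)"
begin

abbreviation "T \<equiv> vertex_tensor \<alpha>"

abbreviation "A v \<equiv> \<alpha> (vgenus v) (vflags v) (vdec v)"

text \<open>The part of \<open>legless\<close> that concerns the vertices, which is inherited by sublists.\<close>

definition vertices_ok :: "'o vertex list \<Rightarrow> bool" where
  "vertices_ok vs \<longleftrightarrow> (\<forall>v\<in>set vs. stable (vgenus v) (vflags v) \<and> vdec v \<in> ospace \<O> (vgenus v) (vflags v) (vpar v))
     \<and> disjoint_flags vs"

lemma legless_vertices_ok: "legless \<O> (vs, es) \<Longrightarrow> vertices_ok vs"
  by (simp add: legless_iff vertices_ok_def)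

lemma vertices_ok_Cons:
  assumes "vertices_ok (v # vs)"
  shows "vertices_ok vs" "vflags v \<inter> flags_of vs = {}" "A v \<in> E_space V (vflags v) (vpar v)"
    "stable (vgenus v) (vflags v)" "vdec v \<in> ospace \<O> (vgenus v) (vflags v) (vpar v)"
  using assms mem by (auto simp: vertices_ok_def)

lemma vertices_ok_append:
  assumes "vertices_ok (us @ vs)"
  shows "vertices_ok us" "vertices_ok vs" "flags_of us \<inter> flags_of vs = {}"
  using assms by (auto simp: vertices_ok_def sorted_wrt_append)

lemma vertex_tensor_mem: "vertices_ok vs \<Longrightarrow> T vs \<in> E_space V (flags_of vs) (sum_list (map vpar vs))"
proof (induction vs)
  case Nil
  then show ?case by (simp add: E_space_def tensor_words_def)
next
  case (Cons v vs)
  then show ?case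
    using E_space_tensor2[OF vertices_ok_Cons(3)[OF Cons.prems] _ vertices_ok_Cons(2)[OF Cons.prems]]
      vertices_ok_Cons(1)[OF Cons.prems] by simp
qed

lemma vertex_tensor_space: "vertices_ok vs \<Longrightarrow> T vs \<in> tensor_space V (flags_of vs)"
  using vertex_tensor_mem by (rule E_space_tensor_space)

lemma E_rel_context:
  assumes "vertices_ok (us @ ws)" "x \<in> E_rel V I" "I \<inter> flags_of us = {}" "I \<inter> flags_of ws = {}"
  shows "tensor2 (T us) (tensor2 x (T ws)) \<in> E_rel V (flags_of us \<union> (I \<union> flags_of ws))"
proof (rule E_rel_tensor2_left)
  note ok = vertices_ok_append[OF assms(1)]
  show "T us \<in> tensor_space V (flags_of us)" by (rule vertex_tensor_space[OF ok(1)])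
  show "tensor2 x (T ws) \<in> E_rel V (I \<union> flags_of ws)"
    by (rule E_rel_tensor2_right[OF assms(2) vertex_tensor_space[OF ok(2)] assms(4)])
  show "flags_of us \<inter> (I \<union> flags_of ws) = {}" using ok(3) assms(3) by blast
qed

definition graph_value :: "'o dgraph \<Rightarrow> 'k" where
  "graph_value \<Gamma> = (if legless \<O> \<Gamma> then lookup (Q (snd \<Gamma>) (T (fst \<Gamma>))) [] else 0)"

definition amplitude :: "('o dgraph \<Rightarrow>\<^sub>0 'k) \<Rightarrow> 'k" where
  "amplitude = lin_ext_scalar graph_value"

text \<open>The tensor power over the empty set is the ground field without relations, so a functional
obtained by contracting all labels takes well-defined values.\<close>

lemma Q_E_rel_value:
  assumes "x \<in> E_rel V (\<Union>(set es))"
  shows "lookup (Q es x) [] = 0"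
  using E_rel_empty[of "Q es x" V] Q_rel[OF assms, of es] by simp

lemma Q_value_cong:
  assumes "x - y \<in> E_rel V (\<Union>(set es))"
  shows "lookup (Q es x) [] = lookup (Q es y) []"
  using Q_E_rel_value[OF assms] by (simp add: plinear_diff[OF Q_linear] lookup_minus)

lemma graph_value_vertices:
  assumes "legless \<O> (us @ v # ws, es)" "x \<in> E_rel V (vflags v)"
  shows "lookup (Q es (tensor2 (T us) (tensor2 x (T ws)))) [] = 0"
proof (rule Q_E_rel_value)
  have ok: "vertices_ok (us @ v # ws)" using assms(1) by (rule legless_vertices_ok)
  have "vertices_ok (us @ ws)" "vflags v \<inter> flags_of us = {}" "vflags v \<inter> flags_of ws = {}"
    using ok by (auto simp: vertices_ok_def sorted_wrt_append)
  then have "tensor2 (T us) (tensor2 x (T ws)) \<in> E_rel V (flags_of us \<union> (vflags v \<union> flags_of ws))"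
    using assms(2) by (intro E_rel_context)
  moreover have "\<Union>(set es) = flags_of us \<union> (vflags v \<union> flags_of ws)"
    using assms(1) by (auto simp: legless_iff)
  ultimately show "tensor2 (T us) (tensor2 x (T ws)) \<in> E_rel V (\<Union>(set es))" by simp
qed

lemmas tensor2_linear = plinearD[OF plinear_tensor2_left] plinearD[OF plinear_tensor2_right]

lemma ospace_add: "stable g I \<Longrightarrow> x \<in> ospace \<O> g I p \<Longrightarrow> y \<in> ospace \<O> g I p \<Longrightarrow> x + y \<in> ospace \<O> g I p"
  and ospace_scale: "stable g I \<Longrightarrow> x \<in> ospace \<O> g I p \<Longrightarrow> oscale \<O> c x \<in> ospace \<O> g I p"
  and odiff_mem: "stable g I \<Longrightarrow> x \<in> ospace \<O> g I p \<Longrightarrow> odiff \<O> g I x \<in> ospace \<O> g I (p + 1)"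
  using modular_operad.dg[OF modular_operad_axioms, of g I] 
    module.subspace_add[of "oscale \<O>" "ospace \<O> g I p" x y]
    module.subspace_scale[of "oscale \<O>" "ospace \<O> g I p" x c]
  by (auto simp: dg_space_def graded_space_def graded_map_def module_iff_vector_space)

lemma vertex_tensor_relabel:
  assumes "vertices_ok vs" "inj_on \<phi> (flags_of vs)"
  shows "T (map (relabel \<O> \<phi>) vs) - E_act \<phi> (T vs) \<in> E_rel V (\<phi> ` flags_of vs)"
  using assms
proof (induction vs)
  case Nil
  then show ?case by (simp add: E_rel_def pm.span_zero)
next
  case (Cons v vs)
  note ok = vertices_ok_Cons[OF Cons.prems(1)]
  let ?v = "relabel \<O> \<phi> v" and ?I = "\<phi> ` vflags v" and ?J = "\<phi> ` flags_of vs"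
  have inj: "inj_on \<phi> (vflags v)" "inj_on \<phi> (flags_of vs)"
    using Cons.prems(2) by (auto simp: inj_on_Un)
  have disj: "?I \<inter> ?J = {}"
    using inj_on_image_Int[OF Cons.prems(2), of "vflags v" "flags_of vs"] ok(2) by auto
  have IH: "T (map (relabel \<O> \<phi>) vs) - E_act \<phi> (T vs) \<in> E_rel V ?J"
    using Cons.IH[OF ok(1) inj(2)] .
  have 1: "A ?v - E_act \<phi> (A v) \<in> E_rel V ?I"
    using act[OF ok(4,5) inj(1)] by simp
  have Av: "E_act \<phi> (A v) \<in> tensor_space V ?I"
    by (rule E_act_mem[OF E_space_tensor_space[OF ok(3)] inj(1)])
  have Tvs: "E_act \<phi> (T vs) \<in> tensor_space V ?J"
    by (rule E_act_mem[OF vertex_tensor_space[OF ok(1)] inj(2)])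
  have "stable (vgenus ?v) (vflags ?v)" "vdec ?v \<in> ospace \<O> (vgenus ?v) (vflags ?v) (vpar ?v)"
    using stable_image[OF ok(4) inj(1)] act_map[OF ok(4) inj(1)] ok(5) by (auto simp: graded_map_def)
  then have Av': "A ?v \<in> tensor_space V ?I"
    using E_space_tensor_space[OF mem] by simp
  have "tensor2 (A ?v) (T (map (relabel \<O> \<phi>) vs) - E_act \<phi> (T vs)) \<in> E_rel V (?I \<union> ?J)"
    by (rule E_rel_tensor2_left[OF Av' IH disj])
  moreover have "tensor2 (A ?v - E_act \<phi> (A v)) (E_act \<phi> (T vs)) \<in> E_rel V (?I \<union> ?J)"
    by (rule E_rel_tensor2_right[OF 1 Tvs disj])
  ultimately have "tensor2 (A ?v) (T (map (relabel \<O> \<phi>) vs) - E_act \<phi> (T vs))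
      + tensor2 (A ?v - E_act \<phi> (A v)) (E_act \<phi> (T vs)) \<in> E_rel V (?I \<union> ?J)"
    by (rule pm.subspace_add[OF subspace_E_rel])
  then show ?case by (simp add: tensor2_linear E_act_tensor2 image_Un)
qed

lemma lookup_E_act_Nil: "t \<in> tensor_space V {} \<Longrightarrow> lookup (E_act \<phi> t) [] = lookup t []"
proof -
  assume "t \<in> tensor_space V {}"
  then have "keys t \<subseteq> {[]}" by (auto simp: tensor_space_def tensor_words_iff)
  then have "t = single [] (lookup t [])"
    by (intro poly_mapping_eqI) (auto simp: lookup_single when_def in_keys_iff)
  then show ?thesis by (metis E_act_single list.simps(8) lookup_single_eq)
qed

text \<open>Each kind of relation on graphs matches a property of the tensor calculus: multilinearity of
the structure map \<open>\<alpha>\<close> modulo \<open>E_rel\<close>, the symmetry constraint for blocks, alternation in the edges,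
and naturality under relabelling.\<close>

lemma amplitude_Fdual_rel:
  assumes "c \<in> Fdual_rel \<O>"
  shows "amplitude c = 0"
proof -
  have val: "amplitude (single \<Gamma> k) = k * graph_value \<Gamma>" for \<Gamma> k
    by (simp add: amplitude_def)
  have gv: "graph_value (vs, es) = lookup (Q es (T vs)) []" if "legless \<O> (vs, es)" for vs es
    using that by (simp add: graph_value_def)
  note lin = amplitude_def lin_ext_scalar_add lin_ext_scalar_diff lin_ext_scalar_scale lin_ext_scalar_zero
  note Qlin = plinearD[OF Q_linear]
  have gen: "amplitude x = 0" if "x \<in>
     {single \<Gamma> 1 | \<Gamma>. \<not> legless \<O> \<Gamma>} \<union>
     {single (us @ Vertex g I p (x + y) # ws, es) 1
        - single (us @ Vertex g I p x # ws, es) 1 - single (us @ Vertex g I p y # ws, es) 1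
        | us g I p x y ws es.
        legless \<O> (us @ Vertex g I p x # ws, es) \<and> legless \<O> (us @ Vertex g I p y # ws, es)} \<union>
     {single (us @ Vertex g I p (oscale \<O> c x) # ws, es) 1 - single (us @ Vertex g I p x # ws, es) c
        | us g I p x c ws es. legless \<O> (us @ Vertex g I p x # ws, es)} \<union>
     {single (us @ v # w # ws, es) 1 - single (us @ w # v # ws, es) (psign (vpar v * vpar w))
        | us v w ws es. legless \<O> (us @ v # w # ws, es)} \<union>
     {single (vs, es @ e # f # fs) 1 + single (vs, es @ f # e # fs) 1
        | vs es e f fs. legless \<O> (vs, es @ e # f # fs)} \<union>
     {single \<Gamma> 1 - single (relabel_graph \<O> \<phi> \<Gamma>) 1
        | \<Gamma> \<phi>. legless \<O> \<Gamma> \<and> inj_on \<phi> (graph_flags (underlying_graph \<Gamma>))}" (is "x \<in> ?S") for x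
    using that
  proof (elim UnE CollectE exE conjE)
    fix \<Gamma> assume "x = single \<Gamma> 1" "\<not> legless \<O> \<Gamma>"
    then show "amplitude x = 0" by (simp add: val graph_value_def)
  next
    fix us g I p a b ws es
    assume x: "x = single (us @ Vertex g I p (a + b) # ws, es) 1
        - single (us @ Vertex g I p a # ws, es) 1 - single (us @ Vertex g I p b # ws, es) 1"
      and la: "legless \<O> (us @ Vertex g I p a # ws, es)" and lb: "legless \<O> (us @ Vertex g I p b # ws, es)"
    have ab: "stable g I" "a \<in> ospace \<O> g I p" "b \<in> ospace \<O> g I p"
      using la lb by (auto simp: legless_iff)
    have lab: "legless \<O> (us @ Vertex g I p (a + b) # ws, es)"
      by (rule legless_replace[OF la]) (simp_all add: ospace_add ab)
    have "\<alpha> g I (a + b) - (\<alpha> g I a + \<alpha> g I b) \<in> E_rel V (vflags (Vertex g I p a))"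
      using add[OF ab] by simp
    from graph_value_vertices[OF la this] show "amplitude x = 0"
      unfolding x by (simp add: lin gv[OF la] gv[OF lb] gv[OF lab] tensor2_linear Qlin lookup_add lookup_minus)
  next
    fix us g I p a c ws es
    assume x: "x = single (us @ Vertex g I p (oscale \<O> c a) # ws, es) 1 - single (us @ Vertex g I p a # ws, es) c"
      and la: "legless \<O> (us @ Vertex g I p a # ws, es)"
    have a: "stable g I" "a \<in> ospace \<O> g I p" using la by (auto simp: legless_iff)
    have lca: "legless \<O> (us @ Vertex g I p (oscale \<O> c a) # ws, es)"
      by (rule legless_replace[OF la]) (simp_all add: ospace_scale a)
    have "\<alpha> g I (oscale \<O> c a) - pscale c (\<alpha> g I a) \<in> E_rel V (vflags (Vertex g I p a))"
      using scale[OF a] by simp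
    from graph_value_vertices[OF la this] show "amplitude x = 0"
      unfolding x by (simp add: lin gv[OF la] gv[OF lca] tensor2_linear Qlin lookup_minus)
  next
    fix us v w ws es
    assume x: "x = single (us @ v # w # ws, es) 1 - single (us @ w # v # ws, es) (psign (vpar v * vpar w))"
      and l: "legless \<O> (us @ v # w # ws, es)"
    have l': "legless \<O> (us @ w # v # ws, es)" by (rule legless_swap[OF l])
    have ok: "vertices_ok (us @ v # w # ws)" by (rule legless_vertices_ok[OF l])
    let ?c = "psign (vpar v * vpar w) :: 'k"
    have vw: "A v \<in> E_space V (vflags v) (vpar v)" "A w \<in> E_space V (vflags w) (vpar w)" "vflags v \<inter> vflags w = {}"
      using ok mem by (auto simp: vertices_ok_def sorted_wrt_append)
    have ok': "vertices_ok (us @ ws)" "(vflags v \<union> vflags w) \<inter> flags_of us = {}" "(vflags v \<union> vflags w) \<inter> flags_of ws = {}"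
      using ok by (auto simp: vertices_ok_def sorted_wrt_append)
    have es: "\<Union>(set es) = flags_of us \<union> (vflags v \<union> vflags w \<union> flags_of ws)"
      using l by (auto simp: legless_iff)
    have "lookup (Q es (tensor2 (T us) (tensor2 (tensor2 (A v) (A w) - pscale ?c (tensor2 (A w) (A v))) (T ws)))) [] = 0"
      unfolding es by (rule Q_E_rel_value, unfold es, rule E_rel_context[OF ok'(1) E_rel_tensor2_commute[OF vw] ok'(2,3)])
    then show "amplitude x = 0"
      unfolding x by (simp add: lin gv[OF l] gv[OF l'] tensor2_linear Qlin lookup_minus tensor2_assoc)
  next
    fix vs es e f fs
    assume x: "x = single (vs, es @ e # f # fs) 1 + single (vs, es @ f # e # fs) 1"
      and l: "legless \<O> (vs, es @ e # f # fs)"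
    have l': "legless \<O> (vs, es @ f # e # fs)" by (rule legless_swap_edges[OF l])
    have "e \<noteq> f \<Longrightarrow> e \<inter> f = {}" "e \<noteq> f" using l by (auto simp: legless_iff)
    then have "Q (es @ e # f # fs) (T vs) = - Q (es @ f # e # fs) (T vs)"
      by (intro Q_swap[OF vertex_tensor_space[OF legless_vertices_ok[OF l]]])
    then show "amplitude x = 0" unfolding x by (simp add: lin gv[OF l] gv[OF l'])
  next
    fix \<Gamma> \<phi>
    assume x: "x = single \<Gamma> 1 - single (relabel_graph \<O> \<phi> \<Gamma>) 1"
      and l0: "legless \<O> \<Gamma>" and inj0: "inj_on \<phi> (graph_flags (underlying_graph \<Gamma>))"
    obtain vs es where \<Gamma>: "\<Gamma> = (vs, es)" by (cases \<Gamma>)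
    have l: "legless \<O> (vs, es)" and inj: "inj_on \<phi> (flags_of vs)"
      using l0 inj0 by (simp_all add: \<Gamma> graph_flags_underlying)
    let ?vs = "map (relabel \<O> \<phi>) vs" and ?es = "map ((`) \<phi>) es"
    have l': "legless \<O> (?vs, ?es)" by (rule legless_relabel[OF l inj])
    have ok: "vertices_ok vs" by (rule legless_vertices_ok[OF l])
    have es: "\<Union>(set es) = flags_of vs" using l by (simp add: legless_iff)
    have es': "\<Union>(set ?es) = \<phi> ` flags_of vs" by (simp flip: es add: image_Union)
    have "lookup (Q ?es (T ?vs)) [] = lookup (Q ?es (E_act \<phi> (T vs))) []"
      by (rule Q_value_cong) (simp only: es' vertex_tensor_relabel[OF ok inj])
    also have "Q ?es (E_act \<phi> (T vs)) = E_act \<phi> (Q es (T vs))"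
      by (rule Q_act[OF vertex_tensor_space[OF ok] inj]) (simp_all add: es)
    also have "lookup \<dots> [] = lookup (Q es (T vs)) []"
      using Q_mem[OF vertex_tensor_space[OF ok], of es] by (intro lookup_E_act_Nil) (simp add: es)
    finally show "amplitude x = 0"
      unfolding x \<Gamma> relabel_graph_def by (simp add: lin gv[OF l] gv[OF l'])
  qed
  show ?thesis
    using assms unfolding Fdual_rel_def
  proof (induction rule: pm.span_induct_alt)
    case base
    show ?case by (simp add: lin)
  next
    case (step c x y)
    then show ?case using gen[OF step(1)] by (simp add: lin)
  qed
qed

lemma amplitude_in_F_space: "amplitude \<in> F_space \<O>"
  unfolding F_space_def using amplitude_Fdual_rel linear_lin_ext_scalar by (auto simp: amplitude_def)

end

context contracted_algebra
begin

text \<open>The internal differential of a graph corresponds to the differential of the tensor of its decorations,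
since \<open>\<alpha>\<close> is a chain map modulo \<open>E_rel\<close> and the differential is a derivation.\<close>

lemma E_diff_vertex_tensor:
  assumes "vertices_ok vs"
  shows "E_diff V (T vs) - (\<Sum>i<length vs. pscale (psign (sum_list (map vpar (take i vs))))
      (T (vs[i := vertex_diff \<O> (vs ! i)]))) \<in> E_rel V (flags_of vs)"
  using assms
proof (induction vs)
  case Nil
  then show ?case by (simp add: E_rel_def pm.span_zero)
next
  case (Cons v vs)
  note ok = vertices_ok_Cons[OF Cons.prems]
  let ?S = "\<Sum>i<length vs. pscale (psign (sum_list (map vpar (take i vs)))) (T (vs[i := vertex_diff \<O> (vs ! i)]))"
  let ?dA = "A (vertex_diff \<O> v)" and ?p = "psign (vpar v) :: 'k"
  have "?dA - E_diff V (A v) \<in> E_rel V (vflags v)"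
    using diff[OF ok(4,5)] by (simp add: vertex_diff_def)
  from pm.subspace_neg[OF subspace_E_rel this] have 1: "E_diff V (A v) - ?dA \<in> E_rel V (vflags v)"
    by simp
  have "tensor2 (E_diff V (A v) - ?dA) (T vs) \<in> E_rel V (vflags v \<union> flags_of vs)"
    by (rule E_rel_tensor2_right[OF 1 vertex_tensor_space[OF ok(1)] ok(2)])
  moreover have "pscale ?p (tensor2 (A v) (E_diff V (T vs) - ?S)) \<in> E_rel V (vflags v \<union> flags_of vs)"
    by (intro pm.subspace_scale[OF subspace_E_rel]
        E_rel_tensor2_left[OF E_space_tensor_space[OF ok(3)] Cons.IH[OF ok(1)] ok(2)])
  ultimately have "tensor2 (E_diff V (A v) - ?dA) (T vs) + pscale ?p (tensor2 (A v) (E_diff V (T vs) - ?S))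
      \<in> E_rel V (vflags v \<union> flags_of vs)"
    by (rule pm.subspace_add[OF subspace_E_rel])
  moreover have "(\<Sum>i<length (v # vs). pscale (psign (sum_list (map vpar (take i (v # vs)))))
      (T ((v # vs)[i := vertex_diff \<O> ((v # vs) ! i)]))) = tensor2 ?dA (T vs) + pscale ?p (tensor2 (A v) ?S)"
    by (simp add: sum.lessThan_Suc_shift tensor2_linear psign_add pscale_sum del: sum.lessThan_Suc)
  ultimately show ?case
    by (simp add: E_diff_tensor2[OF ok(3)] tensor2_linear pscale_diff algebra_simps)
qed

lemma flags_of_filter:
  "flags_of (filter P vs) \<union> flags_of (filter (\<lambda>v. \<not> P v) vs) = flags_of vs"
  "disjoint_flags vs \<Longrightarrow> flags_of (filter P vs) \<inter> flags_of (filter (\<lambda>v. \<not> P v) vs) = {}"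
  by auto (induction vs, auto)

lemma vertices_ok_filter: "vertices_ok vs \<Longrightarrow> vertices_ok (filter P vs)"
  by (simp add: vertices_ok_def sorted_wrt_filter)

text \<open>Reordering vertices agrees with reordering the tensor factors, with the same Koszul sign.\<close>

lemma vertex_tensor_unshuffle:
  assumes "vertices_ok vs"
  shows "T vs - pscale (psign (unshuffle_par vpar P vs)) (T (filter P vs @ filter (\<lambda>v. \<not> P v) vs))
    \<in> E_rel V (flags_of vs)"
  using assms
proof (induction vs)
  case Nil
  then show ?case by (simp add: E_rel_def pm.span_zero)
next
  case (Cons v vs)
  note ok = vertices_ok_Cons[OF Cons.prems]
  let ?X = "T (filter P vs)" and ?Y = "T (filter (\<lambda>v. \<not> P v) vs)"
  let ?u = "psign (unshuffle_par vpar P vs) :: 'k" and ?x = "sum_list (map vpar (filter P vs))"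
  have 1: "tensor2 (A v) (T vs - pscale ?u (tensor2 ?X ?Y)) \<in> E_rel V (vflags v \<union> flags_of vs)"
    using E_rel_tensor2_left[OF E_space_tensor_space[OF ok(3)] Cons.IH[OF ok(1)] ok(2)] by simp
  show ?case
  proof (cases "P v")
    case True
    then show ?thesis using 1 by (simp add: tensor2_linear)
  next
    case False
    let ?e = "psign (vpar v * ?x) :: 'k"
    have okf: "vertices_ok (filter P vs)" "vertices_ok (filter (\<lambda>v. \<not> P v) vs)"
      using ok(1) by (simp_all add: vertices_ok_filter)
    have d: "disjoint_flags vs" using ok(1) by (simp add: vertices_ok_def)
    have "vflags v \<inter> flags_of (filter P vs) = {}" using ok(2) by auto
    from E_rel_tensor2_commute[OF ok(3) vertex_tensor_mem[OF okf(1)] this]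
    have "tensor2 (A v) ?X - pscale ?e (tensor2 ?X (A v)) \<in> E_rel V (vflags v \<union> flags_of (filter P vs))" .
    then have "tensor2 (tensor2 (A v) ?X - pscale ?e (tensor2 ?X (A v))) ?Y
        \<in> E_rel V ((vflags v \<union> flags_of (filter P vs)) \<union> flags_of (filter (\<lambda>v. \<not> P v) vs))"
      using ok(2) flags_of_filter(2)[OF d, of P] vertex_tensor_space[OF okf(2)]
      by (intro E_rel_tensor2_right) auto
    then have "pscale ?u (tensor2 (tensor2 (A v) ?X - pscale ?e (tensor2 ?X (A v))) ?Y)
        \<in> E_rel V (vflags v \<union> flags_of vs)"
      unfolding Un_assoc flags_of_filter(1) by (rule pm.subspace_scale[OF subspace_E_rel])
    from pm.subspace_add[OF subspace_E_rel 1 this] show ?thesis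
      using False by (simp add: tensor2_linear tensor2_assoc pscale_diff psign_add mult_ac)
  qed
qed

text \<open>Contracting an edge of the graph corresponds to contracting its two letters by the inner product: once the
factors at the edge are in front, the contraction only sees these factors, and there it is
the composition in \<open>\<E>(V)\<close>, which \<open>\<alpha>\<close> compares with the composition in \<open>\<O>\<close>.\<close>

lemma contraction_collapse:
  assumes G: "legless \<O> (vs, es)" "j < length es" and e: "e = es ! j"
  shows "contraction V (\<lambda>x. x) e (T vs)
      - pscale (psign (unshuffle_par vpar (\<lambda>v. vflags v \<inter> e \<noteq> {}) vs)) (T (contract_edge_vertices \<O> e vs))
    \<in> E_rel V (flags_of vs - e)"
proof -
  have disjointI: "(X - e) \<inter> Y = {}" if "X \<inter> Y = {}" for X Y :: "nat set" using that by blast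
  have unionI: "(X - e) \<union> Y = Z - e" if "X \<union> Y = Z" "e \<inter> Y = {}" for X Y Z :: "nat set" using that by blast
  let ?P = "\<lambda>v :: 'o vertex. vflags v \<inter> e \<noteq> {}"
  let ?touch = "filter ?P vs" and ?rest = "filter (\<lambda>v. vflags v \<inter> e = {}) vs"
  let ?c = "collapse \<O> (?touch, [e])" and ?K = "contraction V (\<lambda>x. x) e"
  let ?u = "psign (unshuffle_par vpar ?P vs) :: 'k"
  note touch = decorated_touch[OF G e refl refl] flags_touch_rest[OF G e refl refl]
  note legs = collapse_touch_flags[OF G e refl refl]
  have ok: "vertices_ok vs" "vertices_ok ?rest"
    using legless_vertices_ok[OF G(1)] by (simp_all add: vertices_ok_filter)
  have "T vs - pscale ?u (tensor2 (T ?touch) (T ?rest)) \<in> E_rel V (flags_of vs)"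
    using vertex_tensor_unshuffle[OF ok(1), of ?P] by simp
  then have "?K (T vs - pscale ?u (tensor2 (T ?touch) (T ?rest))) \<in> E_rel V (flags_of vs - e)"
    by (rule contraction_E_rel[OF id_adj])
  moreover have "?K (tensor2 (T ?touch) (T ?rest)) = tensor2 (?K (T ?touch)) (T ?rest)"
    by (rule contraction_tensor2[OF vertex_tensor_space[OF ok(2)]]) auto
  ultimately have 1: "?K (T vs) - pscale ?u (tensor2 (?K (T ?touch)) (T ?rest)) \<in> E_rel V (flags_of vs - e)"
    by (simp add: plinearD[OF plinear_contraction])
  have "op_form V (\<lambda>x. x) = form_letters V"
    by (intro ext) (simp add: op_form_def form_letters_def)
  then have "E_comp V (underlying_graph (?touch, [e])) (map A ?touch) = ?K (T ?touch)"
    by (simp add: E_comp_def contract_edges_def underlying_graph_def contraction_def vertex_tensor_def)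
  then have 2: "A ?c - ?K (T ?touch) \<in> E_rel V (flags_of ?touch - e)"
    using comp[OF touch(1) refl] legs by (simp add: collapse_def)
  have "tensor2 (A ?c - ?K (T ?touch)) (T ?rest) \<in> E_rel V ((flags_of ?touch - e) \<union> flags_of ?rest)"
    by (rule E_rel_tensor2_right[OF 2 vertex_tensor_space[OF ok(2)]]) (rule disjointI[OF touch(3)])
  also have "(flags_of ?touch - e) \<union> flags_of ?rest = flags_of vs - e"
    by (rule unionI[OF touch(2,4)])
  finally have "pscale ?u (tensor2 (A ?c - ?K (T ?touch)) (T ?rest)) \<in> E_rel V (flags_of vs - e)"
    by (rule pm.subspace_scale[OF subspace_E_rel])
  from pm.subspace_diff[OF subspace_E_rel 1 this] show ?thesis
    by (simp add: contract_edge_vertices_def tensor2_linear pscale_diff)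
qed

lemma legless_vertex_diff:
  assumes "legless \<O> (vs, es)" "i < length vs"
  shows "legless \<O> (vs[i := vertex_diff \<O> (vs ! i)], es)"
proof -
  have "vs = take i vs @ vs ! i # drop (Suc i) vs" by (rule id_take_nth_drop[OF assms(2)])
  then have l: "legless \<O> (take i vs @ vs ! i # drop (Suc i) vs, es)" using assms(1) by metis
  have "vs ! i \<in> set vs" using assms(2) by simp
  from bspec[OF conjunct1[OF legless_vertices_ok[OF assms(1), unfolded vertices_ok_def]] this]
  have "stable (vgenus (vs ! i)) (vflags (vs ! i))"
    "vdec (vs ! i) \<in> ospace \<O> (vgenus (vs ! i)) (vflags (vs ! i)) (vpar (vs ! i))"
    by simp_all
  then have "legless \<O> (take i vs @ vertex_diff \<O> (vs ! i) # drop (Suc i) vs, es)"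
    by (intro legless_replace[OF l]) (simp_all add: vertex_diff_def odiff_mem)
  then show ?thesis by (simp add: upd_conv_take_nth_drop[OF assms(2)])
qed

text \<open>The signs of the differential of the graph complex are exactly those of \<open>total_boundary\<close>, after
\<open>E_diff_vertex_tensor\<close> and \<open>contraction_collapse\<close> have absorbed the signs of the
vertices.\<close>

lemma amplitude_Fdual_diff_graph:
  assumes "legless \<O> (vs, es)"
  shows "amplitude (Fdual_diff_graph \<O> (vs, es)) = lookup (total_boundary V Q es (T vs)) []"
proof -
  have gv: "graph_value (vs, es) = lookup (Q es (T vs)) []" if "legless \<O> (vs, es)" for vs es
    using that by (simp add: graph_value_def)
  have flags: "\<Union>(set es) = flags_of vs" using assms by (simp add: legless_iff)
  note lin = amplitude_def lin_ext_scalar_add lin_ext_scalar_sum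
  note Qlin = plinearD[OF Q_linear]
  have "lookup (Q es (E_diff V (T vs))) [] = lookup (Q es (\<Sum>i<length vs.
      pscale (psign (sum_list (map vpar (take i vs)))) (T (vs[i := vertex_diff \<O> (vs ! i)])))) []"
    by (rule Q_value_cong) (simp only: flags E_diff_vertex_tensor[OF legless_vertices_ok[OF assms]])
  also have "\<dots> = (\<Sum>i<length vs. psign (sum_list (map vpar (take i vs)))
      * graph_value (vs[i := vertex_diff \<O> (vs ! i)], es))"
    by (simp add: Qlin lookup_sum gv[OF legless_vertex_diff[OF assms]])
  finally have internal: "(\<Sum>i<length vs. psign (of_nat (length es) + sum_list (map vpar (take i vs)))
      * graph_value (vs[i := vertex_diff \<O> (vs ! i)], es))
      = psign (of_nat (length es)) * lookup (Q es (E_diff V (T vs))) []"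
    by (simp add: psign_add sum_distrib_left mult.assoc)
  have contract: "psign (of_nat j + unshuffle_par vpar (\<lambda>v. vflags v \<inter> es ! j \<noteq> {}) vs)
      * graph_value (contract_edge_vertices \<O> (es ! j) vs, take j es @ drop (Suc j) es)
      = psign (of_nat j) * lookup (Q (take j es @ drop (Suc j) es) (contraction V (\<lambda>x. x) (es ! j) (T vs))) []"
    if j: "j < length es" for j
  proof -
    note l = legless_contract_edge[OF assms j refl refl refl]
    have "\<Union>(set (take j es @ drop (Suc j) es)) = flags_of (contract_edge_vertices \<O> (es ! j) vs)"
      using l by (simp add: legless_iff)
    also have "\<dots> = flags_of vs - es ! j"
      using collapse_touch_flags[OF assms j refl refl refl] flags_touch_rest[OF assms j refl refl refl]
      by (auto simp: contract_edge_vertices_def)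
    finally have "contraction V (\<lambda>x. x) (es ! j) (T vs)
      - pscale (psign (unshuffle_par vpar (\<lambda>v. vflags v \<inter> es ! j \<noteq> {}) vs)) (T (contract_edge_vertices \<O> (es ! j) vs))
      \<in> E_rel V (\<Union>(set (take j es @ drop (Suc j) es)))"
      using contraction_collapse[OF assms j refl] by simp
    from Q_value_cong[OF this] show ?thesis
      by (simp add: Qlin gv[OF l] psign_add mult.assoc)
  qed
  show ?thesis
    by (simp add: Fdual_diff_graph_def Let_def lin total_boundary_def lookup_add lookup_sum internal contract)
qed

lemma amplitude_Fdual_diff:
  "amplitude (Fdual_diff \<O> c) =
   lin_ext_scalar (\<lambda>\<Gamma>. if legless \<O> \<Gamma> then lookup (total_boundary V Q (snd \<Gamma>) (T (fst \<Gamma>))) [] else 0) c"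
proof -
  have "amplitude (if legless \<O> \<Gamma> then Fdual_diff_graph \<O> \<Gamma> else 0) =
      (if legless \<O> \<Gamma> then lookup (total_boundary V Q (snd \<Gamma>) (T (fst \<Gamma>))) [] else 0)" for \<Gamma>
    using amplitude_Fdual_diff_graph[of "fst \<Gamma>" "snd \<Gamma>"]
    by (auto simp: amplitude_def lin_ext_scalar_zero)
  then show ?thesis
    unfolding Fdual_diff_def amplitude_def lin_ext_scalar_lin_ext by simp
qed

end

section \<open>Independence of the contracting homotopy\<close>

locale homotopy_of_amplitudes =
  modular_operad \<O> + operad_algebra \<O> V \<alpha> + homotopy_path V s \<delta> r
  for \<O> :: "('k::field_char_0, 'o::ab_group_add) modop"
    and V :: "('k, 'v::ab_group_add) ipdg"
    and \<alpha> :: "nat \<Rightarrow> nat set \<Rightarrow> 'o \<Rightarrow> ('v letter list \<Rightarrow>\<^sub>0 'k)"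
    and s \<delta> r
begin

sublocale AG: contracted_algebra \<O> V \<alpha> "G a" for a
  by (intro contracted_algebra.intro modular_operad_axioms operad_algebra_axioms G.edge_contraction_axioms)

sublocale AH: contracted_algebra \<O> V \<alpha> "H a" for a
  by (intro contracted_algebra.intro modular_operad_axioms operad_algebra_axioms H.edge_contraction_axioms)

lemma lookup_E_diff_Nil:
  assumes "t \<in> tensor_space V {}"
  shows "lookup (E_diff V t) [] = 0"
proof -
  have "keys t \<subseteq> {[]}" using assms by (auto simp: tensor_space_def tensor_words_iff)
  then have "t = single [] (lookup t [])"
    by (intro poly_mapping_eqI) (auto simp: lookup_single when_def in_keys_iff)
  then have "E_diff V t = 0" using E_diff_Nil[of V "lookup t []"] by metis
  then show ?thesis by simp
qed

lemma legless_facts: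
  assumes "legless \<O> (vs, es)"
  shows "vertex_tensor \<alpha> vs \<in> tensor_space V (\<Union>(set es))" "sorted_wrt (\<lambda>e f. e \<inter> f = {}) es"
  using AG.vertex_tensor_space[OF AG.legless_vertices_ok[OF assms]] legless_sorted_edges[OF assms] assms
  by (simp_all add: legless_iff)

text \<open>After all contractions only a scalar is left, on which the differential of the tensor powers
vanishes; so \<open>total_boundary_G\<close> says that the amplitude is closed.\<close>

lemma amplitude_G_cycle: "AG.amplitude a \<in> F_cycles \<O>"
proof -
  have "lookup (total_boundary V (G a) (snd \<Gamma>) (vertex_tensor \<alpha> (fst \<Gamma>))) [] = 0" if "legless \<O> \<Gamma>" for \<Gamma>
  proof -
    have l: "legless \<O> (fst \<Gamma>, snd \<Gamma>)" using that by simp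
    note f = legless_facts[OF l]
    show ?thesis
      unfolding total_boundary_G[OF f] using G_mem[OF f(1), of a "snd \<Gamma>"] by (intro lookup_E_diff_Nil) simp
  qed
  then have "AG.amplitude a (Fdual_diff \<O> c) = 0" for c
    unfolding AG.amplitude_Fdual_diff lin_ext_scalar_def by (intro sum.neutral) auto
  then show ?thesis
    using AG.amplitude_in_F_space by (auto simp: F_cycles_def F_diff_def fun_eq_iff)
qed

lemma amplitude_H_boundary:
  "F_diff \<O> (AH.amplitude a) = AG.amplitude (\<lambda>k. of_nat k * a (k - 1))"
proof
  fix c
  have "(if legless \<O> \<Gamma> then lookup (total_boundary V (H a) (snd \<Gamma>) (vertex_tensor \<alpha> (fst \<Gamma>))) [] else 0)
     = AG.graph_value (\<lambda>k. of_nat k * a (k - 1)) \<Gamma>" for \<Gamma>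
  proof (cases "legless \<O> \<Gamma>")
    case True
    then have l: "legless \<O> (fst \<Gamma>, snd \<Gamma>)" by simp
    note f = legless_facts[OF l]
    have "lookup (E_diff V (H a (snd \<Gamma>) (vertex_tensor \<alpha> (fst \<Gamma>)))) [] = 0"
      using H_mem[OF f(1), of a "snd \<Gamma>"] by (intro lookup_E_diff_Nil) simp
    then show ?thesis
      unfolding total_boundary_H[OF f] AG.graph_value_def using True by (simp add: lookup_minus)
  qed (simp add: AG.graph_value_def)
  then show "F_diff \<O> (AH.amplitude a) c = AG.amplitude (\<lambda>k. of_nat k * a (k - 1)) c"
    by (simp add: F_diff_def AH.amplitude_Fdual_diff AG.amplitude_def)
qed

lemma amplitude_G_diff:
  "AG.amplitude (\<lambda>k. a k - b k) c = AG.amplitude a c - AG.amplitude b c"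
proof -
  have "G (\<lambda>k. a k - b k) es t = G a es t - G b es t" for es t
    using G_add[of "\<lambda>k. a k - b k" b es t] by (simp add: eq_diff_eq)
  then have "AG.graph_value (\<lambda>k. a k - b k) \<Gamma> = AG.graph_value a \<Gamma> - AG.graph_value b \<Gamma>" for \<Gamma>
    by (simp add: AG.graph_value_def lookup_minus)
  then show ?thesis
    by (simp add: AG.amplitude_def lin_ext_scalar_def right_diff_distrib sum_subtractf)
qed

text \<open>The sign in \<open>propagator\<close> is the one that moves \<open>s'\<close> to the first argument of the inner product.\<close>

lemma propagator_contraction:
  assumes "self_adjoint 1 s'" "t \<in> tensor_space V I"
  shows "lin_ext (contract_word (propagator V s') e) t = contraction V s' e t"
proof (rule plinear_eqI[where t = t])
  fix w assume "w \<in> keys t"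
  then have "w \<in> tensor_words V I" using assms(2) by (auto simp: tensor_space_def)
  then have ok: "list_all (letter_ok V) (filter (\<lambda>l. llabel l \<in> e) w)"
    by (auto simp: tensor_words_iff list_all_iff)
  have "pair_form (propagator V s') ls = pair_form (op_form V s') ls" if "list_all (letter_ok V) ls" for ls
    using that self_adjointD(4)[OF assms(1)]
    by (auto simp: pair_form_def propagator_def op_form_def letter_ok_def split: list.splits)
  from this[OF ok]
  show "lin_ext (contract_word (propagator V s') e) (single w 1) = contraction V s' e (single w 1)"
    by (simp add: contraction_def contract_word_eq contract_with_def)
qed (intro plinear_lin_ext plinear_contraction)+

lemma G_zero: "G (\<lambda>k. 0) es t = 0"
  by (induction es) (simp_all add: plinearD[OF plinear_contraction])

lemma contract_edges_start:
  assumes "t \<in> tensor_space V I"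
  shows "contract_edges (propagator V s) es t = G (\<lambda>k. if k = 0 then 1 else 0) es t"
proof (induction es)
  case (Cons e es)
  then show ?case
    using propagator_contraction[OF s_adj G_mem[OF assms]]
    by (simp add: contract_edges_def G_zero plinearD[OF plinear_contraction])
qed (simp add: contract_edges_def)

lemma contract_edges_end:
  assumes "t \<in> tensor_space V I" "self_adjoint 1 s'" "\<And>x. s' x = s x + \<delta> x"
  shows "contract_edges (propagator V s') es t = G (\<lambda>k. 1) es t"
proof (induction es)
  case (Cons e es)
  have "contraction V s' e u = C s e u + C \<delta> e u" for u
  proof (rule plinear_eqI[where t = u])
    fix w
    have "op_form V s' a b = op_form V s a b + op_form V \<delta> a b" for a b
      by (simp add: op_form_def assms(3) form_add)
    then have "pair_form (op_form V s') ls = pair_form (op_form V s) ls + pair_form (op_form V \<delta>) ls" for ls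
      by (auto simp: pair_form_def split: list.splits)
    then show "contraction V s' e (single w 1) = C s e (single w 1) + C \<delta> e (single w 1)"
      by (simp add: contraction_def contract_word_eq contract_with_def distrib_left single_add)
  qed (intro plinear_intros plinear_contraction)+
  then show ?case
    using Cons propagator_contraction[OF assms(2) G_mem[OF assms(1)]]
    by (simp add: contract_edges_def)
qed (simp add: contract_edges_def)

lemma feynman_amplitude_eqI:
  assumes "\<And>t I es. t \<in> tensor_space V I \<Longrightarrow> contract_edges (propagator V s') es t = G a es t"
  shows "feynman_amplitude \<O> V \<alpha> s' = AG.amplitude a"
proof -
  have "(if legless \<O> \<Gamma> then amplitude_graph V \<alpha> s' \<Gamma> else 0) = AG.graph_value a \<Gamma>" for \<Gamma>
    using assms[OF legless_facts(1)[of "fst \<Gamma>" "snd \<Gamma>"]]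
    by (simp add: AG.graph_value_def amplitude_graph_def vertex_tensor_def)
  then show ?thesis by (simp add: feynman_amplitude_def AG.amplitude_def)
qed

end

lemma (in inner_dg_space) contracting_homotopy_adjoint:
  "contracting_homotopy V s \<Longrightarrow> self_adjoint 1 s"
  by (simp add: contracting_homotopy_def self_adjoint_def)

text \<open>For the primitive: \<open>[d, ss'] = s' - s\<close>, because \<open>[d, s] = 1\<close> and \<open>[d, s'] = 1\<close>, and likewise
\<open>[d, s's] = s - s'\<close>.  Passing to the adjoint exchanges \<open>ss'\<close> with \<open>- s's\<close>, so the
antisymmetrisation is self-adjoint and has the same commutator with \<open>d\<close> as \<open>ss'\<close>.\<close>

lemma (in inner_dg_space) contracting_homotopies_path:
  assumes "contracting_homotopy V s" "contracting_homotopy V s'"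
  shows "homotopy_path V s (\<lambda>x. s' x - s x) (\<lambda>x. vscale V (1 / 2) (s (s' x) - s' (s x)))"
proof -
  interpret vs: vector_space "vscale V" by (rule vector_space_V)
  note sa = contracting_homotopy_adjoint[OF assms(1)] and sa' = contracting_homotopy_adjoint[OF assms(2)]
  note lin = self_adjointD(1,2)[OF sa] self_adjointD(1,2)[OF sa']
  have d: "vdiff V (x + y) = vdiff V x + vdiff V y" "vdiff V (vscale V c x) = vscale V c (vdiff V x)" for x y c
    using diff_linear by (simp_all add: Vector_Spaces.linear_iff)
  have dm: "vdiff V (x - y) = vdiff V x - vdiff V y" for x y
    using d(1)[of "x - y" y] by (simp add: eq_diff_eq)
  have sm: "s (x - y) = s x - s y" "s' (x - y) = s' x - s' y" for x y
    using lin(1)[of "x - y" y] lin(3)[of "x - y" y] by (simp_all add: eq_diff_eq)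
  have h: "vdiff V (s x) + s (vdiff V x) = x" "vdiff V (s' x) + s' (vdiff V x) = x" for x
    using assms by (auto simp: contracting_homotopy_def)
  have h': "vdiff V (s x) = x - s (vdiff V x)" "vdiff V (s' x) = x - s' (vdiff V x)" for x
    using h[of x] by (simp_all add: eq_diff_eq)
  have vm: "x - y \<in> vspace V p" if "x \<in> vspace V p" "y \<in> vspace V p" for x y p
    using vspace_add[OF that(1) vspace_scale[OF that(2), of "- 1"]] by simp
  have fm: "vform V z (x - y) = vform V z x - vform V z y" for x y z
    using form_add(2)[of z "x - y" y] by simp
  show ?thesis
  proof (intro homotopy_path.intro homotopy_path_axioms.intro inner_dg_space_axioms sa)
    show "self_adjoint 1 (\<lambda>x. s' x - s x)"
      unfolding self_adjoint_def
      by (auto simp: Vector_Spaces.linear_iff vector_space_V lin vs.scale_right_diff_distrib form_minus fm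
          right_diff_distrib intro!: vm self_adjointD[OF sa] self_adjointD[OF sa'])
        (simp add: self_adjointD(4)[OF sa] self_adjointD(4)[OF sa'])
    have adj2: "vform V (s (s' a)) b = - vform V a (s' (s b))" "vform V (s' (s a)) b = - vform V a (s (s' b))"
      if "a \<in> vspace V p" for a b p
      using self_adjointD(4)[OF sa self_adjointD(3)[OF sa' that]] self_adjointD(4)[OF sa' that]
        self_adjointD(4)[OF sa' self_adjointD(3)[OF sa that]] self_adjointD(4)[OF sa that]
      by (simp_all add: psign_add)
    have par2: "s (s' v) \<in> vspace V p" "s' (s v) \<in> vspace V p" if "v \<in> vspace V p" for v p
      using self_adjointD(3)[OF sa self_adjointD(3)[OF sa' that]]
        self_adjointD(3)[OF sa' self_adjointD(3)[OF sa that]]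
      by (simp_all add: add.assoc)
    show "self_adjoint 0 (\<lambda>x. vscale V (1 / 2) (s (s' x) - s' (s x)))"
      unfolding self_adjoint_def
      by (auto simp: Vector_Spaces.linear_iff vector_space_V lin vs.scale_right_diff_distrib
          vs.scale_right_distrib form_minus fm form_add adj2 mult.commute
          intro!: vm vspace_scale par2)
    fix x
    show "vdiff V (s x) + s (vdiff V x) = x" by (rule h)
    show "vdiff V (s' x - s x) + (s' (vdiff V x) - s (vdiff V x)) = 0"
      by (simp add: dm h')
    have "vscale V (1 / 2) (s' x - s x) + vscale V (1 / 2) (s' x - s x) = s' x - s x"
      by (simp flip: vs.scale_left_distrib)
    then show "vdiff V (vscale V (1 / 2) (s (s' x) - s' (s x))) - vscale V (1 / 2) (s (s' (vdiff V x)) - s' (s (vdiff V x))) = s' x - s x"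
      by (simp add: d dm h' sm vs.scale_right_diff_distrib algebra_simps)
  qed
qed

lemma F_space_linear: "f \<in> F_space \<O> \<Longrightarrow> h \<in> F_space \<O> \<Longrightarrow> (\<lambda>c. a * f c + b * h c) \<in> F_space \<O>"
  by (auto simp: F_space_def Vector_Spaces.linear_iff algebra_simps)

lemma F_space_zero: "(\<lambda>c. 0) \<in> F_space (\<O> :: ('k::field_char_0, 'o::ab_group_add) modop)"
proof -
  have "vector_space ((*) :: 'k \<Rightarrow> 'k \<Rightarrow> 'k)" by unfold_locales (auto simp: algebra_simps)
  then show ?thesis by (simp add: F_space_def Vector_Spaces.linear_iff vector_space_pscale)
qed

lemma equiv_F_homologous: "equiv (F_cycles \<O>) (F_homologous \<O>)"
proof (rule equivI)
  show "refl_on (F_cycles \<O>) (F_homologous \<O>)"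
    using F_space_zero[of \<O>] by (auto simp: refl_on_def F_homologous_def F_diff_def comp_def)
  show "sym (F_homologous \<O>)"
  proof (rule symI)
    fix f f' assume "(f, f') \<in> F_homologous \<O>"
    then obtain h where h: "f \<in> F_cycles \<O>" "f' \<in> F_cycles \<O>" "h \<in> F_space \<O>" "(\<lambda>c. f c - f' c) = F_diff \<O> h"
      by (auto simp: F_homologous_def)
    have "(\<lambda>c. - 1 * h c + 0 * h c) \<in> F_space \<O>" by (rule F_space_linear[OF h(3,3)])
    moreover have "(\<lambda>c. f' c - f c) = F_diff \<O> (\<lambda>c. - 1 * h c + 0 * h c)"
      using h(4) by (auto simp: F_diff_def fun_eq_iff algebra_simps)
    ultimately show "(f', f) \<in> F_homologous \<O>" using h(1,2) by (auto simp: F_homologous_def)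
  qed
  show "trans (F_homologous \<O>)"
  proof (rule transI)
    fix f f' f'' assume "(f, f') \<in> F_homologous \<O>" "(f', f'') \<in> F_homologous \<O>"
    then obtain h h' where h: "f \<in> F_cycles \<O>" "f'' \<in> F_cycles \<O>" "h \<in> F_space \<O>" "h' \<in> F_space \<O>"
      "(\<lambda>c. f c - f' c) = F_diff \<O> h" "(\<lambda>c. f' c - f'' c) = F_diff \<O> h'"
      by (auto simp: F_homologous_def)
    have "(\<lambda>c. 1 * h c + 1 * h' c) \<in> F_space \<O>" by (rule F_space_linear[OF h(3,4)])
    moreover have "(\<lambda>c. f c - f'' c) = F_diff \<O> (\<lambda>c. 1 * h c + 1 * h' c)"
    proof
      fix c
      have "f c - f' c = h (Fdual_diff \<O> c)" "f' c - f'' c = h' (Fdual_diff \<O> c)"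
        using h(5,6) by (auto simp: F_diff_def fun_eq_iff)
      then have "f c - f'' c = h (Fdual_diff \<O> c) + h' (Fdual_diff \<O> c)"
        by (metis diff_add_cancel add_diff_eq)
      then show "f c - f'' c = F_diff \<O> (\<lambda>c. 1 * h c + 1 * h' c) c" by (simp add: F_diff_def)
    qed
    ultimately show "(f, f'') \<in> F_homologous \<O>" using h(1,2) by (auto simp: F_homologous_def)
  qed
qed (auto simp: F_homologous_def)

theorem proposition6p1:
  fixes \<O> :: "('k::field_char_0, 'o::ab_group_add) modop"
    and V :: "('k, 'v::ab_group_add) ipdg"
    and \<alpha> :: "nat \<Rightarrow> nat set \<Rightarrow> 'o \<Rightarrow> ('v letter list \<Rightarrow>\<^sub>0 'k)"
    and s s' :: "'v \<Rightarrow> 'v"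
  assumes "modular_operad \<O>"
    and "inner_dg_space V"
    and "contractible V"
    and "operad_algebra \<O> V \<alpha>"
    and "contracting_homotopy V s"
    and "contracting_homotopy V s'"
  shows "dual_class \<O> V \<alpha> s \<in> F_homology \<O> \<and>
         dual_class \<O> V \<alpha> s' \<in> F_homology \<O> \<and>
         dual_class \<O> V \<alpha> s = dual_class \<O> V \<alpha> s'"
proof -
  interpret inner_dg_space V by fact
  let ?\<delta> = "\<lambda>x. s' x - s x" and ?r = "\<lambda>x. vscale V (1 / 2) (s (s' x) - s' (s x))"
  interpret homotopy_of_amplitudes \<O> V \<alpha> s ?\<delta> ?r
    by (intro homotopy_of_amplitudes.intro contracting_homotopies_path assms)
  \<comment> \<open>the moments of evaluation at \<open>t = 0\<close> and at \<open>t = 1\<close>\<close>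
  let ?a0 = "\<lambda>k::nat. if k = 0 then 1 else 0 :: 'k" and ?a1 = "\<lambda>k::nat. 1 :: 'k"
  have Z: "feynman_amplitude \<O> V \<alpha> s = AG.amplitude ?a0"
    by (intro feynman_amplitude_eqI contract_edges_start)
  have Z': "feynman_amplitude \<O> V \<alpha> s' = AG.amplitude ?a1"
    by (intro feynman_amplitude_eqI contract_edges_end contracting_homotopy_adjoint assms) simp_all
  \<comment> \<open>integration over the unit interval has the moments \<open>1 / (k + 1)\<close>\<close>
  have "(\<lambda>k. of_nat k * (1 / of_nat (Suc (k - 1)))) = (\<lambda>k. ?a1 k - ?a0 k)"
  proof
    fix k show "of_nat k * (1 / of_nat (Suc (k - 1))) = ?a1 k - ?a0 k"
      by (cases k) (auto simp del: of_nat_Suc)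
  qed
  then have "F_diff \<O> (AH.amplitude (\<lambda>k. 1 / of_nat (Suc k))) = AG.amplitude (\<lambda>k. ?a1 k - ?a0 k)"
    unfolding amplitude_H_boundary by simp
  then have "(\<lambda>c. AG.amplitude ?a1 c - AG.amplitude ?a0 c) = F_diff \<O> (AH.amplitude (\<lambda>k. 1 / of_nat (Suc k)))"
    by (simp add: amplitude_G_diff fun_eq_iff)
  then have "(AG.amplitude ?a1, AG.amplitude ?a0) \<in> F_homologous \<O>"
    unfolding F_homologous_def using amplitude_G_cycle AH.amplitude_in_F_space by blast
  from equiv_class_eq[OF equiv_F_homologous this] show ?thesis
    unfolding dual_class_def F_homology_def Z Z' using amplitude_G_cycle by (auto intro: quotientI)
qed

end
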